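(* Let $A\in\mathbb{R}^{n\times n}$ and $C_i\in\mathbb{R}^{m_i\times n}$, $i=1,\ldots,N$, let $C=\mathrm{col}(C_1,\ldots,C_N)$, and consider the plant with local measurements $$\dot x(t)=Ax(t),\qquad y_i(t)=C_ix(t),\quad i=1,\ldots,N,\qquad t\ge 0,$$ where $x(t)\in\mathbb{R}^n$. Let $\mathcal{G}_{\sigma(t)}$ be an undirected switching graph on the nodes $\{1,\ldots,N\}$, with weighted adjacency matrix $\mathcal{A}_{\sigma(t)}=[a_{ij}(t)]_{i,j=1}^N$. Assume: (1) $A$ is neutrally stable, i.e. all eigenvalues of $A$ are semi-simple with zero real parts; (2) the pair $(C,A)$ is observable; (3) $\mathcal{G}_{\sigma(t)}$ is jointly connected. Let $P\in\mathbb{R}^{n\times n}$ be any nonsingular matrix such that $P^{-1}AP$ is skew-symmetric (one may take $P=I_n$ if $A$ itself is skew-symmetric). For $i=1,\ldots,N$ let $\gamma_i>0$ be arbitrary (possibly distinct) and let $L_i\in\mathbb{R}^{n\times m_i}$, $M_i\in\mathbb{R}^{n\times n}$ be the matrices defined in the context. Then the local observers $$\dot{\hat x}_i(t)=A\hat x_i(t)+L_i\bigl(y_i(t)-C_i\hat x_i(t)\bigr)+\gamma_iM_i\sum_{j=1}^Na_{ij}(t)\bigl(\hat x_j(t)-\hat x_i(t)\bigr),\qquad t\ge 0,\quad i=1,\ldots,N,$$ solve the distributed exponential state estimation problem: for any initial conditions $x(0)\in\mathbb{R}^n$ and $\hat x_i(0)\in\mathbb{R}^n$, $i=1,\ldots,N$,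 one has $\lim_{t\to\infty}(\hat x_i(t)-x(t))=0$ exponentially for every $i=1,\ldots,N$.
   Context: **Notation.** $\mathrm{col}(X_1,\ldots,X_N)=[X_1^T\ \cdots\ X_N^T]^T$. "Convergence to $0$ exponentially" means that the norm is bounded by $ce^{-\lambda t}$ for all $t\ge0$, for some $c\ge 0$, $\lambda>0$. Blocks of zero size are allowed. Solutions are continuous and satisfy the differential equations except at switching instants. **Switching signal and graph.** $\sigma:[0,\infty)\to\mathcal{P}=\{1,\ldots,n_0\}$ is a piecewise constant switching signal: there is a sequence $\{t_j:j=0,1,2,\ldots\}$ (the switching instants) with $t_0=0$ and $t_{j+1}-t_j\ge\tau$ for all $j$, for some $\tau>0$ (the dwell time), such that $\sigma$ is constant on each $[t_j,t_{j+1})$. There are $n_0$ undirected graphs $\mathcal{G}_p=(\mathcal{V},\mathcal{E}_p)$, $p\in\mathcal{P}$, on $\mathcal{V}=\{1,\ldots,N\}$, each with a weighted adjacency matrix $\mathcal{A}_p=[a_{ij}]\in\mathbb{R}^{N\times N}$ that is symmetric, with $a_{ii}=0$ and, for $i\ne j$, $a_{ij}>0$ if $(j,i)\in\mathcal{E}_p$ and $a_{ij}=0$ otherwise. The switching graph is $\mathcal{G}_{\sigma(t)}=(\mathcal{V},\mathcal{E}_{\sigma(t)})$, with weighted adjacency matrix $\mathcal{A}_{\sigma(t)}=[a_{ij}(t)]$. **Jointly connected.** There exists a subsequence $\{t_{j_k}:k=0,1,2,\ldots\}$ of the switching instants with $t_{j_0}=0$ and $\tau\le t_{j_{k+1}}-t_{j_k}\le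 T_c$ for all $k$, for some $T_c>0$, such that for every $k$ the union graph $\bigcup_{t_j\in[t_{j_k},t_{j_{k+1}})}\mathcal{G}_{\sigma(t_j)}$ (node set $\mathcal{V}$, edge set the union of the edge sets) is connected. **Design of $L_i$, $M_i$.** Let $\mathcal{O}_i=\mathrm{col}(C_i,C_iA,\ldots,C_iA^{n-1})$ and $\nu_i=n-\mathrm{rank}(\mathcal{O}_i)$. Let $U_i\in\mathbb{R}^{n\times\nu_i}$ have columns forming an orthonormal basis of $\ker(\mathcal{O}_iP)$, let $D_i\in\mathbb{R}^{n\times(n-\nu_i)}$ have columns forming an orthonormal basis of $\mathrm{im}(P^T\mathcal{O}_i^T)$, and let $T_i=[D_i\ \ U_i]$, an orthogonal matrix. Then $$(PT_i)^{-1}A(PT_i)=\begin{bmatrix}A_{io}&0\\0&A_{i\bar o}\end{bmatrix},\qquad C_iPT_i=\begin{bmatrix}C_{io}&0\end{bmatrix},$$ with $A_{io}\in\mathbb{R}^{(n-\nu_i)\times(n-\nu_i)}$, $A_{i\bar o}\in\mathbb{R}^{\nu_i\times\nu_i}$, $C_{io}\in\mathbb{R}^{m_i\times(n-\nu_i)}$, and $(C_{io},A_{io})$ observable. Choose any $L_{io}\in\mathbb{R}^{(n-\nu_i)\times m_i}$ such that $A_{io}-L_{io}C_{io}$ is Hurwitz, and set $$L_i=PT_i\begin{bmatrix}L_{io}\\0\end{bmatrix},\qquad M_i=PT_i\begin{bmatrix}0&0\\0&I_{\nu_i}\end{bmatrix}T_i^TP^{-1}.$$ **Distributed exponential state estimation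 problem.** Design for each agent $i$ a local observer $\dot{\hat x}_i(t)=\mathbf{f}_i(\hat x_i(t),y_i(t),\{\hat x_j(t)-\hat x_i(t):j\in\mathcal{N}_i(t)\})$, with $\mathbf{f}_i$ linear, $\hat x_i(t)\in\mathbb{R}^n$ and $\mathcal{N}_i(t)=\{j\in\mathcal{V}:(j,i)\in\mathcal{E}_{\sigma(t)}\}$, such that for all initial conditions $\hat x_i(t)-x(t)\to0$ exponentially for $i=1,\ldots,N$. *)

theory Defs
  imports
    "HOL-Analysis.L2_Norm"
    "Jordan_Normal_Form.DL_Rank"
    "Jordan_Normal_Form.Gauss_Jordan_Elimination"
    "Jordan_Normal_Form.Matrix_Kernel"
    "Jordan_Normal_Form.Char_Poly"
    "Graph_Theory.Digraph_Component"
begin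

text \<open>
  Matrices and vectors are those of \<^theory>\<open>Jordan_Normal_Form.Matrix\<close>, since the numbers of rows
  \<open>m i\<close> and the block sizes vary with the agent. Agents are numbered \<open>0, \<dots>, N - 1\<close>, in accordance
  with the 0-based matrix indices.
\<close>


subsection \<open>Linear algebra\<close>

definition mat_inv :: "real mat \<Rightarrow> real mat" where
  "mat_inv X = the (mat_inverse X)"

definition skew_symmetric :: "real mat \<Rightarrow> bool" where
  "skew_symmetric X \<longleftrightarrow> transpose_mat X = - X"

text \<open>Block column \<open>col(X\<^sub>1, \<dots>, X\<^sub>k)\<close> of matrices with \<open>nc\<close> columns.\<close>

definition block_col :: "nat \<Rightarrow> real mat list \<Rightarrow> real mat" where
  "block_col nc Xs = mat_of_rows nc (concat (map rows Xs))"

definition complexify :: "real mat \<Rightarrow> complex mat" where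
  "complexify = map_mat complex_of_real"

text \<open>Semi-simple: the geometric multiplicity equals the algebraic multiplicity.\<close>

definition semisimple_eigenvalue :: "complex mat \<Rightarrow> complex \<Rightarrow> bool" where
  "semisimple_eigenvalue X \<mu> \<longleftrightarrow>
     eigenvalue X \<mu> \<and> kernel_dim (char_matrix X \<mu>) = order \<mu> (char_poly X)"

definition neutrally_stable :: "real mat \<Rightarrow> bool" where
  "neutrally_stable A \<longleftrightarrow>
     (\<forall>\<mu>. eigenvalue (complexify A) \<mu> \<longrightarrow> semisimple_eigenvalue (complexify A) \<mu> \<and> Re \<mu> = 0)"

definition Hurwitz :: "real mat \<Rightarrow> bool" where
  "Hurwitz X \<longleftrightarrow> (\<forall>\<mu>. eigenvalue (complexify X) \<mu> \<longrightarrow> Re \<mu> < 0)"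

definition obs_mat :: "nat \<Rightarrow> real mat \<Rightarrow> real mat \<Rightarrow> real mat" where
  "obs_mat n C A = block_col n (map (\<lambda>k. C * A ^\<^sub>m k) [0..<n])"

text \<open>The first argument of \<^const>\<open>vec_space.rank\<close> and \<^const>\<open>vec_space.col_space\<close> is the number of rows.\<close>

definition mat_rank :: "real mat \<Rightarrow> nat" where
  "mat_rank X = vec_space.rank (dim_row X) X"

definition mat_im :: "real mat \<Rightarrow> real vec set" where
  "mat_im X = vec_space.col_space (dim_row X) X"

definition observable :: "nat \<Rightarrow> real mat \<Rightarrow> real mat \<Rightarrow> bool" where
  "observable n C A \<longleftrightarrow> mat_rank (obs_mat n C A) = n"

text \<open>The columns of the \<open>n \<times> k\<close> matrix \<open>B\<close> form an orthonormal basis of the subspace \<open>S\<close>.\<close>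

definition orthonormal_basis_mat :: "nat \<Rightarrow> nat \<Rightarrow> real mat \<Rightarrow> real vec set \<Rightarrow> bool" where
  "orthonormal_basis_mat n k B S \<longleftrightarrow>
     B \<in> carrier_mat n k \<and> transpose_mat B * B = 1\<^sub>m k \<and> mat_im B = S"


subsection \<open>Switching graphs\<close>

text \<open>\<open>t 0, t 1, \<dots>\<close> are the switching instants and \<open>\<tau>\<close> is the dwell time.\<close>

definition switching_signal :: "nat \<Rightarrow> (real \<Rightarrow> nat) \<Rightarrow> (nat \<Rightarrow> real) \<Rightarrow> real \<Rightarrow> bool" where
  "switching_signal n0 \<sigma> t \<tau> \<longleftrightarrow>
     \<tau> > 0 \<and> t 0 = 0 \<and> (\<forall>j. t (Suc j) - t j \<ge> \<tau>) \<and>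
     (\<forall>s\<ge>0. \<sigma> s \<in> {1..n0}) \<and>
     (\<forall>j. \<forall>s\<in>{t j..<t (Suc j)}. \<sigma> s = \<sigma> (t j))"

text \<open>An undirected graph is a symmetric digraph; an arc \<open>(j, i)\<close> runs from \<open>j\<close> to \<open>i\<close>.\<close>

definition undirected_graph :: "nat \<Rightarrow> nat pair_pre_digraph \<Rightarrow> bool" where
  "undirected_graph N G \<longleftrightarrow> pverts G = {..<N} \<and> pair_pseudo_graph G"

definition weighted_adjacency :: "nat \<Rightarrow> nat pair_pre_digraph \<Rightarrow> real mat \<Rightarrow> bool" where
  "weighted_adjacency N G W \<longleftrightarrow>
     W \<in> carrier_mat N N \<and> transpose_mat W = W \<and>
     (\<forall>i<N. W $$ (i, i) = 0) \<and>
     (\<forall>i<N. \<forall>j<N. i \<noteq> j \<longrightarrow>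
        (if (j, i) \<in> parcs G then W $$ (i, j) > 0 else W $$ (i, j) = 0))"

definition union_graph ::
    "nat \<Rightarrow> (nat \<Rightarrow> nat pair_pre_digraph) \<Rightarrow> (real \<Rightarrow> nat) \<Rightarrow> (nat \<Rightarrow> real) \<Rightarrow> real \<Rightarrow> real
      \<Rightarrow> nat pair_pre_digraph" where
  "union_graph N G \<sigma> t a b =
     \<lparr> pverts = {..<N}, parcs = (\<Union>j\<in>{j. t j \<in> {a..<b}}. parcs (G (\<sigma> (t j)))) \<rparr>"

definition jointly_connected ::
    "nat \<Rightarrow> (nat \<Rightarrow> nat pair_pre_digraph) \<Rightarrow> (real \<Rightarrow> nat) \<Rightarrow> (nat \<Rightarrow> real) \<Rightarrow> real \<Rightarrow> bool" where
  "jointly_connected N G \<sigma> t \<tau> \<longleftrightarrow>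
     (\<exists>(jk :: nat \<Rightarrow> nat) Tc.
        strict_mono jk \<and> t (jk 0) = 0 \<and> Tc > 0 \<and>
        (\<forall>k. \<tau> \<le> t (jk (Suc k)) - t (jk k) \<and> t (jk (Suc k)) - t (jk k) \<le> Tc) \<and>
        (\<forall>k. connected (with_proj (union_graph N G \<sigma> t (t (jk k)) (t (jk (Suc k)))))))"


subsection \<open>Observer gains\<close>

text \<open>
  \<open>L\<close> and \<open>M\<close> arise from \<open>P\<close> for the output matrix \<open>C \<in> \<real>\<^bsup>m\<times>n\<^esup>\<close> by some admissible choice of
  \<open>U\<close>, \<open>D\<close> and \<open>Lo\<close>; \<open>r\<close> is \<open>n - \<nu>\<close>. The blocks \<open>A\<^sub>o\<close> and \<open>C\<^sub>o\<close> are read off from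
  \<open>(P T)\<^sup>-\<^sup>1 A (P T)\<close> and \<open>C P T\<close>; that the complementary blocks vanish is a consequence.
\<close>

definition gain_design ::
    "nat \<Rightarrow> nat \<Rightarrow> real mat \<Rightarrow> real mat \<Rightarrow> real mat \<Rightarrow> real mat \<Rightarrow> real mat \<Rightarrow> bool" where
  "gain_design n m A C P L M \<longleftrightarrow>
     (\<exists>U D Lo.
        let Ob = obs_mat n C A;
            \<nu> = n - mat_rank Ob;
            r = n - \<nu>;
            T = mat_of_cols n (cols D @ cols U);
            A\<^sub>o = fst (split_block (mat_inv (P * T) * A * (P * T)) r r);
            C\<^sub>o = fst (split_block (C * P * T) m r)
        in orthonormal_basis_mat n \<nu> U (mat_kernel (Ob * P)) \<and>
           orthonormal_basis_mat n r D (mat_im (transpose_mat P * transpose_mat Ob)) \<and>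
           Lo \<in> carrier_mat r m \<and>
           Hurwitz (A\<^sub>o - Lo * C\<^sub>o) \<and>
           L = P * T * block_col m [Lo, 0\<^sub>m \<nu> m] \<and>
           M = P * T * four_block_mat (0\<^sub>m r r) (0\<^sub>m r \<nu>) (0\<^sub>m \<nu> r) (1\<^sub>m \<nu>)
                 * transpose_mat T * mat_inv P)"


subsection \<open>Distributed exponential state estimation\<close>

text \<open>
  \<open>x\<close> is a continuous solution of \<open>x'(s) = F s\<close> on \<open>[0, \<infinity>)\<close>, where the equation need not hold at
  the instants in \<open>S\<close>.
\<close>

definition trajectory :: "nat \<Rightarrow> real set \<Rightarrow> (real \<Rightarrow> real vec) \<Rightarrow> (real \<Rightarrow> real vec) \<Rightarrow> bool" where
  "trajectory n S F x \<longleftrightarrow>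
     (\<forall>s\<ge>0. x s \<in> carrier_vec n) \<and>
     (\<forall>k<n. continuous_on {0..} (\<lambda>s. x s $ k)) \<and>
     (\<forall>s\<ge>0. s \<notin> S \<longrightarrow>
        (\<forall>k<n. ((\<lambda>u. x u $ k) has_real_derivative F s $ k) (at s within {0..})))"

definition exp_to_zero :: "(real \<Rightarrow> real vec) \<Rightarrow> bool" where
  "exp_to_zero e \<longleftrightarrow>
     (\<exists>c\<ge>0. \<exists>\<rho>>0. \<forall>s\<ge>0. L2_set (\<lambda>k. e s $ k) {..<dim_vec (e s)} \<le> c * exp (- \<rho> * s))"

text \<open>
  A map \<open>g \<xi> y d\<close> of the own estimate \<open>\<xi>\<close>, the local measurement \<open>y\<close> and the relative estimates
  \<open>d j\<close>, \<open>j < N\<close>, that is linear and uses only those \<open>d j\<close> with \<open>j\<close> in the neighbour set \<open>Nb\<close>.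
\<close>

definition local_linear_map ::
    "nat \<Rightarrow> nat \<Rightarrow> nat \<Rightarrow> nat set \<Rightarrow> (real vec \<Rightarrow> real vec \<Rightarrow> (nat \<Rightarrow> real vec) \<Rightarrow> real vec) \<Rightarrow> bool" where
  "local_linear_map n m N Nb g \<longleftrightarrow>
     (\<forall>\<xi>\<in>carrier_vec n. \<forall>y\<in>carrier_vec m. \<forall>d\<in>{..<N} \<rightarrow> carrier_vec n.
        g \<xi> y d \<in> carrier_vec n \<and>
        (\<forall>c. g (c \<cdot>\<^sub>v \<xi>) (c \<cdot>\<^sub>v y) (\<lambda>j. c \<cdot>\<^sub>v d j) = c \<cdot>\<^sub>v g \<xi> y d) \<and>
        (\<forall>\<xi>'\<in>carrier_vec n. \<forall>y'\<in>carrier_vec m. \<forall>d'\<in>{..<N} \<rightarrow> carrier_vec n.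
           g (\<xi> + \<xi>') (y + y') (\<lambda>j. d j + d' j) = g \<xi> y d + g \<xi>' y' d') \<and>
        (\<forall>d'\<in>{..<N} \<rightarrow> carrier_vec n. (\<forall>j\<in>Nb. d j = d' j) \<longrightarrow> g \<xi> y d = g \<xi> y d'))"

text \<open>
  The maps \<open>f i p\<close> may depend on the mode \<open>p\<close>, because the weights \<open>a\<^sub>i\<^sub>j(s)\<close> do. All initial
  conditions are covered by quantifying over all trajectories of plant and observers.
\<close>

definition solves_dist_exp_estimation ::
    "nat \<Rightarrow> nat \<Rightarrow> (nat \<Rightarrow> nat) \<Rightarrow> real mat \<Rightarrow> (nat \<Rightarrow> real mat)
      \<Rightarrow> nat \<Rightarrow> (nat \<Rightarrow> nat pair_pre_digraph) \<Rightarrow> (real \<Rightarrow> nat) \<Rightarrow> (nat \<Rightarrow> real)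
      \<Rightarrow> (nat \<Rightarrow> nat \<Rightarrow> real vec \<Rightarrow> real vec \<Rightarrow> (nat \<Rightarrow> real vec) \<Rightarrow> real vec) \<Rightarrow> bool" where
  "solves_dist_exp_estimation n N m A C n0 G \<sigma> t f \<longleftrightarrow>
     (\<forall>i<N. \<forall>p\<in>{1..n0}. local_linear_map n (m i) N {j. j < N \<and> (j, i) \<in> parcs (G p)} (f i p)) \<and>
     (\<forall>x xh.
        trajectory n (range t) (\<lambda>s. A *\<^sub>v x s) x \<and>
        (\<forall>i<N. trajectory n (range t)
                  (\<lambda>s. f i (\<sigma> s) (xh i s) (C i *\<^sub>v x s) (\<lambda>j. xh j s - xh i s)) (xh i))
        \<longrightarrow> (\<forall>i<N. exp_to_zero (\<lambda>s. xh i s - x s)))"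

definition local_observer ::
    "nat \<Rightarrow> nat \<Rightarrow> real mat \<Rightarrow> (nat \<Rightarrow> real mat) \<Rightarrow> (nat \<Rightarrow> real mat) \<Rightarrow> (nat \<Rightarrow> real mat)
      \<Rightarrow> (nat \<Rightarrow> real) \<Rightarrow> (nat \<Rightarrow> real mat)
      \<Rightarrow> nat \<Rightarrow> nat \<Rightarrow> real vec \<Rightarrow> real vec \<Rightarrow> (nat \<Rightarrow> real vec) \<Rightarrow> real vec" where
  "local_observer n N A C L M \<gamma> W i p \<xi> y d =
     A *\<^sub>v \<xi> + L i *\<^sub>v (y - C i *\<^sub>v \<xi>)
       + \<gamma> i \<cdot>\<^sub>v (M i *\<^sub>v finsum_vec TYPE(real) n (\<lambda>j. W p $$ (i, j) \<cdot>\<^sub>v d j) {..<N})"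

end

theory Submission
  imports Defs "Jordan_Normal_Form.Schur_Decomposition"
begin

text \<open>
  The errors are studied in the coordinates \<open>P\<close>, in which the plant matrix is the skew-symmetric
  \<open>S = P\<^sup>-\<^sup>1 A P\<close>. The gains are made so that the error \<open>\<epsilon>\<^sub>i = P\<^sup>-\<^sup>1 (xh\<^sub>i - x)\<close> of agent \<open>i\<close> splits
  orthogonally into \<open>\<omega>\<^sub>i + \<eta>\<^sub>i\<close>, the part seen through \<open>C\<^sub>i\<close> and the part in the unobservable subspace
  (\<open>gain_design_decomposition\<close>). The first part has autonomous coordinates \<open>w\<^sub>i\<close> with
  \<open>w\<^sub>i' = F\<^sub>i w\<^sub>i\<close> and \<open>F\<^sub>i\<close> Hurwitz; the second one obeys
  \<open>\<eta>\<^sub>i' = S \<eta>\<^sub>i + \<gamma>\<^sub>i E\<^sub>i (\<Sum>\<^sub>j a\<^sub>i\<^sub>j (\<epsilon>\<^sub>j - \<epsilon>\<^sub>i))\<close>, where \<open>E\<^sub>i\<close> is the orthogonal projection onto the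
  unobservable subspace.

  With a Lyapunov matrix \<open>Y\<^sub>i\<close> of \<open>F\<^sub>i\<close> and a large constant \<open>K\<close>, the energy
  \<open>U = \<Sum>\<^sub>i \<bar>\<eta>\<^sub>i\<bar>\<^sup>2 / \<gamma>\<^sub>i + K (\<Sum>\<^sub>i w\<^sub>i \<bullet> Y\<^sub>i w\<^sub>i)\<close> never increases, whatever the graph does: the rotation \<open>S\<close> does
  no work, the weights \<open>1 / \<gamma>\<^sub>i\<close> cancel the gains, and the symmetry of the \<open>a\<^sub>i\<^sub>j\<close> turns the coupling into
  \<open>- \<Sum>\<^sub>i\<^sub>j a\<^sub>i\<^sub>j \<bar>\<eta>\<^sub>i - \<eta>\<^sub>j\<bar>\<^sup>2\<close> up to a factor and cross terms that the second sum absorbs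
  (\<open>energy_function\<close>).

  The dissipation need not be definite at any single time, so the decay is obtained over one
  window on which the union graph is connected (\<open>window_contraction\<close>). Let \<open>\<delta>\<close> be the energy lost in the
  window. By skew-symmetry the squared distance \<open>\<bar>\<eta>\<^sub>i - \<eta>\<^sub>j\<bar>\<^sup>2\<close> is not affected by \<open>S\<close>; up to exponential
  growth at rate one it can rise only at the expense of energy. An edge that is active for a
  dwell time drains energy in proportion to that distance, hence the distance at the end of the
  window is \<open>O(\<delta>)\<close> (\<open>endpoint_le_energy_drop\<close>), and by connectivity so is the distance of every
  pair. Joint observability says that no nonzero vector lies in all unobservable subspaces, so
  vectors \<open>\<eta>\<^sub>i\<close> of these subspaces that nearly agree are small (\<open>agreement_imp_small\<close>). Therefore the
  energy at the end of the window is itself \<open>O(\<delta>)\<close>, that is, it shrinks by a fixed factor per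
  window, and the windows have bounded length.
\<close>

section \<open>Monotone quantities between switching instants\<close>

lemma nonincreasing_off_finite:
  fixes f :: "real \<Rightarrow> real"
  assumes "finite (S \<inter> {a<..<b})" "a \<le> b" "continuous_on {a..b} f"
    and "\<And>s. a < s \<Longrightarrow> s < b \<Longrightarrow> s \<notin> S \<Longrightarrow> \<exists>y. (f has_real_derivative y) (at s) \<and> y \<le> 0"
  shows "f b \<le> f a"
  using assms
proof (induction "card (S \<inter> {a<..<b})" arbitrary: a b rule: less_induct)
  case less
  show ?case
  proof (cases "S \<inter> {a<..<b} = {}")
    case True
    show ?thesis
    proof (rule DERIV_nonpos_imp_decreasing_open[OF less.prems(2) _ less.prems(3)])
      fix s assume "a < s" "s < b"
      moreover from this True have "s \<notin> S" by auto
      ultimately show "\<exists>y. DERIV f s :> y \<and> y \<le> 0" by (rule less.prems(4))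
    qed
  next
    case False
    then obtain c where c: "c \<in> S" "a < c" "c < b" by auto
    have l: "S \<inter> {a<..<c} \<subset> S \<inter> {a<..<b}" and r: "S \<inter> {c<..<b} \<subset> S \<inter> {a<..<b}"
      using c by auto
    have "f c \<le> f a"
    proof (rule less.hyps[OF psubset_card_mono[OF less.prems(1) l]])
      show "continuous_on {a..c} f" by (rule continuous_on_subset[OF less.prems(3)]) (use c in auto)
    qed (use c l less.prems(1,4) in \<open>auto intro: finite_subset[OF psubset_imp_subset]\<close>)
    moreover have "f b \<le> f c"
    proof (rule less.hyps[OF psubset_card_mono[OF less.prems(1) r]])
      show "continuous_on {c..b} f" by (rule continuous_on_subset[OF less.prems(3)]) (use c in auto)
    qed (use c r less.prems(1,4) in \<open>auto intro: finite_subset[OF psubset_imp_subset]\<close>)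
    ultimately show ?thesis by simp
  qed
qed

text \<open>
  The way in which dissipation on a short active interval bounds a quantity at the end of a longer
  window. The energy \<open>U\<close> decreases on \<open>[a, b]\<close>. The quantity \<open>d\<close> grows at most exponentially unless
  energy is spent, so a large final value \<open>d b\<close> forces \<open>d\<close> to be large during all of \<open>[a, b]\<close>, up to
  a multiple of the energy spent; and while \<open>[p, q]\<close> lasts, a large \<open>d\<close> costs energy. Only the
  monotonicity of suitable combinations of \<open>U\<close> and \<open>d\<close> enters, no integrals.
\<close>

lemma endpoint_le_energy_drop:
  fixes U d U' d' :: "real \<Rightarrow> real"
  assumes fin: "finite (S \<inter> {a..b})" and ord: "a \<le> p" "p < q" "q \<le> b" and \<tau>: "0 < \<tau>" "\<tau> \<le> q - p"
    and cont: "continuous_on {a..b} U" "continuous_on {a..b} d"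
    and U': "\<And>s. a < s \<Longrightarrow> s < b \<Longrightarrow> s \<notin> S \<Longrightarrow> (U has_real_derivative U' s) (at s)"
    and d': "\<And>s. a < s \<Longrightarrow> s < b \<Longrightarrow> s \<notin> S \<Longrightarrow> (d has_real_derivative d' s) (at s)"
    and U'_le: "\<And>s. a < s \<Longrightarrow> s < b \<Longrightarrow> s \<notin> S \<Longrightarrow> U' s \<le> 0"
    and growth: "\<And>s. a < s \<Longrightarrow> s < b \<Longrightarrow> s \<notin> S \<Longrightarrow> d' s \<le> d s - k * U' s"
    and active: "\<And>s. p < s \<Longrightarrow> s < q \<Longrightarrow> s \<notin> S \<Longrightarrow> U' s \<le> - c * d s"
    and nn: "\<And>s. 0 \<le> d s" and pos: "0 < c" "0 \<le> k"
  shows "d b \<le> exp (b - a) * (k + 1 / (c * \<tau>)) * (U a - U b)"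
proof -
  have fin': "finite (S \<inter> {x<..<y})" if "a \<le> x" "y \<le> b" for x y
    using that by (intro finite_subset[OF _ fin]) auto
  have U_mono: "U y \<le> U x" if "a \<le> x" "x \<le> y" "y \<le> b" for x y
  proof (rule nonincreasing_off_finite[where f = U, OF fin'])
    show "continuous_on {x..y} U" by (rule continuous_on_subset[OF cont(1)]) (use that in auto)
    fix u assume "x < u" "u < y" "u \<notin> S"
    thus "\<exists>z. (U has_real_derivative z) (at u) \<and> z \<le> 0"
      using U'[of u] U'_le[of u] that by (intro exI[of _ "U' u"]) auto
  qed (use that in auto)
  (* the lower bound that the final value imposes on d throughout the window *)
  define m where "m = exp (- (b - a)) * d b - k * (U a - U b)"
  have d_low: "m \<le> d s" if s: "a \<le> s" "s \<le> b" for s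
  proof -
    (* the spent energy k * U compensates every growth of d that is faster than exponential *)
    define g where "g = (\<lambda>u. exp (- (u - a)) * d u + k * U u)"
    have "g b \<le> g s"
    proof (rule nonincreasing_off_finite[where f = g, OF fin'])
      show "continuous_on {s..b} g"
        unfolding g_def using s
        by (intro continuous_intros continuous_on_subset[OF cont(1)] continuous_on_subset[OF cont(2)]) auto
      fix u assume u: "s < u" "u < b" "u \<notin> S"
      have ab: "a < u" using u s by simp
      have "(g has_real_derivative - exp (- (u - a)) * d u + exp (- (u - a)) * d' u + k * U' u) (at u)"
        unfolding g_def using U'[OF ab u(2,3)] d'[OF ab u(2,3)]
        by (auto intro!: derivative_eq_intros)
      moreover have "- exp (- (u - a)) * d u + exp (- (u - a)) * d' u + k * U' u \<le> 0"
      proof -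
        have "exp (- (u - a)) * (d' u - d u) \<le> exp (- (u - a)) * (- (k * U' u))"
          using growth[OF ab u(2,3)] by (intro mult_left_mono) auto
        also have "\<dots> \<le> 1 * (- (k * U' u))"
          using ab U'_le[OF ab u(2,3)] pos by (intro mult_right_mono) (auto simp: mult_nonneg_nonpos)
        finally show ?thesis by (simp add: algebra_simps)
      qed
      ultimately show "\<exists>y. (g has_real_derivative y) (at u) \<and> y \<le> 0" by blast
    qed (use s in auto)
    hence "exp (- (b - a)) * d b + k * U b \<le> exp (- (s - a)) * d s + k * U s" by (simp add: g_def)
    also have "\<dots> \<le> 1 * d s + k * U a"
      using s nn[of s] pos U_mono[of a s] by (intro add_mono mult_right_mono mult_left_mono) auto
    finally show ?thesis by (simp add: m_def algebra_simps)
  qed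
  have "c * m * (q - p) \<le> U p - U q"
  proof -
    have "U q + c * m * (q - p) \<le> U p + c * m * (p - p)"
    proof (rule nonincreasing_off_finite[where f = "\<lambda>u. U u + c * m * (u - p)", OF fin'])
      show "continuous_on {p..q} (\<lambda>u. U u + c * m * (u - p))"
        using ord by (intro continuous_intros continuous_on_subset[OF cont(1)]) auto
      fix u assume u: "p < u" "u < q" "u \<notin> S"
      have ab: "a < u" "u < b" using u ord by auto
      have "((\<lambda>u. U u + c * m * (u - p)) has_real_derivative U' u + c * m) (at u)"
        using U'[OF ab u(3)] by (auto intro!: derivative_eq_intros)
      moreover have "c * m \<le> c * d u" using d_low[of u] ab pos by (intro mult_left_mono) auto
      ultimately show "\<exists>y. ((\<lambda>u. U u + c * m * (u - p)) has_real_derivative y) (at u) \<and> y \<le> 0"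
        using active[OF u] by (intro exI[of _ "U' u + c * m"]) auto
    qed (use ord in auto)
    thus ?thesis by simp
  qed
  also have "\<dots> \<le> U a - U b" using U_mono[of a p] U_mono[of q b] ord by simp
  finally have cm: "c * m * (q - p) \<le> U a - U b" .
  have \<delta>: "0 \<le> U a - U b" using U_mono[of a b] ord by simp
  have "m \<le> 1 / (c * \<tau>) * (U a - U b)"
  proof (cases "m \<le> 0")
    case True
    thus ?thesis using \<delta> pos \<tau> by (meson divide_nonneg_nonneg mult_nonneg_nonneg order_less_imp_le order_trans zero_le_one)
  next
    case False
    hence "c * m * \<tau> \<le> c * m * (q - p)" using pos \<tau> by (intro mult_left_mono) auto
    with cm show ?thesis using pos \<tau> by (simp add: field_simps)
  qed
  hence "exp (- (b - a)) * d b \<le> (k + 1 / (c * \<tau>)) * (U a - U b)"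
    by (simp add: m_def algebra_simps)
  hence "exp (b - a) * (exp (- (b - a)) * d b) \<le> exp (b - a) * ((k + 1 / (c * \<tau>)) * (U a - U b))"
    by (intro mult_left_mono) auto
  thus ?thesis by (simp add: mult.assoc[symmetric] exp_add[symmetric])
qed

lemma geometric_decay_imp_exponential:
  fixes U :: "real \<Rightarrow> real" and b :: "nat \<Rightarrow> real"
  assumes nn: "\<And>s. 0 \<le> s \<Longrightarrow> 0 \<le> U s"
    and mono: "\<And>x y. 0 \<le> x \<Longrightarrow> x \<le> y \<Longrightarrow> U y \<le> U x"
    and b: "b 0 = 0" "\<And>k. \<tau> \<le> b (Suc k) - b k" "\<And>k. b (Suc k) - b k \<le> T" and \<tau>: "0 < \<tau>"
    and contr: "\<And>k. U (b (Suc k)) \<le> q * U (b k)" and q: "q < 1"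
  shows "\<exists>c\<ge>0. \<exists>\<rho>>0. \<forall>s\<ge>0. U s \<le> c * exp (- \<rho> * s)"
proof -
  (* the rate is a logarithm of the factor, which therefore has to be positive *)
  define r where "r = max q (1/2)"
  have r: "0 < r" "r < 1" "q \<le> r" using q by (auto simp: r_def)
  have T: "0 < T" using b(2)[of 0] b(3)[of 0] \<tau> by linarith
  have b_lo: "\<tau> * real k \<le> b k" and b_hi: "b k \<le> T * real k" for k
  proof (induction k)
    case (Suc k)
    { case 1 show ?case using Suc b(2)[of k] by (simp add: algebra_simps) }
    { case 2 show ?case using Suc b(3)[of k] by (simp add: algebra_simps) }
  qed (use b(1) in auto)
  have b0: "0 \<le> b k" for k using b_lo[of k] \<tau> by (meson mult_nonneg_nonneg of_nat_0_le_iff order_less_imp_le order_trans)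
  have Ub: "U (b k) \<le> r ^ k * U 0" for k
  proof (induction k)
    case (Suc k)
    have "U (b (Suc k)) \<le> q * U (b k)" by (rule contr)
    also have "\<dots> \<le> r * U (b k)" using r nn[OF b0] by (intro mult_right_mono) auto
    also have "\<dots> \<le> r * (r ^ k * U 0)" using r Suc by (intro mult_left_mono) auto
    finally show ?case by (simp add: mult.assoc)
  qed (use b(1) in auto)
  define \<rho> where "\<rho> = - ln r / T"
  have \<rho>: "0 < \<rho>" using r T by (simp add: \<rho>_def divide_neg_pos)
  have rexp: "r = exp (- \<rho> * T)" using r T by (simp add: \<rho>_def)
  have "U s \<le> (U 0 / r) * exp (- \<rho> * s)" if s: "0 \<le> s" for s
  proof -
    have "\<exists>k. s < b k"
    proof -
      obtain k :: nat where "s / \<tau> < real k" using reals_Archimedean2 by blast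
      hence "s < \<tau> * real k" using \<tau> by (simp add: field_simps)
      thus ?thesis using b_lo[of k] by (intro exI[of _ k]) simp
    qed
    define k where "k = (LEAST k. s < b k)"
    have k: "s < b k" unfolding k_def using \<open>\<exists>k. s < b k\<close> by (metis LeastI)
    have "k \<noteq> 0" using k b(1) s by (cases k) auto
    then obtain j where j: "k = Suc j" by (cases k) auto
    have bj: "b j \<le> s" using not_less_Least[of j "\<lambda>k. s < b k"] j k_def by (metis lessI not_le)
    have "U s \<le> r ^ j * U 0" using mono[OF b0 bj] Ub[of j] by simp
    also have "\<dots> = (U 0 / r) * r ^ k" using r j by simp
    also have "r ^ k = exp (- \<rho> * (T * real k))"
      by (simp add: rexp exp_of_nat_mult[symmetric] mult_ac)
    also have "(U 0 / r) * exp (- \<rho> * (T * real k)) \<le> (U 0 / r) * exp (- \<rho> * s)"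
      using k b_hi[of k] \<rho> nn[of 0] r by (intro mult_left_mono) auto
    finally show ?thesis .
  qed
  thus ?thesis using \<rho> nn[of 0] r by (intro exI[of _ "U 0 / r"] conjI exI[of _ \<rho>]) auto
qed

text \<open>
  The bound on the length makes the constant of \<open>window_contraction\<close> independent of the window.
\<close>

lemma rtrancl_imp_short_path:
  assumes "finite E" "(i, j) \<in> E\<^sup>*" "card E \<le> l"
  shows "\<exists>k\<le>l. (i, j) \<in> E ^^ k"
proof -
  have "(i, j) \<in> (\<Union>k\<in>{k. k \<le> card E}. E ^^ k)"
    using assms(1,2) by (simp only: rtrancl_finite_eq_relpow[symmetric])
  thus ?thesis using assms(3) order_trans by blast
qed

section \<open>Linear algebra\<close>

lemma scalar_prod_self: "v \<in> carrier_vec n \<Longrightarrow> v \<bullet> v = (\<Sum>k<n. (v $ k)\<^sup>2)" for v :: "real vec"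
  by (simp add: scalar_prod_def lessThan_atLeast0 power2_eq_square)

lemma scalar_prod_self_nonneg [simp]: "0 \<le> v \<bullet> v" for v :: "real vec"
  by (simp add: scalar_prod_def sum_nonneg)

lemma scalar_prod_self_eq_0:
  "v \<in> carrier_vec n \<Longrightarrow> v \<bullet> v = 0 \<longleftrightarrow> v = 0\<^sub>v n" for v :: "real vec"
  by (auto simp: scalar_prod_self sum_nonneg_eq_0_iff intro!: eq_vecI)

lemma norm_sum_mult_sq_le:
  fixes a u :: "nat \<Rightarrow> 'a::real_normed_field"
  shows "(norm (\<Sum>k<r. a k * u k))\<^sup>2 \<le> (\<Sum>k<r. (norm (a k))\<^sup>2) * (\<Sum>k<r. (norm (u k))\<^sup>2)"
proof -
  have "norm (\<Sum>k<r. a k * u k) \<le> (\<Sum>k<r. \<bar>norm (a k)\<bar> * \<bar>norm (u k)\<bar>)"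
    by (intro order_trans[OF norm_sum] sum_mono) (simp add: norm_mult)
  also have "\<dots> \<le> L2_set (\<lambda>k. norm (a k)) {..<r} * L2_set (\<lambda>k. norm (u k)) {..<r}"
    by (rule L2_set_mult_ineq)
  finally have "(norm (\<Sum>k<r. a k * u k))\<^sup>2
      \<le> (L2_set (\<lambda>k. norm (a k)) {..<r} * L2_set (\<lambda>k. norm (u k)) {..<r})\<^sup>2"
    by (intro power_mono) auto
  thus ?thesis by (simp add: power_mult_distrib L2_set_def sum_nonneg)
qed

lemma mat_inv_unique:
  assumes "X \<in> carrier_mat n n" "Y \<in> carrier_mat n n" "X * Y = 1\<^sub>m n"
  shows "mat_inv X = Y"
proof -
  have YX: "Y * X = 1\<^sub>m n" by (rule mat_mult_left_right_inverse[OF assms])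
  obtain B where B: "mat_inverse X = Some B"
  proof (cases "mat_inverse X")
    case None
    hence "X \<notin> Units (ring_mat TYPE(real) n undefined)" by (rule mat_inverse(1)[OF assms(1)])
    moreover have "X \<in> Units (ring_mat TYPE(real) n undefined)"
      using assms YX by (auto simp: Units_def ring_mat_simps)
    ultimately show ?thesis by blast
  qed
  have B': "X * B = 1\<^sub>m n" "B * X = 1\<^sub>m n" "B \<in> carrier_mat n n" using mat_inverse(2)[OF assms(1) B] by auto
  have "B = (Y * X) * B" using YX B' by simp
  also have "\<dots> = Y" using assms B' by (simp add: assoc_mult_mat[of _ n n _ n _ n])
  finally show ?thesis by (simp add: mat_inv_def B)
qed

lemma mat_inv_props:
  assumes P: "P \<in> carrier_mat n n" and "invertible_mat P"
  shows "mat_inv P \<in> carrier_mat n n" "P * mat_inv P = 1\<^sub>m n" "mat_inv P * P = 1\<^sub>m n"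
proof -
  obtain B where "P * B = 1\<^sub>m n" "B * P = 1\<^sub>m (dim_row B)"
    using assms by (auto simp: invertible_mat_def inverts_mat_def)
  hence B: "B \<in> carrier_mat n n"
    using P by (metis carrier_mat_triv carrier_matD index_mult_mat(2,3) index_one_mat(2,3))
  show "mat_inv P \<in> carrier_mat n n" "P * mat_inv P = 1\<^sub>m n" "mat_inv P * P = 1\<^sub>m n"
    using mat_inv_unique[OF P B] mat_mult_left_right_inverse[OF P B] B \<open>P * B = 1\<^sub>m n\<close> by auto
qed

lemma mat_im_eq: "X \<in> carrier_mat nr nc \<Longrightarrow> mat_im X = {X *\<^sub>v v |v. v \<in> carrier_vec nc}"
  unfolding mat_im_def using vec_space.col_space_eq[of X nr nc] by auto

lemma full_rank_imp_injective:
  assumes X: "X \<in> carrier_mat nr nc" and rank: "mat_rank X = nc"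
    and v: "v \<in> carrier_vec nc" "X *\<^sub>v v = 0\<^sub>v nr"
  shows "v = 0\<^sub>v nc"
proof (rule ccontr)
  assume v0: "v \<noteq> 0\<^sub>v nc"
  interpret vec_space "TYPE(real)" nr .
  have r: "rank X = nc" using rank X by (simp add: mat_rank_def)
  obtain I where I: "maximal I (\<lambda>T. T \<subseteq> set (cols X) \<and> lin_indpt T)"
    using maximal_exists[of "(\<lambda>T. T \<subseteq> set (cols X) \<and> lin_indpt T)" "card (set (cols X))" "{}"]
    by (meson List.finite_set card_mono empty_iff empty_subsetI finite_lin_indpt2 rev_finite_subset)
  have "nc \<le> card (set (cols X))"
    using rank_card_indpt[OF X I] r I by (auto simp: maximal_def intro: card_mono)
  hence "distinct (cols X)"
    using X card_length[of "cols X"] by (intro card_distinct) auto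
  thus False using lin_depI[OF X v(1) v0 v(2)] full_rank_lin_indpt[OF X r] by blast
qed

lemma block_col_mult_vec_eq_0:
  assumes Xs: "\<And>X. X \<in> set Xs \<Longrightarrow> dim_col X = nc" and v: "v \<in> carrier_vec nc"
  shows "block_col nc Xs *\<^sub>v v = 0\<^sub>v (dim_row (block_col nc Xs))
    \<longleftrightarrow> (\<forall>X\<in>set Xs. X *\<^sub>v v = 0\<^sub>v (dim_row X))"
proof -
  define R where "R = concat (map rows Xs)"
  have dR: "u \<in> carrier_vec nc" if "u \<in> set R" for u
    using that Xs by (fastforce simp: R_def rows_def)
  have "block_col nc Xs *\<^sub>v v = 0\<^sub>v (dim_row (block_col nc Xs)) \<longleftrightarrow> (\<forall>i<length R. R ! i \<bullet> v = 0)"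
    unfolding vec_eq_iff using dR by (auto simp: block_col_def R_def[symmetric])
  also have "\<dots> \<longleftrightarrow> (\<forall>u\<in>set R. u \<bullet> v = 0)" by (auto simp: all_set_conv_all_nth)
  also have "\<dots> \<longleftrightarrow> (\<forall>X\<in>set Xs. \<forall>i<dim_row X. row X i \<bullet> v = 0)"
    by (auto simp: R_def rows_def)
  also have "\<dots> \<longleftrightarrow> (\<forall>X\<in>set Xs. X *\<^sub>v v = 0\<^sub>v (dim_row X))"
    unfolding vec_eq_iff by auto
  finally show ?thesis .
qed

lemma pow_mat_mult_vec:
  assumes "S \<in> carrier_mat n n" "v \<in> carrier_vec n"
  shows "S ^\<^sub>m k *\<^sub>v v = ((\<lambda>x. S *\<^sub>v x) ^^ k) v"
  using assms(2)
proof (induction k arbitrary: v)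
  case (Suc k)
  have "S ^\<^sub>m Suc k *\<^sub>v v = S ^\<^sub>m k *\<^sub>v (S *\<^sub>v v)"
    using assms(1) Suc.prems by (simp add: assoc_mult_mat_vec[of _ n n _ n])
  thus ?case using Suc.IH[of "S *\<^sub>v v"] assms(1) Suc.prems by (simp add: funpow_swap1)
qed (use assms in auto)

text \<open>
  The \<open>n + 1\<close> vectors become the columns of a square matrix whose additional last row is zero, so
  that its determinant vanishes.
\<close>

lemma nontrivial_relation_of_many_vectors:
  fixes f :: "nat \<Rightarrow> 'a::field vec"
  shows "\<exists>c. (\<exists>j\<le>n. c j \<noteq> 0) \<and> (\<forall>i<n. (\<Sum>j\<le>n. c j * f j $ i) = 0)"
proof -
  define K where "K = mat (Suc n) (Suc n) (\<lambda>(i, j). if i < n then f j $ i else 0)"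
  have K: "K \<in> carrier_mat (Suc n) (Suc n)" by (simp add: K_def)
  have "transpose_mat K *\<^sub>v unit_vec (Suc n) n = 0\<^sub>v (Suc n)"
    by (rule eq_vecI) (auto simp: K_def)
  moreover have "unit_vec (Suc n) n \<noteq> (0\<^sub>v (Suc n) :: 'a vec)"
    by (metis index_unit_vec(1) index_zero_vec(1) lessI zero_neq_one)
  ultimately have "det (transpose_mat K) = 0"
    using K by (subst det_0_iff_vec_prod_zero[of _ "Suc n"]) (auto intro!: exI[of _ "unit_vec (Suc n) n"])
  hence "det K = 0" using det_transpose[OF K] by simp
  then obtain c where c: "c \<in> carrier_vec (Suc n)" "c \<noteq> 0\<^sub>v (Suc n)" "K *\<^sub>v c = 0\<^sub>v (Suc n)"
    using det_0_iff_vec_prod_zero[OF K] by blast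
  have "\<exists>j\<le>n. c $ j \<noteq> 0"
    using c(1,2) by (metis carrier_vecD eq_vecI index_zero_vec le_simps(2))
  moreover have "(\<Sum>j\<le>n. c $ j * f j $ i) = 0" if i: "i < n" for i
  proof -
    have "(K *\<^sub>v c) $ i = 0" using c(3) i by simp
    hence "(\<Sum>j<Suc n. f j $ i * c $ j) = 0"
      using i c(1) by (simp add: K_def scalar_prod_def lessThan_atLeast0)
    thus ?thesis by (simp add: lessThan_Suc_atMost mult.commute)
  qed
  ultimately show ?thesis by blast
qed

text \<open>
  The step that makes unobservable subspaces invariant. If \<open>R S\<^sup>n v\<close> were nonzero while all earlier
  \<open>R S\<^sup>k v\<close> vanish, then \<open>v, S v, \<dots>, S\<^sup>n v\<close> would be linearly independent: applying \<open>R S\<^sup>n\<^sup>-\<^sup>j\<close> to a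
  relation with last nonzero coefficient \<open>c\<^sub>j\<close> leaves \<open>c\<^sub>j R S\<^sup>n v = 0\<close>.
\<close>

lemma Krylov_kernel_step:
  fixes S R :: "'a::field mat"
  assumes S: "S \<in> carrier_mat n n" and R: "R \<in> carrier_mat m n" and v: "v \<in> carrier_vec n"
    and zero: "\<And>k. k < n \<Longrightarrow> R *\<^sub>v ((\<lambda>x. S *\<^sub>v x) ^^ k) v = 0\<^sub>v m"
  shows "R *\<^sub>v ((\<lambda>x. S *\<^sub>v x) ^^ n) v = 0\<^sub>v m"
proof (rule ccontr)
  define f where "f = (\<lambda>k. ((\<lambda>x. S *\<^sub>v x) ^^ k) v)"
  have f: "f k \<in> carrier_vec n" for k
    unfolding f_def using S v by (induction k) auto
  have zero': "R *\<^sub>v f k = 0\<^sub>v m" if "k < n" for k using zero[OF that] by (simp add: f_def)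
  assume "R *\<^sub>v ((\<lambda>x. S *\<^sub>v x) ^^ n) v \<noteq> 0\<^sub>v m"
  then obtain i0 where i0: "i0 < m" "(R *\<^sub>v f n) $ i0 \<noteq> 0"
    using R by (auto simp: f_def vec_eq_iff)
  obtain c j1 where c: "j1 \<le> n" "c j1 \<noteq> 0" "\<And>i. i < n \<Longrightarrow> (\<Sum>j\<le>n. c j * f j $ i) = 0"
    using nontrivial_relation_of_many_vectors[of n f] by blast
  define j0 where "j0 = Max {j. j \<le> n \<and> c j \<noteq> 0}"
  have fin: "finite {j. j \<le> n \<and> c j \<noteq> 0}" by simp
  have "j0 \<in> {j. j \<le> n \<and> c j \<noteq> 0}" unfolding j0_def by (rule Max_in[OF fin]) (use c in auto)
  hence j0: "j0 \<le> n" "c j0 \<noteq> 0" by auto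
  have above: "c j = 0" if "j0 < j" "j \<le> n" for j
  proof (rule ccontr)
    assume "c j \<noteq> 0"
    hence "j \<le> j0" unfolding j0_def using that by (intro Max_ge[OF fin]) auto
    thus False using that by simp
  qed
  define \<phi> where "\<phi> = row (R * S ^\<^sub>m (n - j0)) i0"
  have \<phi>: "\<phi> \<bullet> f j = (R *\<^sub>v f (n - j0 + j)) $ i0" for j
  proof -
    have "\<phi> \<bullet> f j = ((R * S ^\<^sub>m (n - j0)) *\<^sub>v f j) $ i0" using i0 R by (simp add: \<phi>_def)
    also have "(R * S ^\<^sub>m (n - j0)) *\<^sub>v f j = R *\<^sub>v (S ^\<^sub>m (n - j0) *\<^sub>v f j)"
      using R S f by (intro assoc_mult_mat_vec[of _ m n _ n]) auto
    also have "S ^\<^sub>m (n - j0) *\<^sub>v f j = f (n - j0 + j)"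
      using pow_mat_mult_vec[OF S f] by (simp add: f_def funpow_add)
    finally show ?thesis .
  qed
  have "0 = (\<Sum>i<n. \<phi> $ i * (\<Sum>j\<le>n. c j * f j $ i))" using c(3) by simp
  also have "\<dots> = (\<Sum>j\<le>n. c j * (\<phi> \<bullet> f j))"
  proof -
    have "dim_vec (f j) = n" for j using f by simp
    thus ?thesis
      by (simp add: scalar_prod_def lessThan_atLeast0 sum_distrib_left mult_ac) (rule sum.swap)
  qed
  also have "\<dots> = (\<Sum>j\<in>{j0}. c j * (\<phi> \<bullet> f j))"
  proof (rule sum.mono_neutral_right)
    show "\<forall>j\<in>{..n} - {j0}. c j * (\<phi> \<bullet> f j) = 0"
    proof
      fix j assume j: "j \<in> {..n} - {j0}"
      show "c j * (\<phi> \<bullet> f j) = 0"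
      proof (cases "j0 < j")
        case False
        hence "n - j0 + j < n" using j j0 by auto
        thus ?thesis using zero'[of "n - j0 + j"] i0 by (simp add: \<phi>)
      qed (use above j in auto)
    qed
  qed (use j0 in auto)
  also have "\<dots> = c j0 * (R *\<^sub>v f n) $ i0" using j0 by (simp add: \<phi>)
  finally show False using j0(2) i0(2) by simp
qed

lemma matrix_bounded:
  fixes X :: "real mat"
  assumes X: "X \<in> carrier_mat nr nc"
  shows "\<exists>c\<ge>0. \<forall>v\<in>carrier_vec nc. (X *\<^sub>v v) \<bullet> (X *\<^sub>v v) \<le> c * (v \<bullet> v)"
proof (intro exI conjI ballI)
  show "0 \<le> (\<Sum>i<nr. \<Sum>k<nc. (norm (X $$ (i, k)))\<^sup>2)" by (intro sum_nonneg) auto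
  fix v :: "real vec" assume v: "v \<in> carrier_vec nc"
  have "(X *\<^sub>v v) \<bullet> (X *\<^sub>v v) = (\<Sum>i<nr. (norm (\<Sum>k<nc. X $$ (i, k) * v $ k))\<^sup>2)"
    using X v by (subst scalar_prod_self[of _ nr]) (auto simp: scalar_prod_def lessThan_atLeast0)
  also have "\<dots> \<le> (\<Sum>i<nr. (\<Sum>k<nc. (norm (X $$ (i, k)))\<^sup>2) * (\<Sum>k<nc. (norm (v $ k))\<^sup>2))"
    by (intro sum_mono norm_sum_mult_sq_le)
  also have "\<dots> = (\<Sum>i<nr. \<Sum>k<nc. (norm (X $$ (i, k)))\<^sup>2) * (v \<bullet> v)"
    using v by (simp add: scalar_prod_self sum_distrib_right)
  finally show "(X *\<^sub>v v) \<bullet> (X *\<^sub>v v) \<le> (\<Sum>i<nr. \<Sum>k<nc. (norm (X $$ (i, k)))\<^sup>2) * (v \<bullet> v)" .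
qed

lemma nonsingular_bounded_below:
  fixes H :: "real mat"
  assumes H: "H \<in> carrier_mat n n" and inj: "\<And>v. v \<in> carrier_vec n \<Longrightarrow> H *\<^sub>v v = 0\<^sub>v n \<Longrightarrow> v = 0\<^sub>v n"
  shows "\<exists>c\<ge>0. \<forall>v\<in>carrier_vec n. v \<bullet> v \<le> c * ((H *\<^sub>v v) \<bullet> (H *\<^sub>v v))"
proof -
  have "det H \<noteq> 0" using inj det_0_iff_vec_prod_zero[OF H] by blast
  hence "H \<in> Units (ring_mat TYPE(real) n undefined)" by (rule det_non_zero_imp_unit[OF H])
  then obtain B where B: "B \<in> carrier_mat n n" "B * H = 1\<^sub>m n"
    by (auto simp: Units_def ring_mat_simps)
  obtain c where c: "0 \<le> c" "\<And>v. v \<in> carrier_vec n \<Longrightarrow> (B *\<^sub>v v) \<bullet> (B *\<^sub>v v) \<le> c * (v \<bullet> v)"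
    using matrix_bounded[OF B(1)] by blast
  have "v \<bullet> v \<le> c * ((H *\<^sub>v v) \<bullet> (H *\<^sub>v v))" if v: "v \<in> carrier_vec n" for v
  proof -
    have "B *\<^sub>v (H *\<^sub>v v) = v" using B H v by (metis assoc_mult_mat_vec one_mult_mat_vec)
    thus ?thesis using c(2)[of "H *\<^sub>v v"] H v by simp
  qed
  thus ?thesis using c(1) by blast
qed

section \<open>Lyapunov matrices of Hurwitz matrices\<close>

text \<open>
  For an upper triangular system the squared moduli of the coordinates, with geometrically growing
  weights \<open>q\<^sup>k\<close>, form a Lyapunov function: coordinate \<open>l\<close> disturbs only the coordinates \<open>k < l\<close>, whose
  total weight is a small fraction of \<open>q\<^sup>l\<close> when \<open>q\<close> is large.
\<close>

lemma triangular_dissipation: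
  fixes b :: "nat \<Rightarrow> nat \<Rightarrow> complex"
  assumes diag: "\<And>k. k < r \<Longrightarrow> Re (b k k) \<le> - \<beta>" and \<beta>: "0 < \<beta>"
  shows "\<exists>\<rho> \<alpha>. 0 < \<alpha> \<and> (\<forall>k. 1 \<le> \<rho> k) \<and>
    (\<forall>u. (\<Sum>k<r. \<rho> k * Re (cnj (u k) * (\<Sum>l=k..<r. b k l * u l)))
       \<le> - \<alpha> * (\<Sum>k<r. \<rho> k * (cmod (u k))\<^sup>2))"
proof -
  define M where "M = 1 + (\<Sum>k<r. \<Sum>l<r. cmod (b k l))"
  have M: "cmod (b k l) \<le> M" if "k < r" "l < r" for k l
  proof -
    have "cmod (b k l) \<le> (\<Sum>l<r. cmod (b k l))" using that by (intro member_le_sum) auto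
    also have "\<dots> \<le> (\<Sum>k<r. \<Sum>l<r. cmod (b k l))"
      using that by (intro member_le_sum[of k _ "\<lambda>k. \<Sum>l<r. cmod (b k l)"]) (auto intro: sum_nonneg)
    finally show ?thesis by (simp add: M_def)
  qed
  have M1: "1 \<le> M" by (simp add: M_def sum_nonneg)
  define R where "R = real r + 1"
  have R: "0 < R" by (simp add: R_def)
  define K where "K = M\<^sup>2 * R / (2 * \<beta>)"
  have K: "0 < K" using M1 \<beta> R by (simp add: K_def)
  (* K / (q - 1) = \<beta> / 4: the disturbance uses up half of the remaining decay \<beta> / 2 *)
  define q where "q = 1 + 4 * K / \<beta>"
  have q: "1 < q" using K \<beta> by (simp add: q_def)
  have young: "M * x * y \<le> \<beta> / (2 * R) * x\<^sup>2 + K * y\<^sup>2" for x y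
  proof -
    have "0 \<le> (\<beta> * x - M * R * y)\<^sup>2 / (2 * \<beta> * R)" using \<beta> R by simp
    also have "\<dots> = \<beta> / (2 * R) * x\<^sup>2 + K * y\<^sup>2 - M * x * y"
      using \<beta> R by (simp add: K_def power2_eq_square field_simps)
    finally show ?thesis by simp
  qed
  have geo: "(\<Sum>k<l. q ^ k) \<le> q ^ l * \<beta> / (4 * K)" for l
  proof -
    have "(\<Sum>k<l. q ^ k) = (q ^ l - 1) / (q - 1)" using q by (simp add: geometric_sum)
    also have "\<dots> \<le> q ^ l / (q - 1)" using q by (intro divide_right_mono) auto
    finally show ?thesis using K \<beta> by (simp add: q_def)
  qed
  have "(\<Sum>k<r. q ^ k * Re (cnj (u k) * (\<Sum>l=k..<r. b k l * u l)))
       \<le> - (\<beta> / 4) * (\<Sum>k<r. q ^ k * (cmod (u k))\<^sup>2)" for u :: "nat \<Rightarrow> complex"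
  proof -
    define x where "x = (\<lambda>k. cmod (u k))"
    have row: "Re (cnj (u k) * (\<Sum>l=k..<r. b k l * u l))
        \<le> - (\<beta> / 2) * (x k)\<^sup>2 + K * (\<Sum>l=Suc k..<r. (x l)\<^sup>2)" if k: "k < r" for k
    proof -
      have "(\<Sum>l=k..<r. b k l * u l) = b k k * u k + (\<Sum>l=Suc k..<r. b k l * u l)"
        using k by (simp add: sum.atLeast_Suc_lessThan)
      hence "Re (cnj (u k) * (\<Sum>l=k..<r. b k l * u l))
          = Re (cnj (u k) * u k * b k k) + (\<Sum>l=Suc k..<r. Re (cnj (u k) * (b k l * u l)))"
        by (simp only: distrib_left sum_distrib_left Re_sum plus_complex.simps mult_ac)
      also have "cnj (u k) * u k = complex_of_real ((x k)\<^sup>2)"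
        unfolding x_def complex_norm_square by (simp add: mult.commute)
      also have "Re (complex_of_real ((x k)\<^sup>2) * b k k) \<le> - \<beta> * (x k)\<^sup>2"
        using mult_right_mono[OF diag[OF k], of "(x k)\<^sup>2"] by (simp add: mult_ac)
      also have "(\<Sum>l=Suc k..<r. Re (cnj (u k) * (b k l * u l)))
          \<le> (\<Sum>l=Suc k..<r. \<beta> / (2 * R) * (x k)\<^sup>2 + K * (x l)\<^sup>2)"
      proof (rule sum_mono)
        fix l assume l: "l \<in> {Suc k..<r}"
        have "Re (cnj (u k) * (b k l * u l)) \<le> x k * (cmod (b k l) * x l)"
          using complex_Re_le_cmod[of "cnj (u k) * (b k l * u l)"] by (simp add: x_def norm_mult)
        also have "\<dots> \<le> x k * (M * x l)"
          using M[OF k, of l] l by (intro mult_left_mono mult_right_mono) (auto simp: x_def)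
        also have "\<dots> \<le> \<beta> / (2 * R) * (x k)\<^sup>2 + K * (x l)\<^sup>2" using young[of "x k" "x l"] by (simp add: mult_ac)
        finally show "Re (cnj (u k) * (b k l * u l)) \<le> \<beta> / (2 * R) * (x k)\<^sup>2 + K * (x l)\<^sup>2" .
      qed
      also have "\<dots> = real (r - Suc k) * (\<beta> / (2 * R) * (x k)\<^sup>2) + K * (\<Sum>l=Suc k..<r. (x l)\<^sup>2)"
        by (simp add: sum.distrib sum_distrib_left)
      also have "real (r - Suc k) * (\<beta> / (2 * R) * (x k)\<^sup>2) \<le> R * (\<beta> / (2 * R) * (x k)\<^sup>2)"
        using \<beta> R by (intro mult_right_mono) (auto simp: R_def)
      finally show ?thesis using R by simp
    qed
    have "(\<Sum>k<r. q ^ k * Re (cnj (u k) * (\<Sum>l=k..<r. b k l * u l)))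
        \<le> (\<Sum>k<r. q ^ k * (- (\<beta> / 2) * (x k)\<^sup>2 + K * (\<Sum>l=Suc k..<r. (x l)\<^sup>2)))"
      using row q by (intro sum_mono mult_left_mono) auto
    also have "\<dots> = - (\<beta> / 2) * (\<Sum>k<r. q ^ k * (x k)\<^sup>2)
        + K * (\<Sum>k<r. \<Sum>l=Suc k..<r. q ^ k * (x l)\<^sup>2)"
      by (simp add: algebra_simps sum_subtractf sum.distrib sum_distrib_left sum_negf)
    also have "(\<Sum>k<r. \<Sum>l=Suc k..<r. q ^ k * (x l)\<^sup>2) = (\<Sum>l<r. (\<Sum>k<l. q ^ k) * (x l)\<^sup>2)"
    proof -
      have "(\<Sum>k<r. \<Sum>l=Suc k..<r. q ^ k * (x l)\<^sup>2) = (\<Sum>k<r. \<Sum>l | l < r \<and> k < l. q ^ k * (x l)\<^sup>2)"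
        by (intro sum.cong) auto
      also have "\<dots> = (\<Sum>l<r. \<Sum>k | k < r \<and> k < l. q ^ k * (x l)\<^sup>2)"
        using sum.swap_restrict[of "{..<r}" "{..<r}" "\<lambda>k l. q ^ k * (x l)\<^sup>2" "\<lambda>k l. k < l"] by simp
      also have "\<dots> = (\<Sum>l<r. \<Sum>k<l. q ^ k * (x l)\<^sup>2)" by (intro sum.cong) auto
      finally show ?thesis by (simp add: sum_distrib_right)
    qed
    also have "K * (\<Sum>l<r. (\<Sum>k<l. q ^ k) * (x l)\<^sup>2) \<le> K * (\<Sum>l<r. (q ^ l * \<beta> / (4 * K)) * (x l)\<^sup>2)"
      using geo K by (intro mult_left_mono sum_mono mult_right_mono) auto
    also have "\<dots> = \<beta> / 4 * (\<Sum>l<r. q ^ l * (x l)\<^sup>2)"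
      using K by (simp add: sum_distrib_left mult_ac)
    finally show ?thesis by (simp add: x_def)
  qed
  thus ?thesis using \<beta> q
    by (intro exI[of _ "\<lambda>k. q ^ k"] exI[of _ "\<beta> / 4"]) (auto simp: one_le_power)
qed


text \<open>
  Over the complex numbers the matrix is similar to an upper triangular one, whose diagonal
  consists of eigenvalues. The weighted sum of squares from \<open>triangular_dissipation\<close>, pulled back to
  the original coordinates, is a real quadratic form on real vectors, and \<open>Y\<close> is its matrix.
\<close>

theorem Hurwitz_imp_Lyapunov_matrix:
  assumes F: "F \<in> carrier_mat r r" and "Hurwitz F"
  shows "\<exists>Y c \<alpha>. Y \<in> carrier_mat r r \<and> transpose_mat Y = Y \<and> 0 < c \<and> 0 < \<alpha> \<and>
    (\<forall>w\<in>carrier_vec r. c * (w \<bullet> w) \<le> w \<bullet> (Y *\<^sub>v w)) \<and>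
    (\<forall>w\<in>carrier_vec r. w \<bullet> (Y *\<^sub>v (F *\<^sub>v w)) \<le> - \<alpha> * (w \<bullet> (Y *\<^sub>v w)))"
proof -
  define X where "X = complexify F"
  have X: "X \<in> carrier_mat r r" using F by (simp add: X_def complexify_def)
  obtain es where "char_poly X = (\<Prod>a\<leftarrow>es. [:- a, 1:])" using char_poly_factorized[OF X] by blast
  then obtain B where B: "B \<in> carrier_mat r r" "upper_triangular B" "similar_mat X B"
    using schur_decomposition_exists[OF X] by blast
  obtain P Q where "similar_mat_wit X B P Q" using B(3) unfolding similar_mat_def by blast
  note PQ = similar_mat_witD2[OF X this]
  have diag: "Re (B $$ (k, k)) < 0" if k: "k < r" for k
  proof -
    have "char_poly X = (\<Prod>a\<leftarrow>diag_mat B. [:- a, 1:])"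
      using char_poly_similar[OF B(3)] char_poly_upper_triangular[OF B(1,2)] by simp
    moreover have "B $$ (k, k) \<in> set (diag_mat B)" using k B(1) by (auto simp: diag_mat_def)
    ultimately have "poly (char_poly X) (B $$ (k, k)) = 0"
      by (auto simp: poly_prod_list prod_list_zero_iff)
    hence "eigenvalue X (B $$ (k, k))" by (simp add: eigenvalue_root_char_poly[OF X])
    thus ?thesis using \<open>Hurwitz F\<close> by (simp add: Hurwitz_def X_def)
  qed
  define \<beta> where "\<beta> = Min (insert 1 ((\<lambda>k. - Re (B $$ (k, k))) ` {..<r}))"
  have \<beta>: "0 < \<beta>" using diag by (auto simp: \<beta>_def)
  have diag_le: "Re (B $$ (k, k)) \<le> - \<beta>" if "k < r" for k
  proof -
    have "\<beta> \<le> - Re (B $$ (k, k))" unfolding \<beta>_def using that by (intro Min_le) auto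
    thus ?thesis by simp
  qed
  obtain \<rho> \<alpha> where \<alpha>: "0 < \<alpha>" and \<rho>: "\<And>k. 1 \<le> \<rho> k" and
    diss: "\<And>u. (\<Sum>k<r. \<rho> k * Re (cnj (u k) * (\<Sum>l=k..<r. B $$ (k, l) * u l)))
       \<le> - \<alpha> * (\<Sum>k<r. \<rho> k * (cmod (u k))\<^sup>2)"
    using triangular_dissipation[of r "\<lambda>k l. B $$ (k, l)" \<beta>, OF diag_le \<beta>] by blast
  define cv where "cv = map_vec complex_of_real"
  have cv: "cv w \<in> carrier_vec r" if "w \<in> carrier_vec r" for w using that by (simp add: cv_def)
  (* the triangular coordinates of w *)
  define u where "u = (\<lambda>w k. (Q *\<^sub>v cv w) $ k)"
  have u: "u w k = (\<Sum>j<r. Q $$ (k, j) * complex_of_real (w $ j))" if "w \<in> carrier_vec r" "k < r" for w k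
    using that PQ(7) by (simp add: u_def cv_def scalar_prod_def lessThan_atLeast0)
  have uF: "u (F *\<^sub>v w) k = (\<Sum>l=k..<r. B $$ (k, l) * u w l)" if w: "w \<in> carrier_vec r" and k: "k < r" for w k
  proof -
    have "cv (F *\<^sub>v w) = X *\<^sub>v cv w"
      using F w by (simp add: cv_def X_def complexify_def of_real_hom.mult_mat_vec_hom)
    hence 1: "Q *\<^sub>v cv (F *\<^sub>v w) = (Q * X) *\<^sub>v cv w" using PQ(7) X cv[OF w] by simp
    have "Q * X = (Q * P) * (B * Q)"
      unfolding PQ(3) using PQ(5-7) by (simp add: assoc_mult_mat[of _ r r _ r _ r])
    hence "Q * X = B * Q" using PQ(2,7) B(1) by simp
    hence "Q *\<^sub>v cv (F *\<^sub>v w) = B *\<^sub>v (Q *\<^sub>v cv w)"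
      using 1 PQ(7) B(1) cv[OF w] by simp
    hence "u (F *\<^sub>v w) k = (\<Sum>l<r. B $$ (k, l) * u w l)"
      using k B(1) PQ(7) by (simp add: u_def scalar_prod_def lessThan_atLeast0)
    also have "\<dots> = (\<Sum>l=k..<r. B $$ (k, l) * u w l)"
      using k B(1,2) by (intro sum.mono_neutral_right) auto
    finally show ?thesis .
  qed
  define Y where "Y = mat r r (\<lambda>(i, j). \<Sum>k<r. \<rho> k * Re (cnj (Q $$ (k, i)) * Q $$ (k, j)))"
  have Y: "Y \<in> carrier_mat r r" by (simp add: Y_def)
  have YT: "transpose_mat Y = Y"
    by (rule eq_matI) (auto simp: Y_def intro!: sum.cong)
  have form: "w \<bullet> (Y *\<^sub>v v) = (\<Sum>k<r. \<rho> k * Re (cnj (u w k) * u v k))"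
    if w: "w \<in> carrier_vec r" and v: "v \<in> carrier_vec r" for w v
  proof -
    have "w \<bullet> (Y *\<^sub>v v) = (\<Sum>i<r. \<Sum>j<r. \<Sum>k<r. w $ i * v $ j * (\<rho> k * Re (cnj (Q $$ (k, i)) * Q $$ (k, j))))"
      using w v Y by (simp add: scalar_prod_def lessThan_atLeast0 Y_def sum_distrib_left sum_distrib_right mult_ac)
    also have "\<dots> = (\<Sum>k<r. \<Sum>i<r. \<Sum>j<r. w $ i * v $ j * (\<rho> k * Re (cnj (Q $$ (k, i)) * Q $$ (k, j))))"
      by (subst (2) sum.swap, subst sum.swap) (rule refl)
    also have "\<dots> = (\<Sum>k<r. \<rho> k * Re (cnj (u w k) * u v k))"
    proof (rule sum.cong)
      fix k assume "k \<in> {..<r}"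
      hence "cnj (u w k) * u v k = (\<Sum>i<r. \<Sum>j<r. complex_of_real (w $ i * v $ j) * (cnj (Q $$ (k, i)) * Q $$ (k, j)))"
        using u[OF w] u[OF v] by (simp add: sum_product mult_ac) (rule sum.swap)
      hence "Re (cnj (u w k) * u v k) = (\<Sum>i<r. \<Sum>j<r. w $ i * v $ j * Re (cnj (Q $$ (k, i)) * Q $$ (k, j)))"
        by (simp only: Re_sum Re_complex_of_real times_complex.simps Im_complex_of_real) simp
      thus "(\<Sum>i<r. \<Sum>j<r. w $ i * v $ j * (\<rho> k * Re (cnj (Q $$ (k, i)) * Q $$ (k, j)))) = \<rho> k * Re (cnj (u w k) * u v k)"
        by (simp only: sum_distrib_left mult_ac)
    qed simp
    finally show ?thesis .
  qed
  have form_self: "w \<bullet> (Y *\<^sub>v w) = (\<Sum>k<r. \<rho> k * (cmod (u w k))\<^sup>2)" if w: "w \<in> carrier_vec r" for w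
    unfolding form[OF w w] cmod_power2 by (simp add: power2_eq_square)
  define C where "C = 1 + (\<Sum>i<r. \<Sum>k<r. (cmod (P $$ (i, k)))\<^sup>2)"
  have C: "0 < C" by (simp add: C_def sum_nonneg add_pos_nonneg)
  have coercive: "(1 / C) * (w \<bullet> w) \<le> w \<bullet> (Y *\<^sub>v w)" if w: "w \<in> carrier_vec r" for w
  proof -
    define E where "E = (\<Sum>k<r. (cmod (u w k))\<^sup>2)"
    have E: "0 \<le> E" by (simp add: E_def sum_nonneg)
    have "cv w = (P * Q) *\<^sub>v cv w" using PQ(1) cv[OF w] by simp
    hence cvw: "cv w = P *\<^sub>v (Q *\<^sub>v cv w)" using PQ(6,7) cv[OF w] by simp
    have "(w $ i)\<^sup>2 \<le> (\<Sum>k<r. (cmod (P $$ (i, k)))\<^sup>2) * E" if i: "i < r" for i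
    proof -
      have "complex_of_real (w $ i) = (\<Sum>k<r. P $$ (i, k) * u w k)"
        using arg_cong[OF cvw, of "\<lambda>v. v $ i"] i w PQ(6,7)
        by (simp add: cv_def u_def scalar_prod_def lessThan_atLeast0)
      hence "(w $ i)\<^sup>2 = (cmod (\<Sum>k<r. P $$ (i, k) * u w k))\<^sup>2"
        by (metis norm_of_real power2_abs)
      also have "\<dots> \<le> (\<Sum>k<r. (cmod (P $$ (i, k)))\<^sup>2) * E"
        unfolding E_def by (rule norm_sum_mult_sq_le)
      finally show ?thesis .
    qed
    hence "(\<Sum>i<r. (w $ i)\<^sup>2) \<le> (\<Sum>i<r. (\<Sum>k<r. (cmod (P $$ (i, k)))\<^sup>2) * E)" by (intro sum_mono) auto
    hence "w \<bullet> w \<le> (\<Sum>i<r. \<Sum>k<r. (cmod (P $$ (i, k)))\<^sup>2) * E"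
      using w by (simp add: scalar_prod_def lessThan_atLeast0 power2_eq_square sum_distrib_right)
    also have "\<dots> \<le> C * E" using E by (intro mult_right_mono) (simp_all add: C_def)
    also have "E \<le> w \<bullet> (Y *\<^sub>v w)"
      unfolding E_def form_self[OF w] using \<rho> by (intro sum_mono) (simp add: mult_le_cancel_right1)
    hence "C * E \<le> C * (w \<bullet> (Y *\<^sub>v w))" using C by simp
    finally show ?thesis using C by (simp add: field_simps)
  qed
  have decay: "w \<bullet> (Y *\<^sub>v (F *\<^sub>v w)) \<le> - \<alpha> * (w \<bullet> (Y *\<^sub>v w))" if w: "w \<in> carrier_vec r" for w
  proof -
    have Fw: "F *\<^sub>v w \<in> carrier_vec r" using F w by simp
    have "w \<bullet> (Y *\<^sub>v (F *\<^sub>v w)) = (\<Sum>k<r. \<rho> k * Re (cnj (u w k) * (\<Sum>l=k..<r. B $$ (k, l) * u w l)))"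
      unfolding form[OF w Fw] using uF[OF w] by (intro sum.cong) auto
    also have "\<dots> \<le> - \<alpha> * (\<Sum>k<r. \<rho> k * (cmod (u w k))\<^sup>2)" by (rule diss)
    finally show ?thesis by (simp only: form_self[OF w])
  qed
  show ?thesis
    using Y YT C \<alpha> coercive decay by (intro exI[of _ Y] exI[of _ "1 / C"] exI[of _ \<alpha>]) auto
qed

section \<open>The observability decomposition\<close>

lemma mat_of_cols_append_mult_block_col:
  assumes D: "D \<in> carrier_mat n r" and U: "U \<in> carrier_mat n k"
    and X: "X \<in> carrier_mat r m" and Y: "Y \<in> carrier_mat k m"
  shows "mat_of_cols n (cols D @ cols U) * block_col m [X, Y] = D * X + U * Y"
proof (rule eq_matI)
  fix i j assume ij: "i < dim_row (D * X + U * Y)" "j < dim_col (D * X + U * Y)"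
  hence i: "i < n" and j: "j < m" using U Y by auto
  let ?B = "block_col m [X, Y]" and ?T = "mat_of_cols n (cols D @ cols U)"
  have dims: "dim_row ?B = r + k" "dim_col ?B = m" "dim_row ?T = n" "dim_col ?T = r + k"
    using D U X Y by (auto simp: block_col_def)
  have T1: "?T $$ (i, l) = D $$ (i, l)" if "l < r" for l
    using that i D U by (simp add: mat_of_cols_index nth_append)
  have T2: "?T $$ (i, l) = U $$ (i, l - r)" if "r \<le> l" "l < r + k" for l
    using that i D U by (simp add: mat_of_cols_index nth_append)
  have B1: "?B $$ (l, j) = X $$ (l, j)" if "l < r" for l
    using that j X Y by (simp add: block_col_def mat_of_rows_index nth_append)
  have B2: "?B $$ (l, j) = Y $$ (l - r, j)" if "r \<le> l" "l < r + k" for l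
    using that j X Y by (simp add: block_col_def mat_of_rows_index nth_append)
  have "(?T * ?B) $$ (i, j) = (\<Sum>l=0..<r + k. ?T $$ (i, l) * ?B $$ (l, j))"
    using i j dims by (simp add: scalar_prod_def)
  also have "\<dots> = (\<Sum>l=0..<r. ?T $$ (i, l) * ?B $$ (l, j)) + (\<Sum>l=r..<r + k. ?T $$ (i, l) * ?B $$ (l, j))"
    by (simp add: sum.atLeastLessThan_concat)
  also have "\<dots> = (\<Sum>l=0..<r. D $$ (i, l) * X $$ (l, j)) + (\<Sum>l=r..<r + k. U $$ (i, l - r) * Y $$ (l - r, j))"
    using T1 T2 B1 B2 by (intro arg_cong2[where f = "(+)"] sum.cong) auto
  also have "(\<Sum>l=r..<r + k. U $$ (i, l - r) * Y $$ (l - r, j)) = (\<Sum>l=0..<k. U $$ (i, l) * Y $$ (l, j))"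
    using sum.shift_bounds_nat_ivl[of "\<lambda>l. U $$ (i, l - r) * Y $$ (l - r, j)" 0 r k] by (simp add: add.commute)
  finally show "(?T * ?B) $$ (i, j) = (D * X + U * Y) $$ (i, j)"
    using i j D U X Y by (simp add: scalar_prod_def)
qed (use D U X Y in \<open>auto simp: block_col_def\<close>)

lemma transpose_mat_of_cols_append:
  assumes "D \<in> carrier_mat n r" "U \<in> carrier_mat n k"
  shows "transpose_mat (mat_of_cols n (cols D @ cols U)) = block_col n [transpose_mat D, transpose_mat U]"
  using assms by (simp add: block_col_def transpose_mat_of_cols)

lemma dim_col_obs_mat: "dim_col (obs_mat n C A) = n"
  by (simp add: obs_mat_def block_col_def)

lemma obs_mat_mult_vec_eq_0:
  assumes C: "C \<in> carrier_mat m n" and A: "A \<in> carrier_mat n n" and v: "v \<in> carrier_vec n"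
  shows "obs_mat n C A *\<^sub>v v = 0\<^sub>v (dim_row (obs_mat n C A)) \<longleftrightarrow> (\<forall>k<n. C *\<^sub>v (A ^\<^sub>m k *\<^sub>v v) = 0\<^sub>v m)"
proof -
  have "obs_mat n C A *\<^sub>v v = 0\<^sub>v (dim_row (obs_mat n C A))
      \<longleftrightarrow> (\<forall>X\<in>set (map (\<lambda>k. C * A ^\<^sub>m k) [0..<n]). X *\<^sub>v v = 0\<^sub>v (dim_row X))"
    unfolding obs_mat_def using A v by (intro block_col_mult_vec_eq_0) auto
  also have "\<dots> \<longleftrightarrow> (\<forall>k<n. (C * A ^\<^sub>m k) *\<^sub>v v = 0\<^sub>v m)" using C by auto
  also have "\<dots> \<longleftrightarrow> (\<forall>k<n. C *\<^sub>v (A ^\<^sub>m k *\<^sub>v v) = 0\<^sub>v m)"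
    using C A v by (simp add: assoc_mult_mat_vec[of _ m n _ n])
  finally show ?thesis .
qed

lemma pow_similar:
  assumes "A \<in> carrier_mat n n" "P \<in> carrier_mat n n" "Q \<in> carrier_mat n n" "P * Q = 1\<^sub>m n" "Q * P = 1\<^sub>m n"
    and v: "v \<in> carrier_vec n"
  shows "A ^\<^sub>m k *\<^sub>v (P *\<^sub>v v) = P *\<^sub>v (((\<lambda>x. (Q * A * P) *\<^sub>v x) ^^ k) v)"
  using v
proof (induction k arbitrary: v)
  case (Suc k)
  have Sv: "(Q * A * P) *\<^sub>v v \<in> carrier_vec n"
    using assms Suc.prems by (intro mult_mat_vec_carrier[of _ n n] mult_carrier_mat[of _ n n])
  have "A ^\<^sub>m Suc k *\<^sub>v (P *\<^sub>v v) = A ^\<^sub>m k *\<^sub>v (A *\<^sub>v (P *\<^sub>v v))"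
    using assms Suc.prems by (simp add: assoc_mult_mat_vec[of _ n n _ n])
  also have "A *\<^sub>v (P *\<^sub>v v) = (P * Q) *\<^sub>v (A *\<^sub>v (P *\<^sub>v v))" using assms Suc.prems by simp
  also have "\<dots> = P *\<^sub>v ((Q * A * P) *\<^sub>v v)"
    using assms(1-3) Suc.prems by (simp add: assoc_mult_mat_vec[of _ n n _ n])
  finally show ?case using Suc.IH[OF Sv] by (simp add: funpow_swap1)
qed (use assms in simp)

text \<open>
  What the dynamics of the errors needs to know about \<open>L\<close> and \<open>M\<close>, without the basis of the
  unobservable subspace: \<open>D\<close> is an isometry onto the observable subspace and \<open>E\<close> the orthogonal
  projection onto its complement; \<open>S\<close> respects the splitting; \<open>M\<close> is \<open>E\<close> in the coordinates \<open>P\<close>;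
  output injection through \<open>L\<close> acts only on the observable coordinates, where it produces the closed
  loop matrix \<open>F\<close>.
\<close>

definition observability_coordinates ::
    "nat \<Rightarrow> nat \<Rightarrow> real mat \<Rightarrow> real mat \<Rightarrow> real mat \<Rightarrow> real mat \<Rightarrow> real mat
      \<Rightarrow> nat \<Rightarrow> real mat \<Rightarrow> real mat \<Rightarrow> real mat \<Rightarrow> bool" where
  "observability_coordinates n m A C P L M r D E F \<longleftrightarrow>
     (let Q = mat_inv P; S = Q * A * P in
      D \<in> carrier_mat n r \<and> E \<in> carrier_mat n n \<and> F \<in> carrier_mat r r \<and> Hurwitz F
      \<and> transpose_mat E = E
      \<and> (\<forall>w\<in>carrier_vec r. (D *\<^sub>v w) \<bullet> (D *\<^sub>v w) = w \<bullet> w)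
      \<and> (\<forall>v\<in>carrier_vec n. D *\<^sub>v (transpose_mat D *\<^sub>v v) + E *\<^sub>v v = v
          \<and> transpose_mat D *\<^sub>v (E *\<^sub>v v) = 0\<^sub>v r \<and> E *\<^sub>v (E *\<^sub>v v) = E *\<^sub>v v
          \<and> E *\<^sub>v (S *\<^sub>v v) = S *\<^sub>v (E *\<^sub>v v)
          \<and> Q *\<^sub>v (M *\<^sub>v v) = E *\<^sub>v (Q *\<^sub>v v)
          \<and> transpose_mat D *\<^sub>v (S *\<^sub>v v - Q *\<^sub>v (L *\<^sub>v (C *\<^sub>v (P *\<^sub>v v)))) = F *\<^sub>v (transpose_mat D *\<^sub>v v)
          \<and> (E *\<^sub>v v = v \<longrightarrow> (\<forall>k<n. C *\<^sub>v (A ^\<^sub>m k *\<^sub>v (P *\<^sub>v v)) = 0\<^sub>v m)))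
      \<and> (\<forall>y\<in>carrier_vec m. E *\<^sub>v (Q *\<^sub>v (L *\<^sub>v y)) = 0\<^sub>v n))"

text \<open>
  The kernel of the observability matrix is invariant under \<open>S\<close> by \<open>Krylov_kernel_step\<close>. Since \<open>S\<close>
  is skew-symmetric, the orthogonal complement is invariant as well, which is why the off-diagonal
  blocks of the transformed plant vanish and why \<open>E\<close> commutes with \<open>S\<close>.
\<close>

lemma gain_design_decomposition:
  assumes A: "A \<in> carrier_mat n n" and C: "C \<in> carrier_mat m n"
    and P: "P \<in> carrier_mat n n" "invertible_mat P"
    and skew: "skew_symmetric (mat_inv P * A * P)" and gain: "gain_design n m A C P L M"
  shows "L \<in> carrier_mat n m \<and> M \<in> carrier_mat n n \<and>
    (\<exists>r D E F. observability_coordinates n m A C P L M r D E F)"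
proof -
  define Q where "Q = mat_inv P"
  define S where "S = Q * A * P"
  have Q: "Q \<in> carrier_mat n n" "P * Q = 1\<^sub>m n" "Q * P = 1\<^sub>m n"
    unfolding Q_def by (rule mat_inv_props[OF P])+
  have S: "S \<in> carrier_mat n n" using Q A P by (simp add: S_def)
  have ST: "transpose_mat S = - S" using skew by (simp add: skew_symmetric_def S_def Q_def)
  define Ob where "Ob = obs_mat n C A"
  define \<nu> where "\<nu> = n - mat_rank Ob"
  define r where "r = n - \<nu>"
  have r\<nu>: "r + \<nu> = n" by (simp add: r_def \<nu>_def)
  let ?T = "\<lambda>D U. mat_of_cols n (cols D @ cols U)"
  obtain U D Lo where
    U0: "orthonormal_basis_mat n \<nu> U (mat_kernel (Ob * P))" and
    D0: "orthonormal_basis_mat n r D (mat_im (transpose_mat P * transpose_mat Ob))" and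
    Lo: "Lo \<in> carrier_mat r m" and
    hur: "Hurwitz (fst (split_block (mat_inv (P * ?T D U) * A * (P * ?T D U)) r r)
      - Lo * fst (split_block (C * P * ?T D U) m r))" and
    L: "L = P * ?T D U * block_col m [Lo, 0\<^sub>m \<nu> m]" and
    M: "M = P * ?T D U * four_block_mat (0\<^sub>m r r) (0\<^sub>m r \<nu>) (0\<^sub>m \<nu> r) (1\<^sub>m \<nu>)
              * transpose_mat (?T D U) * mat_inv P"
    using gain unfolding gain_design_def Let_def Ob_def[symmetric] \<nu>_def[symmetric] r_def[symmetric]
    by (elim exE conjE) (rule that)
  define T where "T = mat_of_cols n (cols D @ cols U)"
  note hur = hur[folded T_def] and L = L[folded T_def] and M = M[folded T_def]
  have U: "U \<in> carrier_mat n \<nu>" "transpose_mat U * U = 1\<^sub>m \<nu>" "mat_im U = mat_kernel (Ob * P)"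
    using U0 by (auto simp: orthonormal_basis_mat_def)
  have D: "D \<in> carrier_mat n r" "transpose_mat D * D = 1\<^sub>m r" "mat_im D = mat_im (transpose_mat P * transpose_mat Ob)"
    using D0 by (auto simp: orthonormal_basis_mat_def)
  obtain l where Ob: "Ob \<in> carrier_mat l n"
    using dim_col_obs_mat unfolding Ob_def by (metis carrier_matI)
  have OP: "Ob * P \<in> carrier_mat (l) n" by (rule mult_carrier_mat[OF Ob P(1)])
  have T: "T \<in> carrier_mat n n" using U(1) D(1) r\<nu> unfolding T_def by (intro carrier_matI) auto
  have TT: "transpose_mat T = block_col n [transpose_mat D, transpose_mat U]"
    unfolding T_def using D U by (intro transpose_mat_of_cols_append) auto
  define D' U' where "D' = transpose_mat D" and "U' = transpose_mat U"
  have D': "D' \<in> carrier_mat r n" and U': "U' \<in> carrier_mat \<nu> n" using D U by (auto simp: D'_def U'_def)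
  have colT: "col T i = (if i < r then col D i else col U (i - r))" if "i < n" for i
    using that D U r\<nu> unfolding T_def by (subst col_mat_of_cols) (auto simp: nth_append intro!: carrier_vecI)

  \<comment> \<open>The kernel is expressed through powers of \<open>S\<close>, to which \<open>Krylov_kernel_step\<close> applies.\<close>
  have ker: "(Ob * P) *\<^sub>v v = 0\<^sub>v (l) \<longleftrightarrow> (\<forall>k<n. C *\<^sub>v (A ^\<^sub>m k *\<^sub>v (P *\<^sub>v v)) = 0\<^sub>v m)"
    if v: "v \<in> carrier_vec n" for v
  proof -
    have Pv: "P *\<^sub>v v \<in> carrier_vec n" using P(1) v by simp
    have "(Ob * P) *\<^sub>v v = Ob *\<^sub>v (P *\<^sub>v v)" by (rule assoc_mult_mat_vec[OF Ob P(1) v])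
    thus ?thesis using obs_mat_mult_vec_eq_0[OF C A Pv] Ob unfolding Ob_def[symmetric] by simp
  qed
  have ker_S: "(Ob * P) *\<^sub>v v = 0\<^sub>v (l) \<longleftrightarrow> (\<forall>k<n. (C * P) *\<^sub>v ((\<lambda>x. S *\<^sub>v x) ^^ k) v = 0\<^sub>v m)"
    if v: "v \<in> carrier_vec n" for v
  proof -
    have "((\<lambda>x. S *\<^sub>v x) ^^ k) v \<in> carrier_vec n" for k using S v by (induction k) auto
    hence "C *\<^sub>v (A ^\<^sub>m k *\<^sub>v (P *\<^sub>v v)) = (C * P) *\<^sub>v ((\<lambda>x. S *\<^sub>v x) ^^ k) v" for k
      using pow_similar[OF A P(1) Q v, of k] C P by (simp add: S_def)
    thus ?thesis using ker[OF v] by simp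
  qed
  have ker_inv: "(Ob * P) *\<^sub>v (S *\<^sub>v v) = 0\<^sub>v (l)"
    if v: "v \<in> carrier_vec n" "(Ob * P) *\<^sub>v v = 0\<^sub>v (l)" for v
  proof -
    have z: "(C * P) *\<^sub>v ((\<lambda>x. S *\<^sub>v x) ^^ k) v = 0\<^sub>v m" if "k < n" for k
      using ker_S[OF v(1)] v(2) that by blast
    have zn: "(C * P) *\<^sub>v ((\<lambda>x. S *\<^sub>v x) ^^ n) v = 0\<^sub>v m"
      using Krylov_kernel_step[OF S _ v(1) z] C P by simp
    have "(C * P) *\<^sub>v ((\<lambda>x. S *\<^sub>v x) ^^ k) (S *\<^sub>v v) = 0\<^sub>v m" if "k < n" for k
    proof (cases "Suc k = n")
      case True
      have "((\<lambda>x. S *\<^sub>v x) ^^ k) (S *\<^sub>v v) = ((\<lambda>x. S *\<^sub>v x) ^^ n) v"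
        unfolding True[symmetric] by (simp add: funpow_swap1)
      thus ?thesis using zn by simp
    next
      case False
      hence "(C * P) *\<^sub>v ((\<lambda>x. S *\<^sub>v x) ^^ Suc k) v = 0\<^sub>v m" using z[of "Suc k"] that by simp
      thus ?thesis by (simp add: funpow_swap1)
    qed
    thus ?thesis using ker_S[of "S *\<^sub>v v"] S v(1) mult_mat_vec_carrier by blast
  qed
  have ker_C: "C *\<^sub>v (P *\<^sub>v v) = 0\<^sub>v m"
    if v: "v \<in> carrier_vec n" "(Ob * P) *\<^sub>v v = 0\<^sub>v (l)" for v
  proof (cases "n = 0")
    case True
    thus ?thesis using C P v by (intro eq_vecI) (auto simp: scalar_prod_def)
  next
    case False
    hence "C *\<^sub>v (A ^\<^sub>m 0 *\<^sub>v (P *\<^sub>v v)) = 0\<^sub>v m" using ker[OF v(1)] v(2) by blast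
    thus ?thesis using A P v by simp
  qed
  have U_ker: "(Ob * P) *\<^sub>v (U *\<^sub>v x) = 0\<^sub>v (l)" if "x \<in> carrier_vec \<nu>" for x
  proof -
    have "U *\<^sub>v x \<in> mat_kernel (Ob * P)" using U(3) mat_im_eq[OF U(1)] that by blast
    thus ?thesis using mat_kernelD[OF OP] by blast
  qed
  have ker_U: "\<exists>x\<in>carrier_vec \<nu>. v = U *\<^sub>v x"
    if "v \<in> carrier_vec n" "(Ob * P) *\<^sub>v v = 0\<^sub>v (l)" for v
  proof -
    have "v \<in> mat_im U" unfolding U(3) using mat_kernelI[OF OP that] .
    thus ?thesis using mat_im_eq[OF U(1)] by blast
  qed
  have D'U: "D' *\<^sub>v (U *\<^sub>v x) = 0\<^sub>v r" if x: "x \<in> carrier_vec \<nu>" for x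
  proof -
    define y where "y = D' *\<^sub>v (U *\<^sub>v x)"
    have y: "y \<in> carrier_vec r" using x U D' by (simp add: y_def)
    have tr: "transpose_mat P * transpose_mat Ob = transpose_mat (Ob * P)"
      by (rule transpose_mult[OF Ob P(1), symmetric])
    have "D *\<^sub>v y \<in> mat_im (transpose_mat (Ob * P))"
      unfolding tr[symmetric] D(3)[symmetric] using mat_im_eq[OF D(1)] y by blast
    then obtain z where z: "z \<in> carrier_vec (l)" "D *\<^sub>v y = transpose_mat (Ob * P) *\<^sub>v z"
      using mat_im_eq[of "transpose_mat (Ob * P)" n "l"] OP by auto
    have Ux: "U *\<^sub>v x \<in> carrier_vec n" using U x by simp
    have "y \<bullet> y = (U *\<^sub>v x) \<bullet> (D *\<^sub>v y)"
      using transpose_vec_mult_scalar[OF D(1) y Ux] by (simp only: y_def D'_def)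
    also have "\<dots> = ((Ob * P) *\<^sub>v (U *\<^sub>v x)) \<bullet> z"
    proof -
      have 1: "transpose_mat (Ob * P) *\<^sub>v z \<in> carrier_vec n" using z(2) D(1) y by (metis mult_mat_vec_carrier)
      have 2: "(Ob * P) *\<^sub>v (U *\<^sub>v x) \<in> carrier_vec (l)" using OP Ux by (rule mult_mat_vec_carrier)
      show ?thesis
        unfolding z(2) comm_scalar_prod[OF Ux 1] transpose_vec_mult_scalar[OF OP Ux z(1)]
        by (rule comm_scalar_prod[OF z(1) 2])
    qed
    also have "\<dots> = 0" unfolding U_ker[OF x] using z(1) by simp
    finally show ?thesis using scalar_prod_self_eq_0[OF y] by (simp add: y_def)
  qed

  \<comment> \<open>\<open>T = [D U]\<close> is square with orthonormal columns, so \<open>T T\<^sup>T = 1\<close>: every vector splits along \<open>D\<close> and \<open>U\<close>.\<close>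
  have D'D: "D' *\<^sub>v (D *\<^sub>v w) = w" if "w \<in> carrier_vec r" for w
    using assoc_mult_mat_vec[OF D' D(1) that] D(2) that unfolding D'_def by simp
  have U'U: "U' *\<^sub>v (U *\<^sub>v x) = x" if "x \<in> carrier_vec \<nu>" for x
    using assoc_mult_mat_vec[OF U' U(1) that] U(2) that unfolding U'_def by simp
  have U'D: "U' *\<^sub>v (D *\<^sub>v w) = 0\<^sub>v \<nu>" if w: "w \<in> carrier_vec r" for w
  proof -
    define y where "y = U' *\<^sub>v (D *\<^sub>v w)"
    have Dw: "D *\<^sub>v w \<in> carrier_vec n" using D w by simp
    have y: "y \<in> carrier_vec \<nu>" using Dw U' by (simp add: y_def)
    have Uy: "U *\<^sub>v y \<in> carrier_vec n" using U y by simp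
    have "y \<bullet> y = (D *\<^sub>v w) \<bullet> (U *\<^sub>v y)"
      using transpose_vec_mult_scalar[OF U(1) y Dw] by (simp only: y_def U'_def)
    also have "\<dots> = (D' *\<^sub>v (U *\<^sub>v y)) \<bullet> w"
      unfolding D'_def transpose_vec_mult_scalar[OF D(1) w Uy] by (rule comm_scalar_prod[OF Dw Uy])
    also have "\<dots> = 0" unfolding D'U[OF y] using w by simp
    finally show ?thesis using scalar_prod_self_eq_0[OF y] by (simp add: y_def)
  qed
  have cross: "col D i \<bullet> col U j = 0" if "i < r" "j < \<nu>" for i j
  proof -
    have "col U j = U *\<^sub>v unit_vec \<nu> j"
      using U(1) that by (intro eq_vecI) auto
    hence "D' *\<^sub>v col U j = 0\<^sub>v r" using D'U[of "unit_vec \<nu> j"] by simp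
    hence "(D' *\<^sub>v col U j) $ i = 0" using that by simp
    thus ?thesis using that D(1) by (simp add: D'_def)
  qed
  have tTT: "transpose_mat T * T = 1\<^sub>m n"
  proof (rule eq_matI)
    fix i j assume "i < dim_row (1\<^sub>m n :: real mat)" "j < dim_col (1\<^sub>m n :: real mat)"
    hence i: "i < n" and j: "j < n" by auto
    have DD: "col D i \<bullet> col D j = (if i = j then 1 else 0)" if "i < r" "j < r" for i j
    proof -
      have "(transpose_mat D * D) $$ (i, j) = col D i \<bullet> col D j" using that D(1) by simp
      thus ?thesis unfolding D(2) using that by simp
    qed
    have UU: "col U i \<bullet> col U j = (if i = j then 1 else 0)" if "i < \<nu>" "j < \<nu>" for i j
    proof -
      have "(transpose_mat U * U) $$ (i, j) = col U i \<bullet> col U j" using that U(1) by simp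
      thus ?thesis unfolding U(2) using that by simp
    qed
    have UD: "col U i \<bullet> col D j = 0" if "i < \<nu>" "j < r" for i j
    proof -
      have "col U i \<in> carrier_vec n" "col D j \<in> carrier_vec n"
        using col_carrier_vec[OF that(1) U(1)] col_carrier_vec[OF that(2) D(1)] .
      hence "col U i \<bullet> col D j = col D j \<bullet> col U i" by (rule comm_scalar_prod)
      thus ?thesis using cross[OF that(2,1)] by simp
    qed
    have "col T i \<bullet> col T j = (if i = j then 1 else 0)"
    proof (cases "i < r"; cases "j < r")
      assume "i < r" "j < r"
      thus ?thesis unfolding colT[OF i] colT[OF j] using DD by simp
    next
      assume ij: "i < r" "\<not> j < r"
      hence "j - r < \<nu>" using j r\<nu> by linarith
      thus ?thesis unfolding colT[OF i] colT[OF j] using cross ij by auto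
    next
      assume ij: "\<not> i < r" "j < r"
      hence "i - r < \<nu>" using i r\<nu> by linarith
      thus ?thesis unfolding colT[OF i] colT[OF j] using UD ij by auto
    next
      assume ij: "\<not> i < r" "\<not> j < r"
      hence "i - r < \<nu>" "j - r < \<nu>" "i - r = j - r \<longleftrightarrow> i = j" using i j r\<nu> by linarith+
      thus ?thesis unfolding colT[OF i] colT[OF j] using UU ij by simp
    qed
    moreover have "(transpose_mat T * T) $$ (i, j) = col T i \<bullet> col T j" using i j T by simp
    ultimately show "(transpose_mat T * T) $$ (i, j) = 1\<^sub>m n $$ (i, j)" using i j by simp
  qed (use T in simp_all)
  have TT1: "T * transpose_mat T = 1\<^sub>m n"
    by (rule mat_mult_left_right_inverse[OF _ T tTT]) (use T in simp)
  have TTt: "T * transpose_mat T = D * D' + U * U'"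
    unfolding TT unfolding T_def D'_def[symmetric] U'_def[symmetric]
    by (rule mat_of_cols_append_mult_block_col[OF D(1) U(1) D' U'])
  have dec: "D *\<^sub>v (D' *\<^sub>v v) + U *\<^sub>v (U' *\<^sub>v v) = v" if v: "v \<in> carrier_vec n" for v
  proof -
    have "v = (D * D' + U * U') *\<^sub>v v" using TT1 TTt v by simp
    also have "\<dots> = (D * D') *\<^sub>v v + (U * U') *\<^sub>v v"
      using D(1) D' U(1) U' v by (intro add_mult_distrib_mat_vec[of _ n n]) auto
    finally show ?thesis
      unfolding assoc_mult_mat_vec[OF D(1) D' v] assoc_mult_mat_vec[OF U(1) U' v] by simp
  qed

  \<comment> \<open>The image of \<open>U\<close> is the invariant kernel; skew-symmetry transfers the invariance to the image of \<open>D\<close>.\<close>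
  have D'SU: "D' *\<^sub>v (S *\<^sub>v (U *\<^sub>v x)) = 0\<^sub>v r" if x: "x \<in> carrier_vec \<nu>" for x
  proof -
    have Ux: "U *\<^sub>v x \<in> carrier_vec n" using U x by simp
    hence "S *\<^sub>v (U *\<^sub>v x) \<in> carrier_vec n" using S by simp
    then obtain x' where "x' \<in> carrier_vec \<nu>" "S *\<^sub>v (U *\<^sub>v x) = U *\<^sub>v x'"
      using ker_U ker_inv[OF Ux U_ker[OF x]] by blast
    thus ?thesis using D'U by simp
  qed
  have U'SD: "U' *\<^sub>v (S *\<^sub>v (D *\<^sub>v w)) = 0\<^sub>v \<nu>" if w: "w \<in> carrier_vec r" for w
  proof -
    define y where "y = U' *\<^sub>v (S *\<^sub>v (D *\<^sub>v w))"
    have Dw: "D *\<^sub>v w \<in> carrier_vec n" using D w by simp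
    have SDw: "S *\<^sub>v (D *\<^sub>v w) \<in> carrier_vec n" using S Dw by simp
    have y: "y \<in> carrier_vec \<nu>" using SDw U' by (simp add: y_def)
    have Uy: "U *\<^sub>v y \<in> carrier_vec n" using U y by simp
    have SUy: "S *\<^sub>v (U *\<^sub>v y) \<in> carrier_vec n" using S Uy by simp
    have "y \<bullet> y = (S *\<^sub>v (D *\<^sub>v w)) \<bullet> (U *\<^sub>v y)"
      using transpose_vec_mult_scalar[OF U(1) y SDw] by (simp only: y_def U'_def)
    also have "S *\<^sub>v (D *\<^sub>v w) = - (transpose_mat S *\<^sub>v (D *\<^sub>v w))"
      unfolding ST using S D(1) Dw by simp
    also have "- (transpose_mat S *\<^sub>v (D *\<^sub>v w)) \<bullet> (U *\<^sub>v y) = - ((D *\<^sub>v w) \<bullet> (S *\<^sub>v (U *\<^sub>v y)))"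
      unfolding transpose_vec_mult_scalar[OF S Uy Dw, symmetric]
      using S U(1) D(1) by (intro scalar_prod_uminus_left) auto
    also have "(D *\<^sub>v w) \<bullet> (S *\<^sub>v (U *\<^sub>v y)) = (D' *\<^sub>v (S *\<^sub>v (U *\<^sub>v y))) \<bullet> w"
      unfolding D'_def transpose_vec_mult_scalar[OF D(1) w SUy] by (rule comm_scalar_prod[OF Dw SUy])
    also have "\<dots> = 0" unfolding D'SU[OF y] using w by simp
    finally show ?thesis using scalar_prod_self_eq_0[OF y] by (simp add: y_def)
  qed
  define E where "E = U * U'"
  have E: "E \<in> carrier_mat n n" using U U' by (simp add: E_def)
  have Ev: "E *\<^sub>v v = U *\<^sub>v (U' *\<^sub>v v)" if "v \<in> carrier_vec n" for v
    unfolding E_def by (rule assoc_mult_mat_vec[OF U(1) U' that])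
  have ES: "E *\<^sub>v (S *\<^sub>v v) = S *\<^sub>v (E *\<^sub>v v)" if v: "v \<in> carrier_vec n" for v
  proof -
    define a b where "a = D' *\<^sub>v v" and "b = U' *\<^sub>v v"
    have a: "a \<in> carrier_vec r" and b: "b \<in> carrier_vec \<nu>" using D' U' v by (auto simp: a_def b_def)
    have Da: "D *\<^sub>v a \<in> carrier_vec n" and Ub: "U *\<^sub>v b \<in> carrier_vec n" using D U a b by auto
    have SDa: "S *\<^sub>v (D *\<^sub>v a) \<in> carrier_vec n" and SUb: "S *\<^sub>v (U *\<^sub>v b) \<in> carrier_vec n" using S Da Ub by auto
    have "S *\<^sub>v v = S *\<^sub>v (D *\<^sub>v a) + S *\<^sub>v (U *\<^sub>v b)"
      using mult_add_distrib_mat_vec[OF S Da Ub] dec[OF v] by (simp add: a_def b_def)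
    hence "U' *\<^sub>v (S *\<^sub>v v) = U' *\<^sub>v (S *\<^sub>v (U *\<^sub>v b))"
      using mult_add_distrib_mat_vec[OF U' SDa SUb] U'SD[OF a] U' SUb by simp
    hence "E *\<^sub>v (S *\<^sub>v v) = U *\<^sub>v (U' *\<^sub>v (S *\<^sub>v (U *\<^sub>v b)))" using Ev S v by simp
    also have "\<dots> = S *\<^sub>v (U *\<^sub>v b)"
    proof -
      have "D *\<^sub>v 0\<^sub>v r = 0\<^sub>v n" using D(1) by (intro eq_vecI) auto
      moreover have "U *\<^sub>v (U' *\<^sub>v (S *\<^sub>v (U *\<^sub>v b))) \<in> carrier_vec n" using U(1) U' SUb by simp
      ultimately show ?thesis using dec[OF SUb] D'SU[OF b] by simp
    qed
    finally show ?thesis using Ev[OF v] by (simp add: b_def)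
  qed

  \<comment> \<open>As \<open>T\<close> is orthogonal, \<open>T\<^sup>T Q\<close> inverts \<open>P T\<close>, and the blocks in the design become products with \<open>D\<close> and \<open>U\<close>.\<close>
  have tT: "transpose_mat T \<in> carrier_mat n n" using T by simp
  have PT: "P * T \<in> carrier_mat n n" using P(1) T by simp
  have inv: "mat_inv (P * T) = transpose_mat T * Q"
  proof (rule mat_inv_unique[OF PT])
    show "transpose_mat T * Q \<in> carrier_mat n n" using tT Q(1) by simp
    have "P * T * (transpose_mat T * Q) = P * ((T * transpose_mat T) * Q)"
      using P(1) T tT Q(1) by (simp add: assoc_mult_mat[of _ n n _ n _ n])
    thus "P * T * (transpose_mat T * Q) = 1\<^sub>m n" unfolding TT1 using Q by simp
  qed
  have Qc: "Q * (P * X) = X" if "X \<in> carrier_mat n k" for X k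
    using assoc_mult_mat[OF Q(1) P(1) that] Q(3) that by simp
  define Z :: "real mat" where "Z = four_block_mat (0\<^sub>m r r) (0\<^sub>m r \<nu>) (0\<^sub>m \<nu> r) (1\<^sub>m \<nu>)"
  have Z: "Z \<in> carrier_mat n n" using r\<nu> by (auto simp: Z_def)
  define BL where "BL = block_col m [Lo, 0\<^sub>m \<nu> m]"
  have BL: "BL \<in> carrier_mat n m" using Lo r\<nu> by (auto simp: BL_def block_col_def)
  have TBL: "T * BL = D * Lo"
  proof -
    have "T * BL = D * Lo + U * 0\<^sub>m \<nu> m"
      unfolding T_def BL_def by (rule mat_of_cols_append_mult_block_col[OF D(1) U(1) Lo]) simp
    moreover have "U * 0\<^sub>m \<nu> m = 0\<^sub>m n m" using U(1) by simp
    moreover have "D * Lo \<in> carrier_mat n m" using D(1) Lo by simp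
    ultimately show ?thesis by simp
  qed
  have L': "L = P * (T * BL)"
    unfolding L BL_def[symmetric] by (rule assoc_mult_mat[OF P(1) T BL])
  have Lc: "L \<in> carrier_mat n m" unfolding L' using P(1) T BL by simp
  have QL: "Q *\<^sub>v (L *\<^sub>v y) = D *\<^sub>v (Lo *\<^sub>v y)" if y: "y \<in> carrier_vec m" for y
  proof -
    have "Q * L = D * Lo" unfolding L' TBL by (rule Qc[of _ m]) (use D(1) Lo in simp)
    thus ?thesis using assoc_mult_mat_vec[OF Q(1) Lc y] assoc_mult_mat_vec[OF D(1) Lo y] by simp
  qed
  have TZ: "T * Z * transpose_mat T = E"
  proof -
    have "T * Z = mat_of_cols n (cols (0\<^sub>m n r) @ cols U)"
    proof (rule eq_matI)
      fix i j assume "i < dim_row (mat_of_cols n (cols (0\<^sub>m n r) @ cols U))"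
        "j < dim_col (mat_of_cols n (cols (0\<^sub>m n r) @ cols U))"
      hence i: "i < n" and j: "j < n" using U(1) r\<nu> by auto
      have Zl: "Z $$ (l, j) = (if l = j \<and> r \<le> j then 1 else 0)" if "l < n" for l
        using that j r\<nu> by (auto simp: Z_def)
      have "(T * Z) $$ (i, j) = (\<Sum>l=0..<n. T $$ (i, l) * Z $$ (l, j))"
        using i j T Z by (simp add: scalar_prod_def)
      also have "\<dots> = (\<Sum>l=0..<n. if l = j then (if r \<le> j then T $$ (i, j) else 0) else 0)"
        using Zl by (intro sum.cong) auto
      also have "\<dots> = (if r \<le> j then T $$ (i, j) else 0)" using j by simp
      also have "\<dots> = mat_of_cols n (cols (0\<^sub>m n r) @ cols U) $$ (i, j)"
        using i j r\<nu> U(1) D(1) by (auto simp: T_def mat_of_cols_index nth_append)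
      finally show "(T * Z) $$ (i, j) = mat_of_cols n (cols (0\<^sub>m n r) @ cols U) $$ (i, j)" .
    qed (use T Z U(1) r\<nu> in auto)
    hence "T * Z * transpose_mat T = 0\<^sub>m n r * D' + U * U'"
      unfolding TT D'_def[symmetric] U'_def[symmetric]
      using mat_of_cols_append_mult_block_col[OF _ U(1) D' U', of "0\<^sub>m n r"] by simp
    also have "0\<^sub>m n r * D' = 0\<^sub>m n n" using D' by simp
    finally show ?thesis using E by (simp add: E_def)
  qed
  have M': "M = P * (E * Q)"
  proof -
    have "M = P * T * Z * transpose_mat T * Q" unfolding M Z_def Q_def ..
    also have "\<dots> = P * ((T * Z * transpose_mat T) * Q)"
      using P(1) T Z tT Q(1) by (simp add: assoc_mult_mat[of _ n n _ n _ n])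
    finally show ?thesis unfolding TZ .
  qed
  have EQ: "E * Q \<in> carrier_mat n n" using E Q(1) by simp
  have Mc: "M \<in> carrier_mat n n" unfolding M' using P(1) EQ by simp
  have QM: "Q *\<^sub>v (M *\<^sub>v v) = E *\<^sub>v (Q *\<^sub>v v)" if v: "v \<in> carrier_vec n" for v
    using assoc_mult_mat_vec[OF Q(1) Mc v] assoc_mult_mat_vec[OF E Q(1) v] Qc[OF EQ] by (simp add: M')
  define Ao where "Ao = D' * (S * D)"
  define Co where "Co = C * P * D"
  have CP: "C * P \<in> carrier_mat m n" using C P(1) by simp
  have SD: "S * D \<in> carrier_mat n r" using S D(1) by simp
  have Ao: "Ao \<in> carrier_mat r r" using D' SD by (simp add: Ao_def)
  have Co: "Co \<in> carrier_mat m r" using CP D(1) by (simp add: Co_def)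
  have colTr: "col T i = col D i" if "i < r" for i using colT[of i] that r\<nu> by simp
  have "mat_inv (P * T) * A * (P * T) = transpose_mat T * (S * T)"
    unfolding inv S_def using tT Q(1) A P(1) T by (simp add: assoc_mult_mat[of _ n n _ n _ n])
  moreover have "fst (split_block (transpose_mat T * (S * T)) r r) = Ao"
  proof (rule eq_matI)
    fix i j assume "i < dim_row Ao" "j < dim_col Ao"
    hence ij: "i < r" "j < r" using Ao by auto
    have ST': "S * T \<in> carrier_mat n n" using S T by simp
    have n: "i < n" "j < n" using ij r\<nu> by auto
    have "fst (split_block (transpose_mat T * (S * T)) r r) $$ (i, j) = (transpose_mat T * (S * T)) $$ (i, j)"
      using ij by (simp add: split_block_def Let_def)
    also have "\<dots> = col T i \<bullet> (S *\<^sub>v col T j)"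
      using n tT T ST' col_mult2[OF S T n(2)] by simp
    also have "\<dots> = Ao $$ (i, j)"
      unfolding colTr[OF ij(1)] colTr[OF ij(2)] Ao_def D'_def
      using ij D(1) SD col_mult2[OF S D(1) ij(2)] by simp
    finally show "fst (split_block (transpose_mat T * (S * T)) r r) $$ (i, j) = Ao $$ (i, j)" .
  qed (use Ao in \<open>auto simp: split_block_def Let_def\<close>)
  moreover have "fst (split_block (C * P * T) m r) = Co"
  proof (rule eq_matI)
    fix i j assume "i < dim_row Co" "j < dim_col Co"
    hence ij: "i < m" "j < r" using Co by auto
    have n: "j < n" using ij r\<nu> by auto
    have "fst (split_block (C * P * T) m r) $$ (i, j) = (C * P * T) $$ (i, j)"
      using ij by (simp add: split_block_def Let_def)
    also have "\<dots> = row (C * P) i \<bullet> col T j" by (rule index_mult_mat(1)) (use ij n C T in auto)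
    also have "\<dots> = Co $$ (i, j)"
      unfolding colTr[OF ij(2)] Co_def by (rule index_mult_mat(1)[symmetric]) (use ij C D(1) in auto)
    finally show "fst (split_block (C * P * T) m r) $$ (i, j) = Co $$ (i, j)" .
  qed (use Co in \<open>auto simp: split_block_def Let_def\<close>)
  ultimately have hur: "Hurwitz (Ao - Lo * Co)" using hur by simp
  define F where "F = Ao - Lo * Co"
  have LoCo: "Lo * Co \<in> carrier_mat r r" using Lo Co by simp
  have F: "F \<in> carrier_mat r r" unfolding F_def by (rule minus_carrier_mat[OF LoCo])
  have closed: "D' *\<^sub>v (S *\<^sub>v v - Q *\<^sub>v (L *\<^sub>v (C *\<^sub>v (P *\<^sub>v v)))) = F *\<^sub>v (D' *\<^sub>v v)"
    if v: "v \<in> carrier_vec n" for v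
  proof -
    define a b where "a = D' *\<^sub>v v" and "b = U' *\<^sub>v v"
    have a: "a \<in> carrier_vec r" and b: "b \<in> carrier_vec \<nu>" using D' U' v by (auto simp: a_def b_def)
    have Da: "D *\<^sub>v a \<in> carrier_vec n" and Ub: "U *\<^sub>v b \<in> carrier_vec n" using D(1) U(1) a b by auto
    have SDa: "S *\<^sub>v (D *\<^sub>v a) \<in> carrier_vec n" and SUb: "S *\<^sub>v (U *\<^sub>v b) \<in> carrier_vec n" using S Da Ub by auto
    have Coa: "Co *\<^sub>v a \<in> carrier_vec m" using Co a by simp
    have LoCoa: "Lo *\<^sub>v (Co *\<^sub>v a) \<in> carrier_vec r" using Lo Coa by simp
    have Aoa: "Ao *\<^sub>v a \<in> carrier_vec r" using Ao a by simp
    have v_eq: "v = D *\<^sub>v a + U *\<^sub>v b" using dec[OF v] by (simp add: a_def b_def)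
    have "S *\<^sub>v v = S *\<^sub>v (D *\<^sub>v a) + S *\<^sub>v (U *\<^sub>v b)"
      using mult_add_distrib_mat_vec[OF S Da Ub] v_eq by simp
    hence "D' *\<^sub>v (S *\<^sub>v v) = D' *\<^sub>v (S *\<^sub>v (D *\<^sub>v a))"
      using mult_add_distrib_mat_vec[OF D' SDa SUb] D'SU[OF b] D' SDa by simp
    also have "\<dots> = Ao *\<^sub>v a"
      unfolding Ao_def assoc_mult_mat_vec[OF D' SD a] assoc_mult_mat_vec[OF S D(1) a] ..
    finally have 1: "D' *\<^sub>v (S *\<^sub>v v) = Ao *\<^sub>v a" .
    have "C *\<^sub>v (P *\<^sub>v v) = (C * P) *\<^sub>v v" using assoc_mult_mat_vec[OF C P(1) v] by simp
    also have "\<dots> = (C * P) *\<^sub>v (D *\<^sub>v a) + (C * P) *\<^sub>v (U *\<^sub>v b)"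
      using mult_add_distrib_mat_vec[OF CP Da Ub] v_eq by metis
    also have "(C * P) *\<^sub>v (U *\<^sub>v b) = 0\<^sub>v m"
      using ker_C[OF Ub U_ker[OF b]] assoc_mult_mat_vec[OF C P(1) Ub] by metis
    also have "(C * P) *\<^sub>v (D *\<^sub>v a) = Co *\<^sub>v a"
      unfolding Co_def assoc_mult_mat_vec[OF CP D(1) a] ..
    finally have 2: "C *\<^sub>v (P *\<^sub>v v) = Co *\<^sub>v a" using Coa by simp
    have Sv: "S *\<^sub>v v \<in> carrier_vec n" using S v by simp
    have DL: "D *\<^sub>v (Lo *\<^sub>v (Co *\<^sub>v a)) \<in> carrier_vec n" using D(1) LoCoa by simp
    have "D' *\<^sub>v (S *\<^sub>v v - Q *\<^sub>v (L *\<^sub>v (C *\<^sub>v (P *\<^sub>v v)))) = Ao *\<^sub>v a - Lo *\<^sub>v (Co *\<^sub>v a)"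
      unfolding 2 QL[OF Coa] mult_minus_distrib_mat_vec[OF D' Sv DL] 1 D'D[OF LoCoa] ..
    also have "\<dots> = F *\<^sub>v a"
      unfolding F_def minus_mult_distrib_mat_vec[OF Ao LoCo a] assoc_mult_mat_vec[OF Lo Co a] ..
    finally show ?thesis by (simp only: a_def)
  qed
  have ET: "transpose_mat E = E"
    unfolding E_def U'_def transpose_mult[OF U(1) U'[unfolded U'_def]] by simp
  have iso: "(D *\<^sub>v w) \<bullet> (D *\<^sub>v w) = w \<bullet> w" if w: "w \<in> carrier_vec r" for w
  proof -
    have Dw: "D *\<^sub>v w \<in> carrier_vec n" using D(1) w by simp
    show ?thesis
      using transpose_vec_mult_scalar[OF D(1) w Dw] D'D[OF w] by (simp add: D'_def)
  qed
  have EQL: "E *\<^sub>v (Q *\<^sub>v (L *\<^sub>v y)) = 0\<^sub>v n" if y: "y \<in> carrier_vec m" for y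
  proof -
    have Ly: "Lo *\<^sub>v y \<in> carrier_vec r" and DL: "D *\<^sub>v (Lo *\<^sub>v y) \<in> carrier_vec n" using Lo y D(1) by auto
    have "U *\<^sub>v 0\<^sub>v \<nu> = 0\<^sub>v n" using U(1) by (intro eq_vecI) auto
    thus ?thesis unfolding QL[OF y] Ev[OF DL] U'D[OF Ly] .
  qed
  have dec': "D *\<^sub>v (D' *\<^sub>v v) + E *\<^sub>v v = v" "D' *\<^sub>v (E *\<^sub>v v) = 0\<^sub>v r" "E *\<^sub>v (E *\<^sub>v v) = E *\<^sub>v v"
    and unobs: "E *\<^sub>v v = v \<Longrightarrow> \<forall>k<n. C *\<^sub>v (A ^\<^sub>m k *\<^sub>v (P *\<^sub>v v)) = 0\<^sub>v m" if v: "v \<in> carrier_vec n" for v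
  proof -
    have b: "U' *\<^sub>v v \<in> carrier_vec \<nu>" and Ub: "U *\<^sub>v (U' *\<^sub>v v) \<in> carrier_vec n" using U(1) U' v by auto
    show "D *\<^sub>v (D' *\<^sub>v v) + E *\<^sub>v v = v" unfolding Ev[OF v] by (rule dec[OF v])
    show "D' *\<^sub>v (E *\<^sub>v v) = 0\<^sub>v r" unfolding Ev[OF v] by (rule D'U[OF b])
    show "E *\<^sub>v (E *\<^sub>v v) = E *\<^sub>v v" unfolding Ev[OF v] Ev[OF Ub] U'U[OF b] ..
    show "\<forall>k<n. C *\<^sub>v (A ^\<^sub>m k *\<^sub>v (P *\<^sub>v v)) = 0\<^sub>v m" if "E *\<^sub>v v = v"
      using ker[OF v] U_ker[OF b] that unfolding Ev[OF v] by simp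
  qed
  have "Hurwitz F" using hur by (simp add: F_def)
  hence "observability_coordinates n m A C P L M r D E F"
    unfolding observability_coordinates_def Let_def Q_def[symmetric] S_def[symmetric] D'_def[symmetric]
    by (intro conjI ballI impI D(1) E F ET iso dec' ES QM closed unobs EQL)
  with Lc Mc show ?thesis by blast
qed

section \<open>Vector estimates\<close>

lemma scalar_prod_sum:
  "u \<in> carrier_vec n \<Longrightarrow> v \<in> carrier_vec n \<Longrightarrow> u \<bullet> v = (\<Sum>k<n. u $ k * v $ k)"
  by (simp add: scalar_prod_def lessThan_atLeast0)

lemma two_scalar_prod_le:
  fixes u v :: "real vec"
  assumes "u \<in> carrier_vec n" "v \<in> carrier_vec n"
  shows "2 * (u \<bullet> v) \<le> u \<bullet> u + v \<bullet> v"
  unfolding scalar_prod_sum[OF assms] scalar_prod_sum[OF assms(1,1)] scalar_prod_sum[OF assms(2,2)]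
    sum_distrib_left sum.distrib[symmetric]
proof (rule sum_mono)
  fix k
  show "2 * (u $ k * v $ k) \<le> u $ k * u $ k + v $ k * v $ k"
    using zero_le_power2[of "u $ k - v $ k"] by (simp add: power2_eq_square algebra_simps)
qed

lemma scalar_prod_add_self_le:
  fixes u v :: "real vec"
  assumes "u \<in> carrier_vec n" "v \<in> carrier_vec n"
  shows "(u + v) \<bullet> (u + v) \<le> 2 * (u \<bullet> u) + 2 * (v \<bullet> v)"
  using two_scalar_prod_le[OF assms] comm_scalar_prod[OF assms] assms
  by (simp add: add_scalar_prod_distrib[of _ n] scalar_prod_add_distrib[of _ n])

lemma scalar_prod_minus_self_le:
  fixes u v :: "real vec"
  assumes "u \<in> carrier_vec n" "v \<in> carrier_vec n"
  shows "(u - v) \<bullet> (u - v) \<le> 2 * (u \<bullet> u) + 2 * (v \<bullet> v)"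
proof -
  have "(u - v) \<bullet> (u - v) + (u + v) \<bullet> (u + v) = 2 * (u \<bullet> u) + 2 * (v \<bullet> v)"
    using assms by (simp add: add_scalar_prod_distrib[of _ n] scalar_prod_add_distrib[of _ n]
        minus_scalar_prod_distrib[of _ n] scalar_prod_minus_distrib[of _ n])
  thus ?thesis using scalar_prod_self_nonneg[of "u + v"] by linarith
qed

text \<open>
  The finite sum of vectors by entries; unlike with \<open>finsum_vec\<close>, its dimension is \<open>n\<close> unconditionally.
\<close>

definition vsum :: "nat \<Rightarrow> nat \<Rightarrow> (nat \<Rightarrow> real vec) \<Rightarrow> real vec" where
  "vsum n N f = vec n (\<lambda>k. \<Sum>j<N. f j $ k)"

lemma vsum_carrier [simp]: "vsum n N f \<in> carrier_vec n"
  by (simp add: vsum_def)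

lemma finsum_vec_eq_vsum:
  assumes "\<And>j. j < N \<Longrightarrow> f j \<in> carrier_vec n"
  shows "finsum_vec TYPE(real) n f {..<N} = vsum n N f"
proof (rule eq_vecI)
  have f: "f \<in> {..<N} \<rightarrow> carrier_vec n" using assms by auto
  fix k assume "k < dim_vec (vsum n N f)"
  thus "finsum_vec TYPE(real) n f {..<N} $ k = vsum n N f $ k"
    using f by (simp add: vsum_def index_finsum_vec)
next
  have f: "f \<in> {..<N} \<rightarrow> carrier_vec n" using assms by auto
  have "finsum_vec TYPE(real) n f {..<N} \<in> carrier_vec n" using f by (rule finsum_vec_closed)
  thus "dim_vec (finsum_vec TYPE(real) n f {..<N}) = dim_vec (vsum n N f)" by (simp add: vsum_def)
qed

lemma scalar_prod_vsum:
  assumes "x \<in> carrier_vec n" "\<And>j. j < N \<Longrightarrow> f j \<in> carrier_vec n"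
  shows "x \<bullet> vsum n N f = (\<Sum>j<N. x \<bullet> f j)"
proof -
  have "x \<bullet> vsum n N f = (\<Sum>k<n. \<Sum>j<N. x $ k * f j $ k)"
    using assms(1) by (simp add: scalar_prod_sum[of _ n] vsum_def sum_distrib_left)
  also have "\<dots> = (\<Sum>j<N. \<Sum>k<n. x $ k * f j $ k)" by (rule sum.swap)
  finally show ?thesis using assms by (simp add: scalar_prod_sum[of _ n])
qed

lemma mult_mat_vsum:
  assumes X: "X \<in> carrier_mat m n" and f: "\<And>j. j < N \<Longrightarrow> f j \<in> carrier_vec n"
  shows "X *\<^sub>v vsum n N f = vsum m N (\<lambda>j. X *\<^sub>v f j)"
proof (rule eq_vecI)
  fix i assume "i < dim_vec (vsum m N (\<lambda>j. X *\<^sub>v f j))"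
  hence i: "i < m" by (simp add: vsum_def)
  have "row X i \<in> carrier_vec n" by (rule row_carrier_vec[OF i X])
  from scalar_prod_vsum[OF this f] show "(X *\<^sub>v vsum n N f) $ i = vsum m N (\<lambda>j. X *\<^sub>v f j) $ i"
    using i X by (simp add: vsum_def)
qed (use X in \<open>simp add: vsum_def\<close>)

lemma vsum_self_le:
  assumes "\<And>j. j < N \<Longrightarrow> f j \<in> carrier_vec n"
  shows "vsum n N f \<bullet> vsum n N f \<le> real N * (\<Sum>j<N. f j \<bullet> f j)"
proof -
  have "vsum n N f \<bullet> vsum n N f = (\<Sum>k<n. (norm (\<Sum>j<N. 1 * f j $ k))\<^sup>2)"
    by (simp add: scalar_prod_self[of _ n] vsum_def)
  also have "\<dots> \<le> (\<Sum>k<n. (\<Sum>j<N. (norm (1::real))\<^sup>2) * (\<Sum>j<N. (norm (f j $ k))\<^sup>2))"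
    by (intro sum_mono norm_sum_mult_sq_le)
  also have "\<dots> = real N * (\<Sum>k<n. \<Sum>j<N. (f j $ k)\<^sup>2)" by (simp add: sum_distrib_left)
  also have "(\<Sum>k<n. \<Sum>j<N. (f j $ k)\<^sup>2) = (\<Sum>j<N. \<Sum>k<n. (f j $ k)\<^sup>2)" by (rule sum.swap)
  also have "\<dots> = (\<Sum>j<N. f j \<bullet> f j)" using assms by (simp add: scalar_prod_self[of _ n])
  finally show ?thesis .
qed

lemma orthogonal_projection_contracts:
  fixes X :: "real mat"
  assumes X: "X \<in> carrier_mat n n" "transpose_mat X = X" and idem: "X *\<^sub>v (X *\<^sub>v v) = X *\<^sub>v v"
    and v: "v \<in> carrier_vec n"
  shows "(X *\<^sub>v v) \<bullet> (X *\<^sub>v v) \<le> v \<bullet> v" "(v - X *\<^sub>v v) \<bullet> (v - X *\<^sub>v v) \<le> v \<bullet> v"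
proof -
  have Xv: "X *\<^sub>v v \<in> carrier_vec n" using X v by simp
  have "(X *\<^sub>v v) \<bullet> (X *\<^sub>v v) = v \<bullet> (X *\<^sub>v v)"
    using transpose_vec_mult_scalar[OF X(1) Xv v] X(2) idem by simp
  moreover have "(X *\<^sub>v v) \<bullet> v = v \<bullet> (X *\<^sub>v v)" by (rule comm_scalar_prod[OF Xv v])
  ultimately have "v \<bullet> v = (X *\<^sub>v v) \<bullet> (X *\<^sub>v v) + (v - X *\<^sub>v v) \<bullet> (v - X *\<^sub>v v)"
    using v Xv by (simp add: minus_scalar_prod_distrib[of _ n] scalar_prod_minus_distrib[of _ n])
  thus "(X *\<^sub>v v) \<bullet> (X *\<^sub>v v) \<le> v \<bullet> v" "(v - X *\<^sub>v v) \<bullet> (v - X *\<^sub>v v) \<le> v \<bullet> v"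
    using scalar_prod_self_nonneg[of "X *\<^sub>v v"] scalar_prod_self_nonneg[of "v - X *\<^sub>v v"] by linarith+
qed

text \<open>
  Symmetry of the weights lets the terms for \<open>(i, j)\<close> and \<open>(j, i)\<close> be added; together they are
  \<open>- (\<eta>\<^sub>i - \<eta>\<^sub>j) \<bullet> (\<epsilon>\<^sub>i - \<epsilon>\<^sub>j)\<close>. Half of the resulting square pays for the perturbation \<open>\<omega>\<close>.
\<close>

lemma coupling_dissipation:
  fixes a :: "nat \<Rightarrow> nat \<Rightarrow> real"
  assumes \<eta>: "\<And>i. i < N \<Longrightarrow> \<eta> i \<in> carrier_vec n" and \<omega>: "\<And>i. i < N \<Longrightarrow> \<omega> i \<in> carrier_vec n"
    and \<epsilon>: "\<And>i. i < N \<Longrightarrow> \<epsilon> i = \<omega> i + \<eta> i"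
    and sym: "\<And>i j. i < N \<Longrightarrow> j < N \<Longrightarrow> a i j = a j i"
    and a: "\<And>i j. i < N \<Longrightarrow> j < N \<Longrightarrow> 0 \<le> a i j" "\<And>i j. i < N \<Longrightarrow> j < N \<Longrightarrow> a i j \<le> B"
  shows "2 * (\<Sum>i<N. \<Sum>j<N. a i j * (\<eta> i \<bullet> (\<epsilon> j - \<epsilon> i)))
    \<le> - (1/2) * (\<Sum>i<N. \<Sum>j<N. a i j * ((\<eta> i - \<eta> j) \<bullet> (\<eta> i - \<eta> j))) + 2 * B * real N * (\<Sum>i<N. \<omega> i \<bullet> \<omega> i)"
proof -
  have pw: "\<eta> i \<bullet> (\<epsilon> j - \<epsilon> i) + \<eta> j \<bullet> (\<epsilon> i - \<epsilon> j)
      \<le> - (1/2) * ((\<eta> i - \<eta> j) \<bullet> (\<eta> i - \<eta> j)) + (\<omega> i \<bullet> \<omega> i + \<omega> j \<bullet> \<omega> j)" if ij: "i < N" "j < N" for i j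
  proof -
    have r: "x * ((q + y) - (p + x)) + y * ((p + x) - (q + y)) \<le> - (1/2) * ((x - y) * (x - y)) + (p * p + q * q)"
      for x y p q :: real
    proof -
      have "0 \<le> ((x - y) + (p - q))\<^sup>2 + (p + q)\<^sup>2" by simp
      thus ?thesis by (simp add: power2_eq_square algebra_simps)
    qed
    have "\<eta> i \<bullet> (\<epsilon> j - \<epsilon> i) + \<eta> j \<bullet> (\<epsilon> i - \<epsilon> j) = (\<Sum>k<n. \<eta> i $ k * ((\<omega> j $ k + \<eta> j $ k) - (\<omega> i $ k + \<eta> i $ k))
        + \<eta> j $ k * ((\<omega> i $ k + \<eta> i $ k) - (\<omega> j $ k + \<eta> j $ k)))"
      using \<eta>[OF ij(1)] \<eta>[OF ij(2)] \<omega>[OF ij(1)] \<omega>[OF ij(2)] \<epsilon>[OF ij(1)] \<epsilon>[OF ij(2)]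
      by (simp add: scalar_prod_sum[of _ n] sum.distrib)
    also have "\<dots> \<le> (\<Sum>k<n. - (1/2) * ((\<eta> i $ k - \<eta> j $ k) * (\<eta> i $ k - \<eta> j $ k))
        + (\<omega> i $ k * \<omega> i $ k + \<omega> j $ k * \<omega> j $ k))" by (intro sum_mono r)
    also have "\<dots> = - (1/2) * ((\<eta> i - \<eta> j) \<bullet> (\<eta> i - \<eta> j)) + (\<omega> i \<bullet> \<omega> i + \<omega> j \<bullet> \<omega> j)"
      using \<eta>[OF ij(1)] \<eta>[OF ij(2)] \<omega>[OF ij(1)] \<omega>[OF ij(2)]
      by (simp add: scalar_prod_sum[of _ n] sum.distrib sum_distrib_left sum_negf sum_subtractf)
    finally show ?thesis .
  qed
  define X where "X = (\<Sum>i<N. \<Sum>j<N. a i j * (\<eta> i \<bullet> (\<epsilon> j - \<epsilon> i)))"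
  have "X = (\<Sum>i<N. \<Sum>j<N. a j i * (\<eta> j \<bullet> (\<epsilon> i - \<epsilon> j)))" unfolding X_def by (rule sum.swap)
  also have "\<dots> = (\<Sum>i<N. \<Sum>j<N. a i j * (\<eta> j \<bullet> (\<epsilon> i - \<epsilon> j)))" using sym by (intro sum.cong) auto
  finally have "2 * X = (\<Sum>i<N. \<Sum>j<N. a i j * (\<eta> i \<bullet> (\<epsilon> j - \<epsilon> i) + \<eta> j \<bullet> (\<epsilon> i - \<epsilon> j)))"
    unfolding distrib_left sum.distrib by (simp add: X_def)
  also have "\<dots> \<le> (\<Sum>i<N. \<Sum>j<N. a i j * (- (1/2) * ((\<eta> i - \<eta> j) \<bullet> (\<eta> i - \<eta> j)) + (\<omega> i \<bullet> \<omega> i + \<omega> j \<bullet> \<omega> j)))"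
    using pw a(1) by (intro sum_mono mult_left_mono) auto
  also have "\<dots> = - (1/2) * (\<Sum>i<N. \<Sum>j<N. a i j * ((\<eta> i - \<eta> j) \<bullet> (\<eta> i - \<eta> j)))
      + (\<Sum>i<N. \<Sum>j<N. a i j * (\<omega> i \<bullet> \<omega> i + \<omega> j \<bullet> \<omega> j))"
    unfolding distrib_left sum.distrib sum_distrib_left by (simp add: mult_ac)
  also have "(\<Sum>i<N. \<Sum>j<N. a i j * (\<omega> i \<bullet> \<omega> i + \<omega> j \<bullet> \<omega> j)) \<le> (\<Sum>i<N. \<Sum>j<N. B * (\<omega> i \<bullet> \<omega> i + \<omega> j \<bullet> \<omega> j))"
    using a(2) by (intro sum_mono mult_right_mono) auto
  also have "\<dots> = 2 * B * real N * (\<Sum>i<N. \<omega> i \<bullet> \<omega> i)"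
    by (simp add: sum.distrib sum_distrib_left[symmetric] algebra_simps)
  finally show ?thesis by (simp add: X_def)
qed

text \<open>
  The coupling force is controlled by the dissipation itself, because \<open>a\<^sub>j\<^sup>2 \<le> B a\<^sub>j\<close>.
\<close>

lemma coupling_force_bound:
  fixes a :: "nat \<Rightarrow> real"
  assumes \<eta>: "\<And>i. i < N \<Longrightarrow> \<eta> i \<in> carrier_vec n" and \<omega>: "\<And>i. i < N \<Longrightarrow> \<omega> i \<in> carrier_vec n"
    and \<epsilon>: "\<And>i. i < N \<Longrightarrow> \<epsilon> i = \<omega> i + \<eta> i"
    and a: "\<And>j. j < N \<Longrightarrow> 0 \<le> a j" "\<And>j. j < N \<Longrightarrow> a j \<le> B" and i: "i < N"
  defines "g \<equiv> vsum n N (\<lambda>j. a j \<cdot>\<^sub>v (\<epsilon> j - \<epsilon> i))"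
  shows "g \<bullet> g \<le> 2 * B * real N * (\<Sum>j<N. a j * ((\<eta> i - \<eta> j) \<bullet> (\<eta> i - \<eta> j)))
    + 8 * B\<^sup>2 * (real N)\<^sup>2 * (\<Sum>j<N. \<omega> j \<bullet> \<omega> j)"
proof -
  define \<Omega> where "\<Omega> = (\<Sum>j<N. \<omega> j \<bullet> \<omega> j)"
  have B: "0 \<le> B" using a[OF i] by linarith
  have \<omega>\<Omega>: "\<omega> j \<bullet> \<omega> j \<le> \<Omega>" if "j < N" for j
    unfolding \<Omega>_def using that by (intro member_le_sum) auto
  have d: "(\<epsilon> j - \<epsilon> i) \<bullet> (\<epsilon> j - \<epsilon> i) \<le> 2 * ((\<eta> i - \<eta> j) \<bullet> (\<eta> i - \<eta> j)) + 8 * \<Omega>" if j: "j < N" for j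
  proof -
    have e: "\<epsilon> j - \<epsilon> i = (\<omega> j - \<omega> i) - (\<eta> i - \<eta> j)"
      unfolding \<epsilon>[OF i] \<epsilon>[OF j] using \<eta>[OF i] \<eta>[OF j] \<omega>[OF i] \<omega>[OF j] by (intro eq_vecI) auto
    have "(\<epsilon> j - \<epsilon> i) \<bullet> (\<epsilon> j - \<epsilon> i) \<le> 2 * ((\<omega> j - \<omega> i) \<bullet> (\<omega> j - \<omega> i)) + 2 * ((\<eta> i - \<eta> j) \<bullet> (\<eta> i - \<eta> j))"
      unfolding e using \<eta>[OF i] \<eta>[OF j] \<omega>[OF i] \<omega>[OF j] by (intro scalar_prod_minus_self_le[of _ n]) auto
    moreover have "(\<omega> j - \<omega> i) \<bullet> (\<omega> j - \<omega> i) \<le> 2 * (\<omega> j \<bullet> \<omega> j) + 2 * (\<omega> i \<bullet> \<omega> i)"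
      by (rule scalar_prod_minus_self_le[OF \<omega>[OF j] \<omega>[OF i]])
    ultimately show ?thesis using \<omega>\<Omega>[OF i] \<omega>\<Omega>[OF j] by linarith
  qed
  have 1: "g \<bullet> g \<le> real N * (\<Sum>j<N. (a j \<cdot>\<^sub>v (\<epsilon> j - \<epsilon> i)) \<bullet> (a j \<cdot>\<^sub>v (\<epsilon> j - \<epsilon> i)))"
    unfolding g_def using \<epsilon> \<eta> \<omega> i by (intro vsum_self_le) auto
  have "(\<Sum>j<N. (a j \<cdot>\<^sub>v (\<epsilon> j - \<epsilon> i)) \<bullet> (a j \<cdot>\<^sub>v (\<epsilon> j - \<epsilon> i)))
      \<le> (\<Sum>j<N. B * (2 * (a j * ((\<eta> i - \<eta> j) \<bullet> (\<eta> i - \<eta> j))) + 8 * B * \<Omega>))"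
  proof (rule sum_mono)
    fix j assume "j \<in> {..<N}"
    hence j: "j < N" by simp
    have "(a j \<cdot>\<^sub>v (\<epsilon> j - \<epsilon> i)) \<bullet> (a j \<cdot>\<^sub>v (\<epsilon> j - \<epsilon> i)) = a j * (a j * ((\<epsilon> j - \<epsilon> i) \<bullet> (\<epsilon> j - \<epsilon> i)))"
      by simp
    also have "\<dots> \<le> a j * (a j * (2 * ((\<eta> i - \<eta> j) \<bullet> (\<eta> i - \<eta> j)) + 8 * \<Omega>))"
      using d[OF j] a(1)[OF j] by (intro mult_left_mono) auto
    also have "\<dots> \<le> B * (a j * (2 * ((\<eta> i - \<eta> j) \<bullet> (\<eta> i - \<eta> j)) + 8 * \<Omega>))"
      using a[OF j] by (intro mult_right_mono) (auto simp: \<Omega>_def sum_nonneg)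
    also have "\<dots> \<le> B * (2 * (a j * ((\<eta> i - \<eta> j) \<bullet> (\<eta> i - \<eta> j))) + 8 * B * \<Omega>)"
    proof (rule mult_left_mono[OF _ B])
      have "a j * \<Omega> \<le> B * \<Omega>" using a[OF j] by (intro mult_right_mono) (auto simp: \<Omega>_def sum_nonneg)
      thus "a j * (2 * ((\<eta> i - \<eta> j) \<bullet> (\<eta> i - \<eta> j)) + 8 * \<Omega>) \<le> 2 * (a j * ((\<eta> i - \<eta> j) \<bullet> (\<eta> i - \<eta> j))) + 8 * B * \<Omega>"
        by (simp add: algebra_simps)
    qed
    finally show "(a j \<cdot>\<^sub>v (\<epsilon> j - \<epsilon> i)) \<bullet> (a j \<cdot>\<^sub>v (\<epsilon> j - \<epsilon> i)) \<le> B * (2 * (a j * ((\<eta> i - \<eta> j) \<bullet> (\<eta> i - \<eta> j))) + 8 * B * \<Omega>)" .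
  qed
  also have "\<dots> = 2 * B * (\<Sum>j<N. a j * ((\<eta> i - \<eta> j) \<bullet> (\<eta> i - \<eta> j))) + 8 * B\<^sup>2 * real N * \<Omega>"
    by (simp add: sum.distrib sum_distrib_left power2_eq_square algebra_simps)
  finally have "real N * (\<Sum>j<N. (a j \<cdot>\<^sub>v (\<epsilon> j - \<epsilon> i)) \<bullet> (a j \<cdot>\<^sub>v (\<epsilon> j - \<epsilon> i)))
      \<le> real N * (2 * B * (\<Sum>j<N. a j * ((\<eta> i - \<eta> j) \<bullet> (\<eta> i - \<eta> j))) + 8 * B\<^sup>2 * real N * \<Omega>)"
    by (rule mult_left_mono) simp
  with 1 show ?thesis by (simp add: \<Omega>_def power2_eq_square algebra_simps)
qed

section \<open>Curves of vectors\<close>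

definition has_vec_deriv :: "nat \<Rightarrow> (real \<Rightarrow> real vec) \<Rightarrow> real vec \<Rightarrow> real \<Rightarrow> bool" where
  "has_vec_deriv n x x' s \<longleftrightarrow> (\<forall>k<n. ((\<lambda>u. x u $ k) has_real_derivative x' $ k) (at s))"

definition vec_continuous_on :: "nat \<Rightarrow> real set \<Rightarrow> (real \<Rightarrow> real vec) \<Rightarrow> bool" where
  "vec_continuous_on n I x \<longleftrightarrow> (\<forall>k<n. continuous_on I (\<lambda>u. x u $ k))"

lemma has_vec_deriv_mult_mat:
  assumes X: "X \<in> carrier_mat m n" and x: "\<And>u. x u \<in> carrier_vec n" and x': "x' \<in> carrier_vec n"
    and d: "has_vec_deriv n x x' s"
  shows "has_vec_deriv m (\<lambda>u. X *\<^sub>v x u) (X *\<^sub>v x') s"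
  unfolding has_vec_deriv_def
proof (intro allI impI)
  fix k assume k: "k < m"
  have e: "(X *\<^sub>v v) $ k = (\<Sum>l<n. X $$ (k, l) * v $ l)" if "v \<in> carrier_vec n" for v
    using that X k by (simp add: scalar_prod_def lessThan_atLeast0)
  have "((\<lambda>u. \<Sum>l<n. X $$ (k, l) * x u $ l) has_real_derivative (\<Sum>l<n. X $$ (k, l) * x' $ l)) (at s)"
    using d unfolding has_vec_deriv_def by (intro DERIV_sum DERIV_cmult) auto
  thus "((\<lambda>u. (X *\<^sub>v x u) $ k) has_real_derivative (X *\<^sub>v x') $ k) (at s)" using e x x' by simp
qed

lemma has_vec_deriv_minus:
  assumes "\<And>u. x u \<in> carrier_vec n" "\<And>u. y u \<in> carrier_vec n" "x' \<in> carrier_vec n" "y' \<in> carrier_vec n"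
    and "has_vec_deriv n x x' s" "has_vec_deriv n y y' s"
  shows "has_vec_deriv n (\<lambda>u. x u - y u) (x' - y') s"
  unfolding has_vec_deriv_def
proof (intro allI impI)
  fix k assume k: "k < n"
  have "(x u - y u) $ k = x u $ k - y u $ k" for u using k carrier_vecD[OF assms(2)[of u]] by simp
  moreover have "(x' - y') $ k = x' $ k - y' $ k" using k assms(4) by simp
  ultimately show "((\<lambda>u. (x u - y u) $ k) has_real_derivative (x' - y') $ k) (at s)"
    using assms(5,6) k unfolding has_vec_deriv_def by (simp add: DERIV_diff)
qed

lemma has_vec_deriv_scalar_prod:
  assumes "\<And>u. x u \<in> carrier_vec n" "\<And>u. y u \<in> carrier_vec n" "x' \<in> carrier_vec n" "y' \<in> carrier_vec n"
    and d: "has_vec_deriv n x x' s" "has_vec_deriv n y y' s"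
  shows "((\<lambda>u. x u \<bullet> y u) has_real_derivative x' \<bullet> y s + x s \<bullet> y') (at s)"
proof -
  have "((\<lambda>u. \<Sum>k<n. x u $ k * y u $ k) has_real_derivative (\<Sum>k<n. x' $ k * y s $ k + y' $ k * x s $ k)) (at s)"
    using d unfolding has_vec_deriv_def by (intro DERIV_sum DERIV_mult) auto
  thus ?thesis using assms(1-4) by (simp add: scalar_prod_sum[of _ n] sum.distrib mult.commute)
qed

lemma vec_continuous_on_mult_mat:
  assumes X: "X \<in> carrier_mat m n" and x: "\<And>u. x u \<in> carrier_vec n" and c: "vec_continuous_on n I x"
  shows "vec_continuous_on m I (\<lambda>u. X *\<^sub>v x u)"
  unfolding vec_continuous_on_def
proof (intro allI impI)
  fix k assume k: "k < m"
  have e: "(X *\<^sub>v v) $ k = (\<Sum>l<n. X $$ (k, l) * v $ l)" if "v \<in> carrier_vec n" for v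
    using that X k by (simp add: scalar_prod_def lessThan_atLeast0)
  have "continuous_on I (\<lambda>u. \<Sum>l<n. X $$ (k, l) * x u $ l)"
    using c unfolding vec_continuous_on_def by (intro continuous_intros) auto
  thus "continuous_on I (\<lambda>u. (X *\<^sub>v x u) $ k)" using e x by simp
qed

lemma vec_continuous_on_minus:
  assumes "\<And>u. x u \<in> carrier_vec n" "\<And>u. y u \<in> carrier_vec n"
    and "vec_continuous_on n I x" "vec_continuous_on n I y"
  shows "vec_continuous_on n I (\<lambda>u. x u - y u)"
  unfolding vec_continuous_on_def
proof (intro allI impI)
  fix k assume k: "k < n"
  have "(x u - y u) $ k = x u $ k - y u $ k" for u using k carrier_vecD[OF assms(2)[of u]] by simp
  thus "continuous_on I (\<lambda>u. (x u - y u) $ k)"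
    using assms(3,4) k unfolding vec_continuous_on_def by (simp add: continuous_on_diff)
qed

lemma continuous_on_scalar_prod:
  assumes "\<And>u. x u \<in> carrier_vec n" "\<And>u. y u \<in> carrier_vec n"
    and c: "vec_continuous_on n I x" "vec_continuous_on n I y"
  shows "continuous_on I (\<lambda>u. x u \<bullet> y u)"
proof -
  have "continuous_on I (\<lambda>u. \<Sum>k<n. x u $ k * y u $ k)"
    using c unfolding vec_continuous_on_def by (intro continuous_intros) auto
  thus ?thesis using assms(1,2) by (simp add: scalar_prod_sum[of _ n])
qed

section \<open>Switching and connectivity\<close>

lemma switching_instants_ge:
  assumes "switching_signal n0 \<sigma> t \<tau>"
  shows "\<tau> * real j \<le> t j"
proof (induction j)
  case 0
  show ?case using assms by (simp add: switching_signal_def)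
next
  case (Suc j)
  have "\<tau> \<le> t (Suc j) - t j" using assms by (simp add: switching_signal_def)
  thus ?case using Suc by (simp add: algebra_simps)
qed

lemma switching_instants_mono:
  assumes "switching_signal n0 \<sigma> t \<tau>" "i \<le> j"
  shows "t i \<le> t j"
proof -
  have "t k \<le> t (Suc k)" for k
  proof -
    have "0 < \<tau>" "\<tau> \<le> t (Suc k) - t k" using assms(1) by (auto simp: switching_signal_def)
    thus ?thesis by linarith
  qed
  thus ?thesis using assms(2) by (rule lift_Suc_mono_le)
qed

lemma finite_switching_instants:
  assumes "switching_signal n0 \<sigma> t \<tau>"
  shows "finite (range t \<inter> {a..b})"
proof -
  have \<tau>: "0 < \<tau>" using assms by (simp add: switching_signal_def)
  have "range t \<inter> {a..b} \<subseteq> t ` {.. nat \<lceil>b / \<tau>\<rceil>}"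
  proof
    fix s assume "s \<in> range t \<inter> {a..b}"
    then obtain j where j: "s = t j" "t j \<le> b" by auto
    have "\<tau> * real j \<le> b" using switching_instants_ge[OF assms, of j] j by simp
    hence "real j \<le> b / \<tau>" using \<tau> by (simp add: field_simps)
    hence "j \<le> nat \<lceil>b / \<tau>\<rceil>" by linarith
    thus "s \<in> t ` {.. nat \<lceil>b / \<tau>\<rceil>}" using j by auto
  qed
  thus ?thesis by (rule finite_subset) simp
qed

lemma weighted_adjacency_nonneg:
  assumes "weighted_adjacency N G W" "i < N" "j < N"
  shows "0 \<le> W $$ (i, j)"
proof (cases "i = j")
  case False
  hence "if (j, i) \<in> parcs G then W $$ (i, j) > 0 else W $$ (i, j) = 0"
    using assms unfolding weighted_adjacency_def by blast
  thus ?thesis by (simp split: if_splits)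
qed (use assms in \<open>simp add: weighted_adjacency_def\<close>)

lemma weighted_adjacency_sym:
  assumes "weighted_adjacency N G W" "i < N" "j < N"
  shows "W $$ (i, j) = W $$ (j, i)"
proof -
  have W: "W \<in> carrier_mat N N" "transpose_mat W = W" using assms(1) by (auto simp: weighted_adjacency_def)
  have "transpose_mat W $$ (j, i) = W $$ (i, j)" using W(1) assms(2,3) by (intro index_transpose_mat(1)) auto
  thus ?thesis by (simp add: W(2))
qed

text \<open>
  Connectivity is restated through positive weights, which are what the energy estimate sees; loops
  are dropped, as their weights vanish.
\<close>

lemma union_graph_connected_imp_weighted_paths:
  assumes conn: "connected (with_proj (union_graph N G \<sigma> t a b))"
    and G: "\<And>j. undirected_graph N (G (\<sigma> (t j)))" "\<And>j. weighted_adjacency N (G (\<sigma> (t j))) (W (\<sigma> (t j)))"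
    and ij: "i < N" "j < N"
  shows "(i, j) \<in> {(u, v). u < N \<and> v < N \<and> (\<exists>l. t l \<in> {a..<b} \<and> 0 < W (\<sigma> (t l)) $$ (u, v))}\<^sup>*"
    (is "_ \<in> ?E\<^sup>*")
proof -
  let ?U = "union_graph N G \<sigma> t a b"
  have V: "verts (with_proj ?U) = {..<N}" by (simp add: union_graph_def)
  have A: "arcs_ends (with_proj ?U) = (\<Union>l\<in>{l. t l \<in> {a..<b}}. parcs (G (\<sigma> (t l))))"
    by (simp add: arcs_ends_conv union_graph_def)
  have p: "(i, j) \<in> rtrancl_on {..<N} ((arcs_ends (with_proj ?U))\<^sup>s)"
    using conn ij unfolding connected_conv V by simp
  have sub: "(arcs_ends (with_proj ?U))\<^sup>s \<subseteq> ?E\<^sup>="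
  proof
    fix x assume "x \<in> (arcs_ends (with_proj ?U))\<^sup>s"
    moreover obtain u v where x: "x = (u, v)" by (cases x)
    ultimately obtain l where l: "t l \<in> {a..<b}"
      and uv: "(u, v) \<in> parcs (G (\<sigma> (t l))) \<or> (v, u) \<in> parcs (G (\<sigma> (t l)))"
      unfolding A symcl_def by auto
    interpret pair_pseudo_graph "G (\<sigma> (t l))" using G(1)[of l] by (simp add: undirected_graph_def)
    have N: "pverts (G (\<sigma> (t l))) = {..<N}" using G(1)[of l] by (simp add: undirected_graph_def)
    have lt: "u < N" "v < N" using uv in_arcsD1 in_arcsD2 unfolding N by blast+
    show "x \<in> ?E\<^sup>="
    proof (cases "u = v")
      case False
      have "0 < W (\<sigma> (t l)) $$ (u, v)"
      proof (rule disjE[OF uv])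
        assume "(v, u) \<in> parcs (G (\<sigma> (t l)))"
        thus ?thesis using G(2)[of l] lt False unfolding weighted_adjacency_def by metis
      next
        assume "(u, v) \<in> parcs (G (\<sigma> (t l)))"
        hence "0 < W (\<sigma> (t l)) $$ (v, u)"
          using G(2)[of l] lt False unfolding weighted_adjacency_def by metis
        thus ?thesis using weighted_adjacency_sym[OF G(2) lt] by simp
      qed
      thus ?thesis using lt l x by auto
    qed (use x in auto)
  qed
  have "(i, j) \<in> rtrancl_on {..<N} (?E\<^sup>=)"
    by (rule rtrancl_on_mono[OF sub order_refl p])
  hence "(i, j) \<in> (?E\<^sup>=)\<^sup>*"
    by induct (auto intro: converse_rtrancl_into_rtrancl)
  thus ?thesis by simp
qed

section \<open>The energy estimate\<close>

text \<open>
  The error system in the coordinates of \<open>observability_coordinates\<close>: \<open>\<eta> i\<close> is the unobservable part of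
  the error of agent \<open>i\<close>, \<open>w i\<close> are the coordinates of its observable part \<open>\<omega> i\<close>. The curves are defined
  on all of \<open>\<real>\<close>, so that two-sided derivatives make sense at all positive times.
\<close>

locale observer_error =
  fixes n N n0 :: nat and r :: "nat \<Rightarrow> nat" and S :: "real mat" and E F :: "nat \<Rightarrow> real mat"
    and \<gamma> :: "nat \<Rightarrow> real" and G :: "nat \<Rightarrow> nat pair_pre_digraph" and W :: "nat \<Rightarrow> real mat"
    and \<sigma> :: "real \<Rightarrow> nat" and t :: "nat \<Rightarrow> real" and \<tau> :: real
    and \<eta> \<omega> w :: "nat \<Rightarrow> real \<Rightarrow> real vec"
  assumes S: "S \<in> carrier_mat n n" and skew: "\<And>x. x \<in> carrier_vec n \<Longrightarrow> x \<bullet> (S *\<^sub>v x) = 0"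
    and E: "\<And>i. i < N \<Longrightarrow> E i \<in> carrier_mat n n" "\<And>i. i < N \<Longrightarrow> transpose_mat (E i) = E i"
    and idem: "\<And>i x. i < N \<Longrightarrow> x \<in> carrier_vec n \<Longrightarrow> E i *\<^sub>v (E i *\<^sub>v x) = E i *\<^sub>v x"
    and jointly_obs: "\<And>x. x \<in> carrier_vec n \<Longrightarrow> (\<And>i. i < N \<Longrightarrow> E i *\<^sub>v x = x) \<Longrightarrow> x = 0\<^sub>v n"
    and F: "\<And>i. i < N \<Longrightarrow> F i \<in> carrier_mat (r i) (r i)" "\<And>i. i < N \<Longrightarrow> Hurwitz (F i)"
    and \<gamma>: "\<And>i. i < N \<Longrightarrow> 0 < \<gamma> i"
    and switching: "switching_signal n0 \<sigma> t \<tau>"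
    and graphs: "\<And>p. p \<in> {1..n0} \<Longrightarrow> undirected_graph N (G p)"
    and weights: "\<And>p. p \<in> {1..n0} \<Longrightarrow> weighted_adjacency N (G p) (W p)"
    and conn: "jointly_connected N G \<sigma> t \<tau>"
    and \<eta>: "\<And>i s. i < N \<Longrightarrow> \<eta> i s \<in> carrier_vec n" "\<And>i s. i < N \<Longrightarrow> E i *\<^sub>v \<eta> i s = \<eta> i s"
    and \<omega>: "\<And>i s. i < N \<Longrightarrow> \<omega> i s \<in> carrier_vec n" "\<And>i s. i < N \<Longrightarrow> \<omega> i s \<bullet> \<omega> i s = w i s \<bullet> w i s"
    and w: "\<And>i s. i < N \<Longrightarrow> w i s \<in> carrier_vec (r i)"
    and cont: "\<And>i. i < N \<Longrightarrow> vec_continuous_on n {0..} (\<eta> i)"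
      "\<And>i. i < N \<Longrightarrow> vec_continuous_on (r i) {0..} (w i)"
    and w': "\<And>i s. i < N \<Longrightarrow> 0 < s \<Longrightarrow> s \<notin> range t \<Longrightarrow> has_vec_deriv (r i) (w i) (F i *\<^sub>v w i s) s"
    and \<eta>': "\<And>i s. i < N \<Longrightarrow> 0 < s \<Longrightarrow> s \<notin> range t \<Longrightarrow>
      has_vec_deriv n (\<eta> i) (S *\<^sub>v \<eta> i s + \<gamma> i \<cdot>\<^sub>v (E i *\<^sub>v
        vsum n N (\<lambda>j. W (\<sigma> s) $$ (i, j) \<cdot>\<^sub>v ((\<omega> j s + \<eta> j s) - (\<omega> i s + \<eta> i s))))) s"
begin

lemma \<tau>_pos: "0 < \<tau>" using switching by (simp add: switching_signal_def)

lemma \<sigma>_mode: "0 \<le> s \<Longrightarrow> \<sigma> s \<in> {1..n0}" using switching unfolding switching_signal_def by blast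

lemma t_nonneg: "0 \<le> t j"
  using switching_instants_ge[OF switching, of j] \<tau>_pos
  by (meson mult_nonneg_nonneg of_nat_0_le_iff order_less_imp_le order_trans)

lemma W_nonneg: "0 \<le> s \<Longrightarrow> i < N \<Longrightarrow> j < N \<Longrightarrow> 0 \<le> W (\<sigma> s) $$ (i, j)"
  using weighted_adjacency_nonneg[OF weights[OF \<sigma>_mode]] .

lemma W_sym: "0 \<le> s \<Longrightarrow> i < N \<Longrightarrow> j < N \<Longrightarrow> W (\<sigma> s) $$ (i, j) = W (\<sigma> s) $$ (j, i)"
  using weighted_adjacency_sym[OF weights[OF \<sigma>_mode]] .

lemma weight_bounds:
  obtains B \<beta> where "0 \<le> B" "0 < \<beta>" "\<And>p i j. p \<in> {1..n0} \<Longrightarrow> i < N \<Longrightarrow> j < N \<Longrightarrow> W p $$ (i, j) \<le> B"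
    "\<And>p i j. p \<in> {1..n0} \<Longrightarrow> i < N \<Longrightarrow> j < N \<Longrightarrow> 0 < W p $$ (i, j) \<Longrightarrow> \<beta> \<le> W p $$ (i, j)"
proof -
  define X where "X = (\<lambda>(p, i, j). W p $$ (i, j)) ` ({1..n0} \<times> {..<N} \<times> {..<N})"
  have X: "finite X" by (simp add: X_def)
  have mem: "W p $$ (i, j) \<in> X" if "p \<in> {1..n0}" "i < N" "j < N" for p i j
    unfolding X_def by (rule image_eqI[of _ _ "(p, i, j)"]) (use that in auto)
  define Xp where "Xp = insert 1 (X \<inter> {0<..})"
  have Xp: "finite Xp" "Xp \<noteq> {}" using X by (auto simp: Xp_def)
  show ?thesis
  proof (rule that[of "Max (insert 0 X)" "Min Xp"])
    show "0 \<le> Max (insert 0 X)" using X by (intro Max_ge) auto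
    show "0 < Min Xp" using Min_in[OF Xp] by (auto simp: Xp_def)
    show "W p $$ (i, j) \<le> Max (insert 0 X)" if "p \<in> {1..n0}" "i < N" "j < N" for p i j
      using mem[OF that] X by (intro Max_ge) auto
    show "Min Xp \<le> W p $$ (i, j)" if "p \<in> {1..n0}" "i < N" "j < N" "0 < W p $$ (i, j)" for p i j
      using mem[OF that(1-3)] that(4) Xp by (intro Min_le) (auto simp: Xp_def)
  qed
qed

definition dist2 :: "nat \<Rightarrow> nat \<Rightarrow> real \<Rightarrow> real" where
  "dist2 i j s = (\<eta> i s - \<eta> j s) \<bullet> (\<eta> i s - \<eta> j s)"

definition disagreement :: "real \<Rightarrow> real" where
  "disagreement s = (\<Sum>i<N. \<Sum>j<N. W (\<sigma> s) $$ (i, j) * dist2 i j s)"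

definition perturbation :: "real \<Rightarrow> real" where
  "perturbation s = (\<Sum>i<N. \<omega> i s \<bullet> \<omega> i s)"

lemma dist2_nonneg: "0 \<le> dist2 i j s" by (simp add: dist2_def)

lemma perturbation_nonneg: "0 \<le> perturbation s" by (simp add: perturbation_def sum_nonneg)

lemma disagreement_nonneg: "0 \<le> s \<Longrightarrow> 0 \<le> disagreement s"
  unfolding disagreement_def using W_nonneg dist2_nonneg by (intro sum_nonneg) auto

lemma disagreement_ge_edge:
  assumes "0 \<le> s" "i < N" "j < N"
  shows "W (\<sigma> s) $$ (i, j) * dist2 i j s \<le> disagreement s"
proof -
  have nn: "0 \<le> W (\<sigma> s) $$ (k, l) * dist2 k l s" if "k < N" "l < N" for k l
    using W_nonneg[OF assms(1) that] dist2_nonneg by simp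
  have "W (\<sigma> s) $$ (i, j) * dist2 i j s \<le> (\<Sum>l<N. W (\<sigma> s) $$ (i, l) * dist2 i l s)"
    using assms nn by (intro member_le_sum[of j]) auto
  also have "\<dots> \<le> disagreement s"
    unfolding disagreement_def using assms nn
    by (intro member_le_sum[of i _ "\<lambda>i. \<Sum>l<N. W (\<sigma> s) $$ (i, l) * dist2 i l s"]) (auto intro: sum_nonneg)
  finally show ?thesis .
qed

lemma dist2_triangle:
  assumes "i < N" "j < N" "k < N"
  shows "dist2 i k s \<le> 2 * dist2 i j s + 2 * dist2 j k s"
proof -
  have "\<eta> i s - \<eta> k s = (\<eta> i s - \<eta> j s) + (\<eta> j s - \<eta> k s)"
    using \<eta>(1)[OF assms(1), of s] \<eta>(1)[OF assms(2), of s] \<eta>(1)[OF assms(3), of s] by (intro eq_vecI) auto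
  thus ?thesis unfolding dist2_def
    using scalar_prod_add_self_le[of "\<eta> i s - \<eta> j s" n "\<eta> j s - \<eta> k s"]
      \<eta>(1)[OF assms(1), of s] \<eta>(1)[OF assms(2), of s] \<eta>(1)[OF assms(3), of s] by simp
qed

text \<open>
  The matrix \<open>H = \<Sum>\<^sub>i (1 - E\<^sub>i)\<close> is injective by joint observability, hence bounded below. Since \<open>\<eta>\<^sub>i\<close>
  is fixed by \<open>E\<^sub>i\<close>, the vector \<open>(1 - E\<^sub>i) \<eta>\<^sub>j\<close> equals \<open>(1 - E\<^sub>i) (\<eta>\<^sub>j - \<eta>\<^sub>i)\<close>, so \<open>H \<eta>\<^sub>j\<close> is controlled
  by the distances of \<open>\<eta>\<^sub>j\<close> to the other vectors.
\<close>

lemma agreement_imp_small: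
  obtains c where "0 \<le> c" "\<And>j s. j < N \<Longrightarrow> \<eta> j s \<bullet> \<eta> j s \<le> c * (\<Sum>i<N. dist2 j i s)"
proof -
  define H where "H = mat n n (\<lambda>(k, l). \<Sum>i<N. (1\<^sub>m n - E i) $$ (k, l))"
  have H: "H \<in> carrier_mat n n" by (simp add: H_def)
  have Ex: "E i *\<^sub>v x \<in> carrier_vec n" if "i < N" "x \<in> carrier_vec n" for i x
    using E(1)[OF that(1)] that(2) by simp
  have Hx: "H *\<^sub>v x = vsum n N (\<lambda>i. x - E i *\<^sub>v x)" if x: "x \<in> carrier_vec n" for x
  proof (rule eq_vecI)
    fix k assume "k < dim_vec (vsum n N (\<lambda>i. x - E i *\<^sub>v x))"
    hence k: "k < n" by (simp add: vsum_def)
    have "(H *\<^sub>v x) $ k = (\<Sum>l<n. \<Sum>i<N. (1\<^sub>m n - E i) $$ (k, l) * x $ l)"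
      using k x H by (simp add: scalar_prod_def lessThan_atLeast0 H_def sum_distrib_right)
    also have "\<dots> = (\<Sum>i<N. \<Sum>l<n. (1\<^sub>m n - E i) $$ (k, l) * x $ l)" by (rule sum.swap)
    also have "\<dots> = (\<Sum>i<N. (x - E i *\<^sub>v x) $ k)"
    proof (rule sum.cong)
      fix i assume "i \<in> {..<N}"
      hence i: "i < N" by simp
      have "(\<Sum>l<n. (1\<^sub>m n - E i) $$ (k, l) * x $ l) = ((1\<^sub>m n - E i) *\<^sub>v x) $ k"
        using k x E(1)[OF i] by (simp add: scalar_prod_def lessThan_atLeast0)
      also have "(1\<^sub>m n - E i) *\<^sub>v x = x - E i *\<^sub>v x"
        using minus_mult_distrib_mat_vec[OF _ E(1)[OF i] x, of "1\<^sub>m n"] x by simp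
      finally show "(\<Sum>l<n. (1\<^sub>m n - E i) $$ (k, l) * x $ l) = (x - E i *\<^sub>v x) $ k" .
    qed simp
    finally show "(H *\<^sub>v x) $ k = vsum n N (\<lambda>i. x - E i *\<^sub>v x) $ k" using k by (simp add: vsum_def)
  qed (use H in \<open>simp add: vsum_def\<close>)
  have "x = 0\<^sub>v n" if x: "x \<in> carrier_vec n" "H *\<^sub>v x = 0\<^sub>v n" for x
  proof (rule jointly_obs[OF x(1)])
    \<comment> \<open>\<open>x \<bullet> H x\<close> is the sum of the squared norms of the components \<open>x - E i x\<close>\<close>
    have "x \<bullet> (x - E i *\<^sub>v x) = (x - E i *\<^sub>v x) \<bullet> (x - E i *\<^sub>v x)" if i: "i < N" for i
    proof -
      have "(E i *\<^sub>v x) \<bullet> (x - E i *\<^sub>v x) = x \<bullet> (E i *\<^sub>v (x - E i *\<^sub>v x))"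
        using transpose_vec_mult_scalar[OF E(1)[OF i], of "x - E i *\<^sub>v x" x] E(2)[OF i] x(1) Ex[OF i x(1)] by simp
      also have "E i *\<^sub>v (x - E i *\<^sub>v x) = 0\<^sub>v n"
        using mult_minus_distrib_mat_vec[OF E(1)[OF i] x(1) Ex[OF i x(1)]] idem[OF i x(1)] Ex[OF i x(1)] by simp
      finally have "(E i *\<^sub>v x) \<bullet> (x - E i *\<^sub>v x) = 0" using x(1) by simp
      thus ?thesis using minus_scalar_prod_distrib[OF x(1) Ex[OF i x(1)], of "x - E i *\<^sub>v x"] x(1) Ex[OF i x(1)] by simp
    qed
    hence "(\<Sum>i<N. (x - E i *\<^sub>v x) \<bullet> (x - E i *\<^sub>v x)) = x \<bullet> (H *\<^sub>v x)"
      unfolding Hx[OF x(1)] using x(1) Ex by (subst scalar_prod_vsum) auto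
    also have "\<dots> = 0" using x by simp
    finally have z: "(x - E i *\<^sub>v x) \<bullet> (x - E i *\<^sub>v x) = 0" if "i < N" for i
      using that by (simp add: sum_nonneg_eq_0_iff)
    fix i assume i: "i < N"
    have "x - E i *\<^sub>v x = 0\<^sub>v n"
      using z[OF i] scalar_prod_self_eq_0[of "x - E i *\<^sub>v x" n] x(1) Ex[OF i x(1)] by simp
    hence "(x - E i *\<^sub>v x) $ k = 0" if "k < n" for k using that by simp
    thus "E i *\<^sub>v x = x" using x(1) carrier_matD[OF E(1)[OF i]] by (intro eq_vecI) auto
  qed
  then obtain c where c: "0 \<le> c" "\<And>x. x \<in> carrier_vec n \<Longrightarrow> x \<bullet> x \<le> c * ((H *\<^sub>v x) \<bullet> (H *\<^sub>v x))"
    using nonsingular_bounded_below[OF H] by blast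
  show ?thesis
  proof (rule that[of "c * real N"])
    fix j s assume j: "j < N"
    let ?x = "\<eta> j s"
    have x: "?x \<in> carrier_vec n" using \<eta> j by simp
    have le: "(?x - E i *\<^sub>v ?x) \<bullet> (?x - E i *\<^sub>v ?x) \<le> dist2 j i s" if i: "i < N" for i
    proof -
      have y: "?x - \<eta> i s \<in> carrier_vec n" using x \<eta>(1)[OF i] by simp
      have "?x - E i *\<^sub>v ?x = (?x - \<eta> i s) - E i *\<^sub>v (?x - \<eta> i s)"
        using mult_minus_distrib_mat_vec[OF E(1)[OF i] x \<eta>(1)[OF i]] \<eta>(2)[OF i] x \<eta>(1)[OF i, of s] carrier_matD[OF E(1)[OF i]]
        by (intro eq_vecI) auto
      thus ?thesis unfolding dist2_def
        using orthogonal_projection_contracts(2)[OF E(1)[OF i] E(2)[OF i] idem[OF i y] y] by simp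
    qed
    have "(H *\<^sub>v ?x) \<bullet> (H *\<^sub>v ?x) \<le> real N * (\<Sum>i<N. (?x - E i *\<^sub>v ?x) \<bullet> (?x - E i *\<^sub>v ?x))"
      unfolding Hx[OF x] using x Ex by (intro vsum_self_le) auto
    also have "\<dots> \<le> real N * (\<Sum>i<N. dist2 j i s)" using le by (intro mult_left_mono sum_mono) auto
    finally have "c * ((H *\<^sub>v ?x) \<bullet> (H *\<^sub>v ?x)) \<le> c * (real N * (\<Sum>i<N. dist2 j i s))"
      using c(1) by (rule mult_left_mono)
    thus "?x \<bullet> ?x \<le> c * real N * (\<Sum>i<N. dist2 j i s)" using c(2)[OF x] by (simp add: mult.assoc)
  qed (use c in simp)
qed

lemma \<gamma>_nonneg: "i < N \<Longrightarrow> 0 \<le> \<gamma> i" using \<gamma> by (simp add: less_imp_le)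

definition coupling :: "nat \<Rightarrow> real \<Rightarrow> real vec" where
  "coupling i s = vsum n N (\<lambda>j. W (\<sigma> s) $$ (i, j) \<cdot>\<^sub>v ((\<omega> j s + \<eta> j s) - (\<omega> i s + \<eta> i s)))"

lemma coupling_carrier [simp]: "coupling i s \<in> carrier_vec n"
  by (simp add: coupling_def)

definition force :: "nat \<Rightarrow> real \<Rightarrow> real vec" where
  "force i s = \<gamma> i \<cdot>\<^sub>v (E i *\<^sub>v coupling i s)"

lemma force_carrier: "i < N \<Longrightarrow> force i s \<in> carrier_vec n"
  using mult_mat_vec_carrier[OF E(1) coupling_carrier] by (simp add: force_def)

lemma S\<eta>_carrier: "i < N \<Longrightarrow> S *\<^sub>v \<eta> i s \<in> carrier_vec n"
  using S \<eta>(1) by simp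

lemma \<eta>_deriv:
  "i < N \<Longrightarrow> 0 < s \<Longrightarrow> s \<notin> range t \<Longrightarrow> has_vec_deriv n (\<eta> i) (S *\<^sub>v \<eta> i s + force i s) s"
  unfolding force_def coupling_def by (rule \<eta>')

text \<open>
  All agents rotate with the same \<open>S\<close>, and a rotation of the difference does not change its length.
  Only the coupling forces contribute, and they are bounded by the dissipation.
\<close>

lemma dist2_growth:
  obtains C d' where "0 \<le> C"
    "\<And>i j s. i < N \<Longrightarrow> j < N \<Longrightarrow> 0 < s \<Longrightarrow> s \<notin> range t \<Longrightarrow> (dist2 i j has_real_derivative d' i j s) (at s)"
    "\<And>i j s. i < N \<Longrightarrow> j < N \<Longrightarrow> 0 < s \<Longrightarrow> s \<notin> range t \<Longrightarrow>
      d' i j s \<le> dist2 i j s + C * (disagreement s + perturbation s)"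
proof -
  obtain B \<beta> where B: "0 \<le> B" "\<And>p i j. p \<in> {1..n0} \<Longrightarrow> i < N \<Longrightarrow> j < N \<Longrightarrow> W p $$ (i, j) \<le> B"
    using weight_bounds by metis
  define C1 where "C1 = 2 * B * real N + 8 * B\<^sup>2 * (real N)\<^sup>2"
  define \<Gamma> where "\<Gamma> = (\<Sum>i<N. (\<gamma> i)\<^sup>2)"
  have C1: "0 \<le> C1" using B by (simp add: C1_def)
  have \<Gamma>: "0 \<le> \<Gamma>" by (simp add: \<Gamma>_def sum_nonneg)
  have force_le: "force i s \<bullet> force i s \<le> \<Gamma> * (C1 * (disagreement s + perturbation s))"
    if i: "i < N" and s: "0 < s" for i s
  proof -
    let ?g = "coupling i s"
    have nn: "0 \<le> W (\<sigma> s) $$ (k, l) * dist2 k l s" if "k < N" "l < N" for k l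
      using W_nonneg[OF _ that, of s] dist2_nonneg s by simp
    have D: "0 \<le> disagreement s" using disagreement_nonneg s by simp
    have "?g \<bullet> ?g \<le> 2 * B * real N * (\<Sum>j<N. W (\<sigma> s) $$ (i, j) * ((\<eta> i s - \<eta> j s) \<bullet> (\<eta> i s - \<eta> j s)))
        + 8 * B\<^sup>2 * (real N)\<^sup>2 * (\<Sum>j<N. \<omega> j s \<bullet> \<omega> j s)"
      unfolding coupling_def
      by (rule coupling_force_bound) (use \<eta>(1) \<omega>(1) W_nonneg[OF _ i] B(2)[OF \<sigma>_mode i] s i in auto)
    also have "(\<Sum>j<N. W (\<sigma> s) $$ (i, j) * ((\<eta> i s - \<eta> j s) \<bullet> (\<eta> i s - \<eta> j s))) \<le> disagreement s"
      unfolding disagreement_def dist2_def[symmetric]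
      using i nn by (intro member_le_sum[of i _ "\<lambda>i. \<Sum>l<N. W (\<sigma> s) $$ (i, l) * dist2 i l s"]) (auto intro: sum_nonneg)
    finally have "?g \<bullet> ?g \<le> 2 * B * real N * disagreement s + 8 * B\<^sup>2 * (real N)\<^sup>2 * perturbation s"
      unfolding perturbation_def[symmetric] using B(1) by (simp add: mult_left_mono)
    also have "\<dots> \<le> C1 * (disagreement s + perturbation s)"
    proof -
      have "0 \<le> 2 * B * real N * perturbation s" "0 \<le> 8 * B\<^sup>2 * (real N)\<^sup>2 * disagreement s"
        using B(1) D perturbation_nonneg by simp_all
      thus ?thesis unfolding C1_def by (simp add: algebra_simps)
    qed
    finally have g: "?g \<bullet> ?g \<le> C1 * (disagreement s + perturbation s)" .
    have "(E i *\<^sub>v ?g) \<bullet> (E i *\<^sub>v ?g) \<le> ?g \<bullet> ?g"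
      by (rule orthogonal_projection_contracts(1)[OF E(1)[OF i] E(2)[OF i] idem[OF i]]) simp_all
    with g have Eg: "(E i *\<^sub>v ?g) \<bullet> (E i *\<^sub>v ?g) \<le> C1 * (disagreement s + perturbation s)" by linarith
    have "force i s \<bullet> force i s = (\<gamma> i)\<^sup>2 * ((E i *\<^sub>v ?g) \<bullet> (E i *\<^sub>v ?g))"
      by (simp add: force_def power2_eq_square)
    also have "\<dots> \<le> \<Gamma> * (C1 * (disagreement s + perturbation s))"
    proof (rule mult_mono[OF _ Eg \<Gamma>])
      show "(\<gamma> i)\<^sup>2 \<le> \<Gamma>" unfolding \<Gamma>_def using i by (intro member_le_sum) auto
    qed simp
    finally show ?thesis .
  qed
  define d' where "d' = (\<lambda>i j s. 2 * ((\<eta> i s - \<eta> j s) \<bullet> (force i s - force j s)))"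
  show ?thesis
  proof (rule that[of "4 * \<Gamma> * C1" d'])
    fix i j s assume i: "i < N" and j: "j < N" and s: "0 < s" "s \<notin> range t"
    have \<delta>: "\<eta> i u - \<eta> j u \<in> carrier_vec n" for u using \<eta>(1)[OF i] \<eta>(1)[OF j] by simp
    have f: "force i s - force j s \<in> carrier_vec n" using force_carrier[OF i] force_carrier[OF j] by simp
    have S\<delta>: "S *\<^sub>v (\<eta> i s - \<eta> j s) \<in> carrier_vec n" using S \<delta> by simp
    have e: "(S *\<^sub>v \<eta> i s + force i s) - (S *\<^sub>v \<eta> j s + force j s) = S *\<^sub>v (\<eta> i s - \<eta> j s) + (force i s - force j s)"
      unfolding mult_minus_distrib_mat_vec[OF S \<eta>(1)[OF i] \<eta>(1)[OF j]]
      using force_carrier[OF i, of s] force_carrier[OF j, of s] carrier_matD[OF S] by (intro eq_vecI) auto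
    have "has_vec_deriv n (\<lambda>u. \<eta> i u - \<eta> j u) (S *\<^sub>v (\<eta> i s - \<eta> j s) + (force i s - force j s)) s"
      unfolding e[symmetric]
      by (intro has_vec_deriv_minus \<eta>(1)[OF i] \<eta>(1)[OF j] \<eta>_deriv[OF i s] \<eta>_deriv[OF j s]
          add_carrier_vec S\<eta>_carrier[OF i] S\<eta>_carrier[OF j] force_carrier[OF i] force_carrier[OF j])
    from has_vec_deriv_scalar_prod[OF \<delta> \<delta> _ _ this this]
    have "((\<lambda>u. (\<eta> i u - \<eta> j u) \<bullet> (\<eta> i u - \<eta> j u)) has_real_derivative
        (S *\<^sub>v (\<eta> i s - \<eta> j s) + (force i s - force j s)) \<bullet> (\<eta> i s - \<eta> j s)
        + (\<eta> i s - \<eta> j s) \<bullet> (S *\<^sub>v (\<eta> i s - \<eta> j s) + (force i s - force j s))) (at s)"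
      using S\<delta> f by simp
    moreover have "(S *\<^sub>v (\<eta> i s - \<eta> j s) + (force i s - force j s)) \<bullet> (\<eta> i s - \<eta> j s)
        = (\<eta> i s - \<eta> j s) \<bullet> (S *\<^sub>v (\<eta> i s - \<eta> j s) + (force i s - force j s))"
      using S\<delta> f by (intro comm_scalar_prod[OF _ \<delta>]) simp
    moreover have "(\<eta> i s - \<eta> j s) \<bullet> (S *\<^sub>v (\<eta> i s - \<eta> j s) + (force i s - force j s))
        = (\<eta> i s - \<eta> j s) \<bullet> (force i s - force j s)"
      using scalar_prod_add_distrib[OF \<delta> S\<delta> f] skew[OF \<delta>] by simp
    ultimately show "(dist2 i j has_real_derivative d' i j s) (at s)"
      unfolding dist2_def[abs_def] d'_def by simp
    have "d' i j s \<le> dist2 i j s + (force i s - force j s) \<bullet> (force i s - force j s)"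
      unfolding d'_def dist2_def by (rule two_scalar_prod_le[OF \<delta> f])
    also have "(force i s - force j s) \<bullet> (force i s - force j s) \<le> 2 * (force i s \<bullet> force i s) + 2 * (force j s \<bullet> force j s)"
      by (rule scalar_prod_minus_self_le[OF force_carrier[OF i] force_carrier[OF j]])
    finally show "d' i j s \<le> dist2 i j s + 4 * \<Gamma> * C1 * (disagreement s + perturbation s)"
      using force_le[OF i s(1)] force_le[OF j s(1)] by (simp add: mult.assoc)
  qed (use \<Gamma> C1 in simp)
qed

definition dissipative ::
    "(real \<Rightarrow> real) \<Rightarrow> (real \<Rightarrow> real) \<Rightarrow> (real \<Rightarrow> real) \<Rightarrow> (real \<Rightarrow> real) \<Rightarrow> real \<Rightarrow> bool" where
  "dissipative U V U' V' \<kappa> \<longleftrightarrow>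
     0 < \<kappa> \<and> (\<forall>s. 0 \<le> V s) \<and> continuous_on {0..} U \<and> continuous_on {0..} V \<and>
     (\<forall>s. 0 < s \<longrightarrow> s \<notin> range t \<longrightarrow>
        (U has_real_derivative U' s) (at s) \<and> (V has_real_derivative V' s) (at s) \<and>
        U' s \<le> - (1/2) * disagreement s - perturbation s - \<kappa> * V s \<and> V' s \<le> 0)"

text \<open>
  \<open>V\<close> is the Lyapunov function of the observable parts and \<open>U\<close> the total energy. The factor \<open>K\<close> in
  front of \<open>V\<close> is chosen such that the decay of \<open>V\<close> pays for the disturbance \<open>2 B N\<close> times the
  perturbation in \<open>coupling_dissipation\<close> and still leaves dissipation over.
\<close>

lemma energy_function:
  obtains U V U' V' :: "real \<Rightarrow> real" and \<kappa> C0 C1 where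
    "dissipative U V U' V' \<kappa>" "0 \<le> C0" "0 \<le> C1" "\<And>s. 0 \<le> U s"
    "\<And>s. U s \<le> C0 * ((\<Sum>j<N. \<eta> j s \<bullet> \<eta> j s) + V s)"
    "\<And>i s. i < N \<Longrightarrow> \<omega> i s \<bullet> \<omega> i s + \<eta> i s \<bullet> \<eta> i s \<le> C1 * U s"
proof -
  obtain B \<beta> where B: "0 \<le> B" "\<And>p i j. p \<in> {1..n0} \<Longrightarrow> i < N \<Longrightarrow> j < N \<Longrightarrow> W p $$ (i, j) \<le> B"
    using weight_bounds by metis
  define lyap where "lyap = (\<lambda>i Y c \<alpha>. Y \<in> carrier_mat (r i) (r i) \<and> transpose_mat Y = Y \<and> 0 < c \<and> 0 < \<alpha> \<and>
    (\<forall>x\<in>carrier_vec (r i). c * (x \<bullet> x) \<le> x \<bullet> (Y *\<^sub>v x)) \<and>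
    (\<forall>x\<in>carrier_vec (r i). x \<bullet> (Y *\<^sub>v (F i *\<^sub>v x)) \<le> - \<alpha> * (x \<bullet> (Y *\<^sub>v x))))"
  have "\<exists>Y c \<alpha>. lyap i Y c \<alpha>" if "i < N" for i
    unfolding lyap_def by (rule Hurwitz_imp_Lyapunov_matrix[OF F(1)[OF that] F(2)[OF that]])
  then obtain Y c \<alpha> where lyap: "\<And>i. i < N \<Longrightarrow> lyap i (Y i) (c i) (\<alpha> i)" by metis
  have Y: "Y i \<in> carrier_mat (r i) (r i)" "transpose_mat (Y i) = Y i" "0 < c i" "0 < \<alpha> i"
    and Y_lo: "\<And>x. x \<in> carrier_vec (r i) \<Longrightarrow> c i * (x \<bullet> x) \<le> x \<bullet> (Y i *\<^sub>v x)"
    and Y_decay: "\<And>x. x \<in> carrier_vec (r i) \<Longrightarrow> x \<bullet> (Y i *\<^sub>v (F i *\<^sub>v x)) \<le> - \<alpha> i * (x \<bullet> (Y i *\<^sub>v x))"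
    if "i < N" for i
    using lyap[OF that] unfolding lyap_def by blast+
  define c0 where "c0 = Min (insert 1 (c ` {..<N}))"
  define \<alpha>0 where "\<alpha>0 = Min (insert 1 (\<alpha> ` {..<N}))"
  have c0: "0 < c0" "\<And>i. i < N \<Longrightarrow> c0 \<le> c i" using Y(3) by (auto simp: c0_def)
  have \<alpha>0: "0 < \<alpha>0" "\<And>i. i < N \<Longrightarrow> \<alpha>0 \<le> \<alpha> i" using Y(4) by (auto simp: \<alpha>0_def)
  define K where "K = (2 * B * real N + 1) / (\<alpha>0 * c0)"
  have K: "0 < K" using B(1) \<alpha>0(1) c0(1) by (auto simp: K_def intro!: divide_pos_pos add_nonneg_pos)
  have Yw: "Y i *\<^sub>v w i s \<in> carrier_vec (r i)" if "i < N" for i s using Y(1)[OF that] w[OF that] by simp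
  have Fw: "F i *\<^sub>v w i s \<in> carrier_vec (r i)" if "i < N" for i s using F(1)[OF that] w[OF that] by simp
  have YFw: "Y i *\<^sub>v (F i *\<^sub>v w i s) \<in> carrier_vec (r i)" if "i < N" for i s using Y(1)[OF that] Fw[OF that] by simp
  have V_term: "0 \<le> w i s \<bullet> (Y i *\<^sub>v w i s)" if "i < N" for i s
    using Y_lo[OF that w[OF that], of s] Y(3)[OF that] scalar_prod_self_nonneg[of "w i s"]
    by (meson mult_nonneg_nonneg order_less_imp_le order_trans)

  define V where "V = (\<lambda>s. \<Sum>i<N. w i s \<bullet> (Y i *\<^sub>v w i s))"
  define V' where "V' = (\<lambda>s. \<Sum>i<N. (F i *\<^sub>v w i s) \<bullet> (Y i *\<^sub>v w i s) + w i s \<bullet> (Y i *\<^sub>v (F i *\<^sub>v w i s)))"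
  have V0: "0 \<le> V s" for s unfolding V_def using V_term by (intro sum_nonneg) auto
  have V_cont: "continuous_on {0..} V"
    unfolding V_def
    by (intro continuous_on_sum continuous_on_scalar_prod[of _ "r _"] vec_continuous_on_mult_mat[of _ "r _" "r _"])
      (use w Yw Y(1) cont(2) in auto)
  have V_deriv: "(V has_real_derivative V' s) (at s)" if s: "0 < s" "s \<notin> range t" for s
    unfolding V_def V'_def
    by (intro DERIV_sum has_vec_deriv_scalar_prod[of _ "r _"] has_vec_deriv_mult_mat[of _ "r _" "r _"])
      (use w Yw Fw YFw Y(1) w' s in auto)
  have V'_le: "V' s \<le> - 2 * \<alpha>0 * V s" for s
    unfolding V'_def V_def sum_distrib_left
  proof (rule sum_mono)
    fix i assume "i \<in> {..<N}"
    hence i: "i < N" by simp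
    have "(F i *\<^sub>v w i s) \<bullet> (Y i *\<^sub>v w i s) = (Y i *\<^sub>v (F i *\<^sub>v w i s)) \<bullet> w i s"
      using transpose_vec_mult_scalar[OF Y(1)[OF i] w[OF i] Fw[OF i]] Y(2)[OF i] by simp
    also have "\<dots> = w i s \<bullet> (Y i *\<^sub>v (F i *\<^sub>v w i s))" by (rule comm_scalar_prod[OF YFw[OF i] w[OF i]])
    finally have e: "(F i *\<^sub>v w i s) \<bullet> (Y i *\<^sub>v w i s) = w i s \<bullet> (Y i *\<^sub>v (F i *\<^sub>v w i s))" .
    have "\<alpha>0 * (w i s \<bullet> (Y i *\<^sub>v w i s)) \<le> \<alpha> i * (w i s \<bullet> (Y i *\<^sub>v w i s))"
      using \<alpha>0(2)[OF i] V_term[OF i] by (intro mult_right_mono) auto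
    thus "(F i *\<^sub>v w i s) \<bullet> (Y i *\<^sub>v w i s) + w i s \<bullet> (Y i *\<^sub>v (F i *\<^sub>v w i s)) \<le> - 2 * \<alpha>0 * (w i s \<bullet> (Y i *\<^sub>v w i s))"
      using Y_decay[OF i w[OF i], of s] unfolding e by linarith
  qed
  have pert_le: "c0 * perturbation s \<le> V s" for s
    unfolding perturbation_def V_def sum_distrib_left
  proof (rule sum_mono)
    fix i assume "i \<in> {..<N}"
    hence i: "i < N" by simp
    have "c0 * (w i s \<bullet> w i s) \<le> c i * (w i s \<bullet> w i s)" using c0(2)[OF i] by (intro mult_right_mono) auto
    thus "c0 * (\<omega> i s \<bullet> \<omega> i s) \<le> w i s \<bullet> (Y i *\<^sub>v w i s)"
      using Y_lo[OF i w[OF i], of s] \<omega>(2)[OF i] by simp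
  qed

  \<comment> \<open>In the derivative of \<open>Z\<close> the weight \<open>1 / \<gamma>\<^sub>i\<close> cancels the gain, so that symmetry can be used.\<close>
  define Z where "Z = (\<lambda>s. \<Sum>i<N. (1 / \<gamma> i) * (\<eta> i s \<bullet> \<eta> i s))"
  define Z' where "Z' = (\<lambda>s. 2 * (\<Sum>i<N. \<Sum>j<N. W (\<sigma> s) $$ (i, j) * (\<eta> i s \<bullet> ((\<omega> j s + \<eta> j s) - (\<omega> i s + \<eta> i s)))))"
  have Z0: "0 \<le> Z s" for s unfolding Z_def using \<gamma>_nonneg by (intro sum_nonneg) auto
  have Z_cont: "continuous_on {0..} Z"
    unfolding Z_def by (intro continuous_intros continuous_on_scalar_prod[of _ n]) (use \<eta>(1) cont(1) in auto)
  have Z_deriv: "(Z has_real_derivative Z' s) (at s)" if s: "0 < s" "s \<notin> range t" for s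
  proof -
    have "((\<lambda>u. (1 / \<gamma> i) * (\<eta> i u \<bullet> \<eta> i u)) has_real_derivative
        2 * (\<Sum>j<N. W (\<sigma> s) $$ (i, j) * (\<eta> i s \<bullet> ((\<omega> j s + \<eta> j s) - (\<omega> i s + \<eta> i s))))) (at s)"
      if i: "i < N" for i
    proof -
      let ?x = "\<eta> i s" and ?g = "coupling i s"
      have x: "?x \<in> carrier_vec n" by (rule \<eta>(1)[OF i])
      have Eg: "E i *\<^sub>v ?g \<in> carrier_vec n" using E(1)[OF i] by simp
      have sf: "S *\<^sub>v ?x + force i s \<in> carrier_vec n"
        by (intro add_carrier_vec S\<eta>_carrier[OF i] force_carrier[OF i])
      have "?x \<bullet> (S *\<^sub>v ?x + force i s) = \<gamma> i * (?x \<bullet> (E i *\<^sub>v ?g))"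
        using scalar_prod_add_distrib[OF x S\<eta>_carrier[OF i] force_carrier[OF i]] skew[OF x] x Eg
        by (simp add: force_def)
      also have "?x \<bullet> (E i *\<^sub>v ?g) = ?x \<bullet> ?g"
        using transpose_vec_mult_scalar[OF E(1)[OF i] coupling_carrier x, of i s] E(2)[OF i] \<eta>(2)[OF i, of s] by simp
      also have "?x \<bullet> ?g = (\<Sum>j<N. W (\<sigma> s) $$ (i, j) * (\<eta> i s \<bullet> ((\<omega> j s + \<eta> j s) - (\<omega> i s + \<eta> i s))))"
        unfolding coupling_def using x \<omega>(1) \<eta>(1) i by (subst scalar_prod_vsum) (auto simp: scalar_prod_smult_distrib[of _ n])
      finally have 1: "?x \<bullet> (S *\<^sub>v ?x + force i s)
          = \<gamma> i * (\<Sum>j<N. W (\<sigma> s) $$ (i, j) * (\<eta> i s \<bullet> ((\<omega> j s + \<eta> j s) - (\<omega> i s + \<eta> i s))))" .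
      have "((\<lambda>u. \<eta> i u \<bullet> \<eta> i u) has_real_derivative
          (S *\<^sub>v ?x + force i s) \<bullet> ?x + ?x \<bullet> (S *\<^sub>v ?x + force i s)) (at s)"
        by (rule has_vec_deriv_scalar_prod[OF \<eta>(1)[OF i] \<eta>(1)[OF i] sf sf \<eta>_deriv[OF i s] \<eta>_deriv[OF i s]])
      hence "((\<lambda>u. (1 / \<gamma> i) * (\<eta> i u \<bullet> \<eta> i u)) has_real_derivative
          (1 / \<gamma> i) * ((S *\<^sub>v ?x + force i s) \<bullet> ?x + ?x \<bullet> (S *\<^sub>v ?x + force i s))) (at s)"
        by (rule DERIV_cmult)
      moreover have "(S *\<^sub>v ?x + force i s) \<bullet> ?x = ?x \<bullet> (S *\<^sub>v ?x + force i s)" by (rule comm_scalar_prod[OF sf x])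
      ultimately show ?thesis using \<gamma>[OF i] by (simp add: 1)
    qed
    hence "(Z has_real_derivative (\<Sum>i<N. 2 * (\<Sum>j<N. W (\<sigma> s) $$ (i, j) * (\<eta> i s \<bullet> ((\<omega> j s + \<eta> j s) - (\<omega> i s + \<eta> i s)))))) (at s)"
      unfolding Z_def by (intro DERIV_sum) auto
    thus ?thesis by (simp only: Z'_def sum_distrib_left)
  qed
  have Z'_le: "Z' s \<le> - (1/2) * disagreement s + 2 * B * real N * perturbation s" if s: "0 < s" for s
    unfolding Z'_def disagreement_def perturbation_def dist2_def
    by (rule coupling_dissipation) (use \<eta>(1) \<omega>(1) W_nonneg W_sym B(2)[OF \<sigma>_mode] s in auto)

  define U where "U = (\<lambda>s. Z s + K * V s)"
  define U' where "U' = (\<lambda>s. Z' s + K * V' s)"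
  have diss: "dissipative U V U' V' (\<alpha>0 * K)"
    unfolding dissipative_def
  proof (intro conjI allI impI)
    show "0 < \<alpha>0 * K" using \<alpha>0(1) K by simp
    show "0 \<le> V s" for s by (rule V0)
    show "continuous_on {0..} V" by (rule V_cont)
    show "continuous_on {0..} U" unfolding U_def by (intro continuous_intros Z_cont V_cont)
    fix s :: real assume s: "0 < s" "s \<notin> range t"
    show "(V has_real_derivative V' s) (at s)" by (rule V_deriv[OF s])
    show "(U has_real_derivative U' s) (at s)"
      unfolding U_def U'_def by (intro DERIV_add DERIV_cmult Z_deriv[OF s] V_deriv[OF s])
    have "0 \<le> 2 * \<alpha>0 * V s" using V0[of s] \<alpha>0(1) by simp
    thus "V' s \<le> 0" using V'_le[of s] by linarith
    have "K * V' s \<le> K * (- 2 * \<alpha>0 * V s)" using V'_le K by (intro mult_left_mono) auto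
    moreover have "(2 * B * real N + 1) * perturbation s \<le> \<alpha>0 * K * V s"
    proof -
      have "(2 * B * real N + 1) * perturbation s = \<alpha>0 * K * (c0 * perturbation s)"
        using \<alpha>0(1) c0(1) by (simp add: K_def)
      also have "\<dots> \<le> \<alpha>0 * K * V s" using pert_le \<alpha>0(1) K by (intro mult_left_mono) auto
      finally show ?thesis .
    qed
    ultimately show "U' s \<le> - (1/2) * disagreement s - perturbation s - \<alpha>0 * K * V s"
      using Z'_le[OF s(1)] unfolding U'_def by (simp add: algebra_simps)
  qed
  show ?thesis
  proof (rule that[OF diss, of "(\<Sum>i<N. 1 / \<gamma> i) + K" "(\<Sum>i<N. \<gamma> i) + 1 / (K * c0)"])
    have \<gamma>1: "0 \<le> (\<Sum>i<N. 1 / \<gamma> i)" "0 \<le> (\<Sum>i<N. \<gamma> i)" using \<gamma>_nonneg by (auto intro!: sum_nonneg)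
    thus "0 \<le> (\<Sum>i<N. 1 / \<gamma> i) + K" using K by simp
    show "0 \<le> (\<Sum>i<N. \<gamma> i) + 1 / (K * c0)" using \<gamma>1 K c0(1) by simp
    show "0 \<le> U s" for s using Z0 V0 K by (simp add: U_def)
  next
    fix s
    have "Z s \<le> (\<Sum>i<N. (\<Sum>i<N. 1 / \<gamma> i) * (\<eta> i s \<bullet> \<eta> i s))"
      unfolding Z_def
    proof (intro sum_mono mult_right_mono)
      fix i assume "i \<in> {..<N}"
      thus "1 / \<gamma> i \<le> (\<Sum>i<N. 1 / \<gamma> i)" using \<gamma>_nonneg by (intro member_le_sum) auto
    qed simp
    also have "\<dots> = (\<Sum>i<N. 1 / \<gamma> i) * (\<Sum>j<N. \<eta> j s \<bullet> \<eta> j s)" by (simp add: sum_distrib_left)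
    finally have "Z s \<le> (\<Sum>i<N. 1 / \<gamma> i) * (\<Sum>j<N. \<eta> j s \<bullet> \<eta> j s)" .
    moreover have "0 \<le> (\<Sum>i<N. 1 / \<gamma> i) * V s" "0 \<le> K * (\<Sum>j<N. \<eta> j s \<bullet> \<eta> j s)"
      using \<gamma>_nonneg V0 K by (auto intro!: mult_nonneg_nonneg sum_nonneg)
    ultimately show "U s \<le> ((\<Sum>i<N. 1 / \<gamma> i) + K) * ((\<Sum>j<N. \<eta> j s \<bullet> \<eta> j s) + V s)"
      unfolding U_def by (simp add: algebra_simps)
  next
    fix i s assume i: "i < N"
    have "(1 / \<gamma> i) * (\<eta> i s \<bullet> \<eta> i s) \<le> Z s"
      unfolding Z_def using i \<gamma>_nonneg by (intro member_le_sum[of i _ "\<lambda>i. (1 / \<gamma> i) * (\<eta> i s \<bullet> \<eta> i s)"]) auto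
    also have "\<dots> \<le> U s" using V0 K by (simp add: U_def)
    finally have "\<eta> i s \<bullet> \<eta> i s \<le> \<gamma> i * U s" using \<gamma>[OF i] by (simp add: field_simps)
    also have "\<dots> \<le> (\<Sum>i<N. \<gamma> i) * U s"
      using i \<gamma> Z0 V0 K by (intro mult_right_mono member_le_sum) (auto simp: U_def intro: less_imp_le)
    finally have 1: "\<eta> i s \<bullet> \<eta> i s \<le> (\<Sum>i<N. \<gamma> i) * U s" .
    have "\<omega> i s \<bullet> \<omega> i s \<le> perturbation s" unfolding perturbation_def using i by (intro member_le_sum) auto
    also have "\<dots> \<le> 1 / (K * c0) * (K * V s)" using pert_le[of s] c0(1) K by (simp add: field_simps)
    also have "\<dots> \<le> 1 / (K * c0) * U s" using Z0 K c0(1) by (intro mult_left_mono) (auto simp: U_def)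
    finally show "\<omega> i s \<bullet> \<omega> i s + \<eta> i s \<bullet> \<eta> i s \<le> ((\<Sum>i<N. \<gamma> i) + 1 / (K * c0)) * U s"
      using 1 by (simp add: algebra_simps)
  qed
qed

section \<open>Contraction over a connected window\<close>

text \<open>
  \<open>endpoint_le_energy_drop\<close> is applied to the squared distance along an edge, with the interval on
  which a mode containing this edge is active, and to \<open>V\<close>, with the entire window.
\<close>

lemma window_contraction:
  assumes dis: "dissipative U V U' V' \<kappa>"
    and mono: "\<And>x y. 0 \<le> x \<Longrightarrow> x \<le> y \<Longrightarrow> U y \<le> U x"
  obtains K where "0 \<le> K" "\<And>k l i j. k < l \<Longrightarrow> t l - t k \<le> T \<Longrightarrow>
      connected (with_proj (union_graph N G \<sigma> t (t k) (t l))) \<Longrightarrow> i < N \<Longrightarrow> j < N \<Longrightarrow>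
      dist2 i j (t l) \<le> K * (U (t k) - U (t l))"
    "\<And>k l. k < l \<Longrightarrow> t l - t k \<le> T \<Longrightarrow> V (t l) \<le> K * (U (t k) - U (t l))"
proof -
  have \<kappa>: "0 < \<kappa>" and E: "continuous_on {0..} U" "continuous_on {0..} V" "\<And>s. 0 \<le> V s"
    using dis unfolding dissipative_def by blast+
  note D = dis[unfolded dissipative_def, THEN conjunct2, THEN conjunct2, THEN conjunct2, THEN conjunct2, rule_format]
  note U' = D[THEN conjunct1] and V' = D[THEN conjunct2, THEN conjunct1]
    and U'_le = D[THEN conjunct2, THEN conjunct2, THEN conjunct1]
    and V'_le = D[THEN conjunct2, THEN conjunct2, THEN conjunct2]
  obtain C d' where C: "0 \<le> C"
    and d': "\<And>i j s. i < N \<Longrightarrow> j < N \<Longrightarrow> 0 < s \<Longrightarrow> s \<notin> range t \<Longrightarrow> (dist2 i j has_real_derivative d' i j s) (at s)"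
    and d'_le: "\<And>i j s. i < N \<Longrightarrow> j < N \<Longrightarrow> 0 < s \<Longrightarrow> s \<notin> range t \<Longrightarrow>
      d' i j s \<le> dist2 i j s + C * (disagreement s + perturbation s)"
    using dist2_growth by metis
  obtain B \<beta> where \<beta>: "0 < \<beta>"
    "\<And>p i j. p \<in> {1..n0} \<Longrightarrow> i < N \<Longrightarrow> j < N \<Longrightarrow> 0 < W p $$ (i, j) \<Longrightarrow> \<beta> \<le> W p $$ (i, j)"
    using weight_bounds by metis
  have dis0: "0 \<le> disagreement s" if "0 < s" for s using disagreement_nonneg that by simp
  have U'0: "U' s \<le> 0" if s: "0 < s" "s \<notin> range t" for s
  proof -
    have "0 \<le> \<kappa> * V s" using E(3) \<kappa> by simp
    thus ?thesis using U'_le[OF s] dis0[OF s(1)] perturbation_nonneg[of s] by linarith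
  qed
  have dist2_cont: "continuous_on {0..} (dist2 i j)" if "i < N" "j < N" for i j
    unfolding dist2_def[abs_def]
    by (intro continuous_on_scalar_prod[of _ n] vec_continuous_on_minus) (use \<eta>(1) cont(1) that in auto)
  have step: "\<tau> \<le> t (Suc l) - t l" for l using switching by (simp add: switching_signal_def)
  define K1 where "K1 = exp T * (2 * C + 1 / ((\<beta> / 2) * \<tau>))"
  define K2 where "K2 = exp T * (0 + 1 / (\<kappa> * \<tau>))"
  have K: "0 \<le> K1" "0 \<le> K2" using C \<beta>(1) \<kappa> \<tau>_pos by (auto simp: K1_def K2_def)

  have edge: "dist2 i j (t l) \<le> K1 * (U (t k) - U (t l))"
    if kl: "k < l" "t l - t k \<le> T" and ij: "i < N" "j < N"
      and e: "t e \<in> {t k..<t l}" "0 < W (\<sigma> (t e)) $$ (i, j)" for k l e i j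
  proof -
    have "e < l" using e(1) switching_instants_mono[OF switching, of l e] by (cases "e < l") auto
    hence tl: "t (Suc e) \<le> t l" using switching_instants_mono[OF switching] by simp
    have tk: "0 \<le> t k" by (rule t_nonneg)
    have w\<beta>: "\<beta> \<le> W (\<sigma> (t e)) $$ (i, j)" by (rule \<beta>(2)[OF \<sigma>_mode[OF t_nonneg] ij e(2)])
    have "dist2 i j (t l) \<le> exp (t l - t k) * (2 * C + 1 / ((\<beta> / 2) * \<tau>)) * (U (t k) - U (t l))"
    proof (rule endpoint_le_energy_drop[where S = "range t" and p = "t e" and q = "t (Suc e)" and U' = U' and d' = "d' i j"])
      show "finite (range t \<inter> {t k..t l})" by (rule finite_switching_instants[OF switching])
      show "t k \<le> t e" using e(1) by simp
      show "\<tau> \<le> t (Suc e) - t e" by (rule step)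
      thus "t e < t (Suc e)" using \<tau>_pos by linarith
      show "continuous_on {t k..t l} U" by (rule continuous_on_subset[OF E(1)]) (use tk in auto)
      show "continuous_on {t k..t l} (dist2 i j)" by (rule continuous_on_subset[OF dist2_cont[OF ij]]) (use tk in auto)
      fix s assume s: "s \<notin> range t"
      { assume "t k < s" "s < t l"
        hence s0: "0 < s" using tk by simp
        show "(U has_real_derivative U' s) (at s)" by (rule U'[OF s0 s])
        show "(dist2 i j has_real_derivative d' i j s) (at s)" by (rule d'[OF ij s0 s])
        show "U' s \<le> 0" by (rule U'0[OF s0 s])
        have "0 \<le> \<kappa> * V s" using E(3) \<kappa> by simp
        hence "disagreement s + perturbation s \<le> - 2 * U' s"
          using U'_le[OF s0 s] perturbation_nonneg[of s] by linarith
        hence "C * (disagreement s + perturbation s) \<le> C * (- 2 * U' s)" using C by (rule mult_left_mono)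
        thus "d' i j s \<le> dist2 i j s - 2 * C * U' s" using d'_le[OF ij s0 s] by simp }
      assume se: "t e < s" "s < t (Suc e)"
      have s0: "0 < s" using se(1) t_nonneg[of e] by simp
      have \<sigma>e: "\<sigma> s = \<sigma> (t e)" using switching se unfolding switching_signal_def by auto
      have "\<beta> * dist2 i j s \<le> W (\<sigma> s) $$ (i, j) * dist2 i j s"
        using w\<beta> dist2_nonneg unfolding \<sigma>e by (intro mult_right_mono)
      also have "\<dots> \<le> disagreement s" using s0 by (intro disagreement_ge_edge ij) simp
      finally have "\<beta> * dist2 i j s \<le> disagreement s" .
      moreover have "0 \<le> \<kappa> * V s" using E(3) \<kappa> by simp
      ultimately show "U' s \<le> - (\<beta> / 2) * dist2 i j s"
        using U'_le[OF s0 s] perturbation_nonneg[of s] by simp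
    qed (use tl \<tau>_pos dist2_nonneg \<beta>(1) C in auto)
    also have "\<dots> \<le> K1 * (U (t k) - U (t l))"
      unfolding K1_def using kl C \<beta>(1) \<tau>_pos mono[OF tk, of "t l"] switching_instants_mono[OF switching, of k l]
      by (intro mult_right_mono) auto
    finally show ?thesis .
  qed

  have V_drop: "V (t l) \<le> K2 * (U (t k) - U (t l))" if kl: "k < l" "t l - t k \<le> T" for k l
  proof -
    have tk: "0 \<le> t k" by (rule t_nonneg)
    have "t (Suc k) \<le> t l" using switching_instants_mono[OF switching, of "Suc k" l] kl(1) by simp
    hence \<tau>kl: "\<tau> \<le> t l - t k" using step[of k] by linarith
    have "V (t l) \<le> exp (t l - t k) * (0 + 1 / (\<kappa> * \<tau>)) * (U (t k) - U (t l))"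
    proof (rule endpoint_le_energy_drop[where S = "range t" and p = "t k" and q = "t l" and U' = U' and d' = V'])
      show "finite (range t \<inter> {t k..t l})" by (rule finite_switching_instants[OF switching])
      show "continuous_on {t k..t l} U" by (rule continuous_on_subset[OF E(1)]) (use tk in auto)
      show "continuous_on {t k..t l} V" by (rule continuous_on_subset[OF E(2)]) (use tk in auto)
      fix s assume "t k < s" "s < t l" and s: "s \<notin> range t"
      hence s0: "0 < s" using tk by simp
      show "(U has_real_derivative U' s) (at s)" by (rule U'[OF s0 s])
      show "(V has_real_derivative V' s) (at s)" by (rule V'[OF s0 s])
      show "U' s \<le> 0" by (rule U'0[OF s0 s])
      show "V' s \<le> V s - 0 * U' s" using V'_le[OF s0 s] E(3)[of s] by simp
      show "U' s \<le> - \<kappa> * V s" using U'_le[OF s0 s] dis0[OF s0] perturbation_nonneg[of s] by simp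
    qed (use \<tau>kl \<tau>_pos \<kappa> E(3) in auto)
    also have "\<dots> \<le> K2 * (U (t k) - U (t l))"
      unfolding K2_def using kl \<kappa> \<tau>_pos mono[OF tk, of "t l"] switching_instants_mono[OF switching, of k l]
      by (intro mult_right_mono) auto
    finally show ?thesis .
  qed

  have path: "dist2 i j (t l) \<le> 4 ^ (N * N) * K1 * (U (t k) - U (t l))"
    if kl: "k < l" "t l - t k \<le> T" and c: "connected (with_proj (union_graph N G \<sigma> t (t k) (t l)))"
      and ij: "i < N" "j < N" for k l i j
  proof -
    define R where "R = {(u, v). u < N \<and> v < N \<and> (\<exists>e. t e \<in> {t k..<t l} \<and> 0 < W (\<sigma> (t e)) $$ (u, v))}"
    have sub: "R \<subseteq> {..<N} \<times> {..<N}" by (auto simp: R_def)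
    have fin: "finite R" by (rule finite_subset[OF sub]) simp
    have card: "card R \<le> N * N" using card_mono[OF _ sub] by simp
    have "(i, j) \<in> R\<^sup>*"
      unfolding R_def using graphs[OF \<sigma>_mode[OF t_nonneg]] weights[OF \<sigma>_mode[OF t_nonneg]]
      by (rule union_graph_connected_imp_weighted_paths[OF c]) (use ij in auto)
    then obtain m where m: "m \<le> N * N" "(i, j) \<in> R ^^ m" using rtrancl_imp_short_path[OF fin _ card] by blast
    define b where "b = K1 * (U (t k) - U (t l))"
    have b: "0 \<le> b"
      unfolding b_def using K mono[OF t_nonneg[of k], of "t l"] switching_instants_mono[OF switching, of k l] kl(1) by simp
    have "dist2 i j (t l) \<le> 4 ^ m * b"
      using m(2)
    proof (induction m arbitrary: j)
      case 0
      thus ?case using b ij(1) \<eta>(1)[OF ij(1), of "t l"] by (simp add: dist2_def)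
    next
      case (Suc m)
      then obtain v where v: "(i, v) \<in> R ^^ m" "(v, j) \<in> R" by auto
      then obtain e where e: "v < N" "j < N" "t e \<in> {t k..<t l}" "0 < W (\<sigma> (t e)) $$ (v, j)" by (auto simp: R_def)
      have "dist2 v j (t l) \<le> b" unfolding b_def by (rule edge[OF kl e])
      moreover have "b \<le> 4 ^ m * b" using b by (simp add: mult_le_cancel_right1)
      ultimately show ?case
        using Suc.IH[OF v(1)] dist2_triangle[OF ij(1) e(1,2), of "t l"] by simp
    qed
    also have "\<dots> \<le> 4 ^ (N * N) * b" using b m(1) by (intro mult_right_mono power_increasing) auto
    finally show ?thesis by (simp add: b_def mult.assoc)
  qed
  show ?thesis
  proof (rule that[of "4 ^ (N * N) * K1 + K2"])
    fix k l i j assume kl: "k < l" "t l - t k \<le> T"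
    have \<delta>: "0 \<le> U (t k) - U (t l)"
      using mono[OF t_nonneg[of k], of "t l"] switching_instants_mono[OF switching, of k l] kl(1) by simp
    have nn: "0 \<le> K2 * (U (t k) - U (t l))" "0 \<le> 4 ^ (N * N) * K1 * (U (t k) - U (t l))" using K \<delta> by auto
    show "V (t l) \<le> (4 ^ (N * N) * K1 + K2) * (U (t k) - U (t l))"
      using V_drop[OF kl] nn by (simp add: algebra_simps)
    assume "connected (with_proj (union_graph N G \<sigma> t (t k) (t l)))" "i < N" "j < N"
    from path[OF kl this] show "dist2 i j (t l) \<le> (4 ^ (N * N) * K1 + K2) * (U (t k) - U (t l))"
      using nn by (simp add: algebra_simps)
  qed (use K in simp)
qed

text \<open>
  By \<open>window_contraction\<close> and \<open>agreement_imp_small\<close> the energy at the end of a window is at most \<open>C\<close>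
  times the loss \<open>U(a) - U(b)\<close>, hence at most \<open>C / (1 + C)\<close> times the energy at its beginning.
\<close>

theorem exponential_decay:
  "\<exists>c\<ge>0. \<exists>\<rho>>0. \<forall>i<N. \<forall>s\<ge>0. \<omega> i s \<bullet> \<omega> i s + \<eta> i s \<bullet> \<eta> i s \<le> c * exp (- \<rho> * s)"
proof -
  obtain U V U' V' \<kappa> C0 C1 where dis: "dissipative U V U' V' \<kappa>"
    and C0: "0 \<le> C0" and C1: "0 \<le> C1" and U0: "\<And>s. 0 \<le> U s"
    and U_up: "\<And>s. U s \<le> C0 * ((\<Sum>j<N. \<eta> j s \<bullet> \<eta> j s) + V s)"
    and U_lo: "\<And>i s. i < N \<Longrightarrow> \<omega> i s \<bullet> \<omega> i s + \<eta> i s \<bullet> \<eta> i s \<le> C1 * U s"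
    by (rule energy_function) (rule that; assumption)
  have \<kappa>: "0 < \<kappa>" and U_cont: "continuous_on {0..} U" and V0: "\<And>s. 0 \<le> V s"
    using dis unfolding dissipative_def by blast+
  note D = dis[unfolded dissipative_def, THEN conjunct2, THEN conjunct2, THEN conjunct2, THEN conjunct2, rule_format]
  note U' = D[THEN conjunct1] and U'_le = D[THEN conjunct2, THEN conjunct2, THEN conjunct1]
  have mono: "U y \<le> U x" if xy: "0 \<le> x" "x \<le> y" for x y
  proof (rule nonincreasing_off_finite[where f = U and S = "range t"])
    show "finite (range t \<inter> {x<..<y})"
      by (rule finite_subset[OF _ finite_switching_instants[OF switching, of x y]]) auto
    show "continuous_on {x..y} U" by (rule continuous_on_subset[OF U_cont]) (use xy in auto)
    fix s assume "x < s" "s < y" and s: "s \<notin> range t"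
    hence s0: "0 < s" using xy by simp
    have "0 \<le> disagreement s" using disagreement_nonneg s0 by simp
    moreover have "0 \<le> \<kappa> * V s" using V0 \<kappa> by simp
    ultimately have "U' s \<le> 0" using U'_le[OF s0 s] perturbation_nonneg[of s] by linarith
    thus "\<exists>z. (U has_real_derivative z) (at s) \<and> z \<le> 0" using U'[OF s0 s] by blast
  qed (use xy in auto)
  obtain jk Tc where jk: "strict_mono jk" "t (jk 0) = 0"
    and win: "\<And>k. \<tau> \<le> t (jk (Suc k)) - t (jk k)" "\<And>k. t (jk (Suc k)) - t (jk k) \<le> Tc"
    and con: "\<And>k. connected (with_proj (union_graph N G \<sigma> t (t (jk k)) (t (jk (Suc k)))))"
    using conn unfolding jointly_connected_def by blast
  obtain K where K: "0 \<le> K"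
    and dK: "\<And>k l i j. k < l \<Longrightarrow> t l - t k \<le> Tc \<Longrightarrow>
      connected (with_proj (union_graph N G \<sigma> t (t k) (t l))) \<Longrightarrow> i < N \<Longrightarrow> j < N \<Longrightarrow>
      dist2 i j (t l) \<le> K * (U (t k) - U (t l))"
    and VK: "\<And>k l. k < l \<Longrightarrow> t l - t k \<le> Tc \<Longrightarrow> V (t l) \<le> K * (U (t k) - U (t l))"
    by (rule window_contraction[OF dis mono, of Tc]) (assumption+, (rule that; assumption))
  obtain c where c: "0 \<le> c" "\<And>j s. j < N \<Longrightarrow> \<eta> j s \<bullet> \<eta> j s \<le> c * (\<Sum>i<N. dist2 j i s)"
    using agreement_imp_small by blast
  define C where "C = C0 * (real N * (c * (real N * K)) + K)"
  have C: "0 \<le> C" using C0 c(1) K by (simp add: C_def)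
  define q where "q = C / (1 + C)"
  have q: "q < 1" using C by (simp add: q_def field_simps)
  have contr: "U (t (jk (Suc k))) \<le> q * U (t (jk k))" for k
  proof -
    have lt: "jk k < jk (Suc k)" using jk(1) by (simp add: strict_mono_def)
    let ?a = "t (jk k)" and ?b = "t (jk (Suc k))"
    define \<delta> where "\<delta> = U ?a - U ?b"
    have "(\<Sum>j<N. \<eta> j ?b \<bullet> \<eta> j ?b) \<le> (\<Sum>j<N. c * (\<Sum>i<N. K * \<delta>))"
    proof (rule sum_mono)
      fix j assume "j \<in> {..<N}"
      hence j: "j < N" by simp
      have "\<eta> j ?b \<bullet> \<eta> j ?b \<le> c * (\<Sum>i<N. dist2 j i ?b)" by (rule c(2)[OF j])
      also have "\<dots> \<le> c * (\<Sum>i<N. K * \<delta>)"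
        using c(1) dK[OF lt win(2) con j] by (intro mult_left_mono sum_mono) (auto simp: \<delta>_def)
      finally show "\<eta> j ?b \<bullet> \<eta> j ?b \<le> c * (\<Sum>i<N. K * \<delta>)" .
    qed
    hence "(\<Sum>j<N. \<eta> j ?b \<bullet> \<eta> j ?b) + V ?b \<le> (real N * (c * (real N * K)) + K) * \<delta>"
      using VK[OF lt win(2)] by (simp add: \<delta>_def algebra_simps)
    hence "C0 * ((\<Sum>j<N. \<eta> j ?b \<bullet> \<eta> j ?b) + V ?b) \<le> C * \<delta>"
      unfolding C_def mult.assoc[of C0] using C0 by (rule mult_left_mono)
    hence "U ?b \<le> C * \<delta>" using U_up[of ?b] by linarith
    hence "(1 + C) * U ?b \<le> C * U ?a" by (simp add: \<delta>_def algebra_simps)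
    thus ?thesis using C by (simp add: q_def field_simps)
  qed
  obtain c' \<rho> where c': "0 \<le> c'" "0 < \<rho>" "\<And>s. 0 \<le> s \<Longrightarrow> U s \<le> c' * exp (- \<rho> * s)"
    using geometric_decay_imp_exponential[of U "\<lambda>k. t (jk k)" \<tau> Tc q, OF U0 mono jk(2) win \<tau>_pos contr q] by blast
  have "\<omega> i s \<bullet> \<omega> i s + \<eta> i s \<bullet> \<eta> i s \<le> (C1 * c') * exp (- \<rho> * s)" if "i < N" "0 \<le> s" for i s
    using U_lo[OF that(1), of s] mult_left_mono[OF c'(3)[OF that(2)] C1] by (simp add: mult.assoc)
  thus ?thesis using C1 c'(1,2) by (intro exI[of _ "C1 * c'"] conjI exI[of _ \<rho>]) auto
qed

end

section \<open>From trajectories to the error system\<close>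

lemma local_observer_eq:
  assumes "\<And>j. j < N \<Longrightarrow> d j \<in> carrier_vec n"
  shows "local_observer n N A C L M \<gamma> W i p \<xi> y d
    = A *\<^sub>v \<xi> + L i *\<^sub>v (y - C i *\<^sub>v \<xi>) + \<gamma> i \<cdot>\<^sub>v (M i *\<^sub>v vsum n N (\<lambda>j. W p $$ (i, j) \<cdot>\<^sub>v d j))"
  unfolding local_observer_def using assms by (subst finsum_vec_eq_vsum) auto

lemma weighted_adjacency_nonedge:
  assumes "weighted_adjacency N G W" "i < N" "j < N" "(j, i) \<notin> parcs G"
  shows "W $$ (i, j) = 0"
proof (cases "i = j")
  case False
  hence "if (j, i) \<in> parcs G then W $$ (i, j) > 0 else W $$ (i, j) = 0"
    using assms unfolding weighted_adjacency_def by blast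
  thus ?thesis using assms(4) by simp
qed (use assms in \<open>simp add: weighted_adjacency_def\<close>)

lemma local_linear_map_local_observer:
  assumes A: "A \<in> carrier_mat n n" and C: "C i \<in> carrier_mat m n" and L: "L i \<in> carrier_mat n m"
    and M: "M i \<in> carrier_mat n n" and W: "weighted_adjacency N G (W p)" and i: "i < N"
  shows "local_linear_map n m N {j. j < N \<and> (j, i) \<in> parcs G} (local_observer n N A C L M \<gamma> W i p)"
  unfolding local_linear_map_def
proof (intro ballI conjI allI impI)
  fix \<xi> y :: "real vec" and d :: "nat \<Rightarrow> real vec"
  assume \<xi>: "\<xi> \<in> carrier_vec n" and y: "y \<in> carrier_vec m" and d: "d \<in> {..<N} \<rightarrow> carrier_vec n"
  have dim: "dim_vec (d j) = n" if "d \<in> {..<N} \<rightarrow> carrier_vec n" "j < N" for d :: "nat \<Rightarrow> real vec" and j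
  proof -
    have "d j \<in> carrier_vec n" using that by auto
    thus ?thesis by (rule carrier_vecD)
  qed
  define g where "g = (\<lambda>d. vsum n N (\<lambda>j. W p $$ (i, j) \<cdot>\<^sub>v d j))"
  define H where "H = (\<lambda>\<xi> y v. A *\<^sub>v \<xi> + L i *\<^sub>v (y - C i *\<^sub>v \<xi>) + \<gamma> i \<cdot>\<^sub>v (M i *\<^sub>v v))"
  have obs: "local_observer n N A C L M \<gamma> W i p \<xi> y d = H \<xi> y (g d)"
    if "d \<in> {..<N} \<rightarrow> carrier_vec n" for \<xi> y d
    unfolding H_def g_def by (rule local_observer_eq) (use that in auto)
  have g: "g d \<in> carrier_vec n" for d by (simp add: g_def)
  have parts: "A *\<^sub>v \<xi> \<in> carrier_vec n" "C i *\<^sub>v \<xi> \<in> carrier_vec m" "y - C i *\<^sub>v \<xi> \<in> carrier_vec m"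
    "L i *\<^sub>v (y - C i *\<^sub>v \<xi>) \<in> carrier_vec n" "M i *\<^sub>v v \<in> carrier_vec n"
    if "\<xi> \<in> carrier_vec n" "y \<in> carrier_vec m" "v \<in> carrier_vec n" for \<xi> y v
    using A C L M that by auto
  have H: "H \<xi> y v \<in> carrier_vec n" if "\<xi> \<in> carrier_vec n" "y \<in> carrier_vec m" "v \<in> carrier_vec n" for \<xi> y v
    unfolding H_def using parts[OF that] by simp
  show "local_observer n N A C L M \<gamma> W i p \<xi> y d \<in> carrier_vec n"
    unfolding obs[OF d] by (rule H[OF \<xi> y g])
  show "local_observer n N A C L M \<gamma> W i p (c \<cdot>\<^sub>v \<xi>) (c \<cdot>\<^sub>v y) (\<lambda>j. c \<cdot>\<^sub>v d j)
      = c \<cdot>\<^sub>v local_observer n N A C L M \<gamma> W i p \<xi> y d" for c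
  proof -
    have cd: "(\<lambda>j. c \<cdot>\<^sub>v d j) \<in> {..<N} \<rightarrow> carrier_vec n" using d by auto
    have gc: "g (\<lambda>j. c \<cdot>\<^sub>v d j) = c \<cdot>\<^sub>v g d"
      by (rule eq_vecI) (use dim[OF d] in \<open>auto simp: g_def vsum_def sum_distrib_left mult_ac intro!: sum.cong\<close>)
    have "c \<cdot>\<^sub>v y - c \<cdot>\<^sub>v (C i *\<^sub>v \<xi>) = c \<cdot>\<^sub>v (y - C i *\<^sub>v \<xi>)"
      using y carrier_matD[OF C] by (intro eq_vecI) (auto simp: right_diff_distrib)
    hence "H (c \<cdot>\<^sub>v \<xi>) (c \<cdot>\<^sub>v y) (c \<cdot>\<^sub>v g d)
        = c \<cdot>\<^sub>v (A *\<^sub>v \<xi>) + c \<cdot>\<^sub>v (L i *\<^sub>v (y - C i *\<^sub>v \<xi>)) + \<gamma> i \<cdot>\<^sub>v (c \<cdot>\<^sub>v (M i *\<^sub>v g d))"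
      unfolding H_def mult_mat_vec[OF A \<xi>] mult_mat_vec[OF C \<xi>] mult_mat_vec[OF M g]
      using mult_mat_vec[OF L parts(3)[OF \<xi> y g], of c] by simp
    also have "\<dots> = c \<cdot>\<^sub>v H \<xi> y (g d)"
      unfolding H_def using parts[OF \<xi> y g] carrier_matD[OF A] carrier_matD[OF L] carrier_matD[OF M]
      by (intro eq_vecI) (auto simp: algebra_simps)
    finally show ?thesis unfolding obs[OF d] obs[OF cd] gc .
  qed
  show "local_observer n N A C L M \<gamma> W i p (\<xi> + \<xi>') (y + y') (\<lambda>j. d j + d' j)
      = local_observer n N A C L M \<gamma> W i p \<xi> y d + local_observer n N A C L M \<gamma> W i p \<xi>' y' d'"
    if \<xi>': "\<xi>' \<in> carrier_vec n" and y': "y' \<in> carrier_vec m" and d': "d' \<in> {..<N} \<rightarrow> carrier_vec n" for \<xi>' y' d'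
  proof -
    have dd: "(\<lambda>j. d j + d' j) \<in> {..<N} \<rightarrow> carrier_vec n" using d d' by (auto intro!: add_carrier_vec)
    note dims = dim[OF d] dim[OF d']
    have gd: "g (\<lambda>j. d j + d' j) = g d + g d'"
    proof (rule eq_vecI)
      fix k assume "k < dim_vec (g d + g d')"
      hence k: "k < n" by (simp add: g_def vsum_def)
      have "(\<Sum>j<N. (W p $$ (i, j) \<cdot>\<^sub>v (d j + d' j)) $ k)
          = (\<Sum>j<N. (W p $$ (i, j) \<cdot>\<^sub>v d j) $ k + (W p $$ (i, j) \<cdot>\<^sub>v d' j) $ k)"
        using dims k by (intro sum.cong refl) (simp add: distrib_left)
      thus "g (\<lambda>j. d j + d' j) $ k = (g d + g d') $ k"
        using k by (simp add: g_def vsum_def sum.distrib)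
    qed (simp add: g_def vsum_def)
    have "y + y' - (C i *\<^sub>v \<xi> + C i *\<^sub>v \<xi>') = (y - C i *\<^sub>v \<xi>) + (y' - C i *\<^sub>v \<xi>')"
      using y y' carrier_matD[OF C] by (intro eq_vecI) auto
    hence "H (\<xi> + \<xi>') (y + y') (g d + g d') = (A *\<^sub>v \<xi> + A *\<^sub>v \<xi>')
        + (L i *\<^sub>v (y - C i *\<^sub>v \<xi>) + L i *\<^sub>v (y' - C i *\<^sub>v \<xi>')) + \<gamma> i \<cdot>\<^sub>v (M i *\<^sub>v g d + M i *\<^sub>v g d')"
      unfolding H_def mult_add_distrib_mat_vec[OF A \<xi> \<xi>'] mult_add_distrib_mat_vec[OF C \<xi> \<xi>'] mult_add_distrib_mat_vec[OF M g g]
      using mult_add_distrib_mat_vec[OF L parts(3)[OF \<xi> y g] parts(3)[OF \<xi>' y' g]] by simp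
    also have "\<dots> = H \<xi> y (g d) + H \<xi>' y' (g d')"
      unfolding H_def using carrier_matD[OF A] carrier_matD[OF L] carrier_matD[OF M]
      by (intro eq_vecI) (auto simp: algebra_simps)
    finally show ?thesis unfolding obs[OF d] obs[OF d'] obs[OF dd] gd .
  qed
  show "local_observer n N A C L M \<gamma> W i p \<xi> y d = local_observer n N A C L M \<gamma> W i p \<xi> y d'"
    if d': "d' \<in> {..<N} \<rightarrow> carrier_vec n" and eq: "\<forall>j\<in>{j. j < N \<and> (j, i) \<in> parcs G}. d j = d' j" for d'
  proof -
    note dims = dim[OF d] dim[OF d']
    have "W p $$ (i, j) \<cdot>\<^sub>v d j = W p $$ (i, j) \<cdot>\<^sub>v d' j" if j: "j < N" for j
    proof (cases "(j, i) \<in> parcs G")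
      case True
      thus ?thesis using eq j by simp
    next
      case False
      hence "W p $$ (i, j) = 0" by (rule weighted_adjacency_nonedge[OF W i j])
      thus ?thesis using dims[OF j] by (intro eq_vecI) auto
    qed
    hence "g d = g d'"
      unfolding g_def vsum_def by (intro arg_cong[where f = "vec n"] ext sum.cong) auto
    thus ?thesis unfolding obs[OF d] obs[OF d'] by simp
  qed
qed

lemma local_observer_minus_plant:
  assumes A: "A \<in> carrier_mat n n" and C: "C i \<in> carrier_mat m n" and L: "L i \<in> carrier_mat n m"
    and M: "M i \<in> carrier_mat n n" and \<xi>: "\<xi> \<in> carrier_vec n" and x: "x \<in> carrier_vec n"
    and d: "\<And>j. j < N \<Longrightarrow> d j \<in> carrier_vec n"
  shows "local_observer n N A C L M \<gamma> W i p \<xi> (C i *\<^sub>v x) d - A *\<^sub>v x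
    = (A *\<^sub>v (\<xi> - x) - L i *\<^sub>v (C i *\<^sub>v (\<xi> - x))) + \<gamma> i \<cdot>\<^sub>v (M i *\<^sub>v vsum n N (\<lambda>j. W p $$ (i, j) \<cdot>\<^sub>v d j))"
proof -
  have C\<xi>: "C i *\<^sub>v \<xi> \<in> carrier_vec m" and Cx: "C i *\<^sub>v x \<in> carrier_vec m" using C \<xi> x by auto
  have eq: "local_observer n N A C L M \<gamma> W i p \<xi> (C i *\<^sub>v x) d = A *\<^sub>v \<xi> + L i *\<^sub>v (C i *\<^sub>v x - C i *\<^sub>v \<xi>)
      + \<gamma> i \<cdot>\<^sub>v (M i *\<^sub>v vsum n N (\<lambda>j. W p $$ (i, j) \<cdot>\<^sub>v d j))"
    by (rule local_observer_eq) (rule d)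
  show ?thesis
    unfolding eq mult_minus_distrib_mat_vec[OF A \<xi> x] mult_minus_distrib_mat_vec[OF C \<xi> x]
      mult_minus_distrib_mat_vec[OF L C\<xi> Cx] mult_minus_distrib_mat_vec[OF L Cx C\<xi>]
    using carrier_matD[OF A] carrier_matD[OF L] carrier_matD[OF M] by (intro eq_vecI) auto
qed

lemma jointly_unobservable_trivial:
  assumes A: "A \<in> carrier_mat n n" and C: "\<And>i. i < N \<Longrightarrow> C i \<in> carrier_mat (m i) n"
    and obs: "observable n (block_col n (map C [0..<N])) A" and v: "v \<in> carrier_vec n"
    and zero: "\<And>i k. i < N \<Longrightarrow> k < n \<Longrightarrow> C i *\<^sub>v (A ^\<^sub>m k *\<^sub>v v) = 0\<^sub>v (m i)"
  shows "v = 0\<^sub>v n"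
proof -
  define B where "B = block_col n (map C [0..<N])"
  have B: "B \<in> carrier_mat (dim_row B) n" by (intro carrier_matI) (simp_all add: B_def block_col_def)
  then obtain l where B: "B \<in> carrier_mat l n" by blast
  have C_dim: "dim_row (C i) = m i" "dim_col (C i) = n" if "i < N" for i using C[OF that] by auto
  have "B *\<^sub>v (A ^\<^sub>m k *\<^sub>v v) = 0\<^sub>v l" if k: "k < n" for k
  proof -
    have "A ^\<^sub>m k *\<^sub>v v \<in> carrier_vec n" using A v by (intro mult_mat_vec_carrier[of _ n n]) auto
    hence "B *\<^sub>v (A ^\<^sub>m k *\<^sub>v v) = 0\<^sub>v (dim_row B)"
      unfolding B_def using C_dim zero[OF _ k] by (subst block_col_mult_vec_eq_0) auto
    thus ?thesis using B by simp
  qed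
  hence z: "obs_mat n B A *\<^sub>v v = 0\<^sub>v (dim_row (obs_mat n B A))"
    by (subst obs_mat_mult_vec_eq_0[OF B A v]) simp
  have "mat_rank (obs_mat n B A) = n" using obs by (simp add: observable_def B_def)
  thus ?thesis
    by (rule full_rank_imp_injective[OF carrier_matI[OF refl dim_col_obs_mat] _ v z])
qed

text \<open>
  The transfer from trajectories to \<open>observer_error\<close>. Trajectories are vectors of dimension \<open>n\<close> only at
  nonnegative times, so the error \<open>e\<close> is built from their entries, which gives a curve of such vectors
  on all of \<open>\<real>\<close>.
\<close>

lemma decay_of_trajectory_errors:
  assumes A: "A \<in> carrier_mat n n"
    and C: "\<And>i. i < N \<Longrightarrow> C i \<in> carrier_mat (m i) n"
    and switching: "switching_signal n0 \<sigma> t \<tau>"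
    and graphs: "\<And>p. p \<in> {1..n0} \<Longrightarrow> undirected_graph N (G p)"
    and weights: "\<And>p. p \<in> {1..n0} \<Longrightarrow> weighted_adjacency N (G p) (W p)"
    and obs: "observable n (block_col n (map C [0..<N])) A"
    and conn: "jointly_connected N G \<sigma> t \<tau>"
    and P: "P \<in> carrier_mat n n" "invertible_mat P"
    and skew: "skew_symmetric (mat_inv P * A * P)"
    and \<gamma>: "\<And>i. i < N \<Longrightarrow> \<gamma> i > 0"
    and gain: "\<And>i. i < N \<Longrightarrow> gain_design n (m i) A (C i) P (L i) (M i)"
    and x: "trajectory n (range t) (\<lambda>s. A *\<^sub>v x s) x"
    and xh: "\<And>i. i < N \<Longrightarrow> trajectory n (range t)
        (\<lambda>s. local_observer n N A C L M \<gamma> W i (\<sigma> s) (xh i s) (C i *\<^sub>v x s) (\<lambda>j. xh j s - xh i s)) (xh i)"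
    and i0: "i0 < N"
  shows "exp_to_zero (\<lambda>s. xh i0 s - x s)"
proof -
  define Q where "Q = mat_inv P"
  define S where "S = Q * A * P"
  have Q: "Q \<in> carrier_mat n n" "P * Q = 1\<^sub>m n" "Q * P = 1\<^sub>m n"
    unfolding Q_def by (rule mat_inv_props[OF P])+
  have S: "S \<in> carrier_mat n n" unfolding S_def using Q(1) A P(1) by (intro mult_carrier_mat[of _ n n]) auto
  have gd: "L i \<in> carrier_mat n (m i) \<and> M i \<in> carrier_mat n n \<and>
      (\<exists>r D E F. observability_coordinates n (m i) A (C i) P (L i) (M i) r D E F)" if "i < N" for i
    by (rule gain_design_decomposition[OF A C[OF that] P skew gain[OF that]])
  hence LM: "L i \<in> carrier_mat n (m i)" "M i \<in> carrier_mat n n" if "i < N" for i using that by auto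
  have "\<exists>r D E F. observability_coordinates n (m i) A (C i) P (L i) (M i) r D E F" if "i < N" for i
    using gd[OF that] by blast
  then obtain r D E F where
    "\<And>i. i < N \<Longrightarrow> observability_coordinates n (m i) A (C i) P (L i) (M i) (r i) (D i) (E i) (F i)"
    by metis
  note d = this[unfolded observability_coordinates_def Let_def, folded Q_def, folded S_def]
  have D: "D i \<in> carrier_mat n (r i)" and E: "E i \<in> carrier_mat n n" "transpose_mat (E i) = E i"
    and F: "F i \<in> carrier_mat (r i) (r i)" "Hurwitz (F i)" if "i < N" for i
    using d[OF that] by blast+
  have iso: "(D i *\<^sub>v v) \<bullet> (D i *\<^sub>v v) = v \<bullet> v" if "i < N" "v \<in> carrier_vec (r i)" for i v
    using d[OF that(1)] that(2) by blast
  have dec1: "D i *\<^sub>v (transpose_mat (D i) *\<^sub>v v) + E i *\<^sub>v v = v"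
    and dec2: "transpose_mat (D i) *\<^sub>v (E i *\<^sub>v v) = 0\<^sub>v (r i)"
    and dec3: "E i *\<^sub>v (E i *\<^sub>v v) = E i *\<^sub>v v" and dec4: "E i *\<^sub>v (S *\<^sub>v v) = S *\<^sub>v (E i *\<^sub>v v)"
    and dec5: "Q *\<^sub>v (M i *\<^sub>v v) = E i *\<^sub>v (Q *\<^sub>v v)"
    and dec6: "transpose_mat (D i) *\<^sub>v (S *\<^sub>v v - Q *\<^sub>v (L i *\<^sub>v (C i *\<^sub>v (P *\<^sub>v v)))) = F i *\<^sub>v (transpose_mat (D i) *\<^sub>v v)"
    and dec7: "E i *\<^sub>v v = v \<Longrightarrow> \<forall>k<n. C i *\<^sub>v (A ^\<^sub>m k *\<^sub>v (P *\<^sub>v v)) = 0\<^sub>v (m i)"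
    if "i < N" "v \<in> carrier_vec n" for i v
    using d[OF that(1)] that(2) by blast+
  have dec8: "E i *\<^sub>v (Q *\<^sub>v (L i *\<^sub>v y)) = 0\<^sub>v n" if "i < N" "y \<in> carrier_vec (m i)" for i y
    using d[OF that(1)] that(2) by blast
  have Dt: "transpose_mat (D i) \<in> carrier_mat (r i) n" if "i < N" for i using D[OF that] by simp

  define e where "e = (\<lambda>i u. vec n (\<lambda>k. xh i u $ k - x u $ k))"
  (* the error in the coordinates P and its unobservable and observable parts *)
  define \<epsilon> where "\<epsilon> = (\<lambda>i u. Q *\<^sub>v e i u)"
  define \<eta> where "\<eta> = (\<lambda>i u. E i *\<^sub>v \<epsilon> i u)"
  define w where "w = (\<lambda>i u. transpose_mat (D i) *\<^sub>v \<epsilon> i u)"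
  define \<omega> where "\<omega> = (\<lambda>i u. D i *\<^sub>v w i u)"
  have e: "e i u \<in> carrier_vec n" for i u by (simp add: e_def)
  have \<epsilon>: "\<epsilon> i u \<in> carrier_vec n" for i u using Q(1) e by (simp add: \<epsilon>_def)
  have \<eta>: "\<eta> i u \<in> carrier_vec n" and w: "w i u \<in> carrier_vec (r i)" and \<omega>: "\<omega> i u \<in> carrier_vec n" if "i < N" for i u
    using mult_mat_vec_carrier[OF E(1)[OF that] \<epsilon>] mult_mat_vec_carrier[OF Dt[OF that] \<epsilon>]
      mult_mat_vec_carrier[OF D[OF that] mult_mat_vec_carrier[OF Dt[OF that] \<epsilon>]]
    by (auto simp: \<eta>_def w_def \<omega>_def)
  have \<epsilon>_split: "\<omega> i u + \<eta> i u = \<epsilon> i u" if "i < N" for i u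
    unfolding \<omega>_def w_def \<eta>_def by (rule dec1[OF that \<epsilon>])
  have Pe: "P *\<^sub>v \<epsilon> i u = e i u" for i u
    unfolding \<epsilon>_def using assoc_mult_mat_vec[OF P(1) Q(1) e, of i u] Q(2) e by simp
  have x_carr: "x s \<in> carrier_vec n" if "0 \<le> s" for s using x that by (simp add: trajectory_def)
  have xh_carr: "xh i s \<in> carrier_vec n" if "i < N" "0 \<le> s" for i s using xh[OF that(1)] that by (simp add: trajectory_def)
  have e_eq: "e i s = xh i s - x s" if "i < N" "0 \<le> s" for i s
    using x_carr[OF that(2)] xh_carr[OF that] by (intro eq_vecI) (auto simp: e_def)

  have e_cont: "vec_continuous_on n {0..} (e i)" if "i < N" for i
    using x xh[OF that] unfolding trajectory_def vec_continuous_on_def e_def by (simp add: continuous_on_diff)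
  define g where "g = (\<lambda>i s. vsum n N (\<lambda>j. W (\<sigma> s) $$ (i, j) \<cdot>\<^sub>v (e j s - e i s)))"
  define e' where "e' = (\<lambda>i s. (A *\<^sub>v e i s - L i *\<^sub>v (C i *\<^sub>v e i s)) + \<gamma> i \<cdot>\<^sub>v (M i *\<^sub>v g i s))"
  have g: "g i s \<in> carrier_vec n" for i s by (simp add: g_def)
  have Ae: "A *\<^sub>v e i s \<in> carrier_vec n" and Ce: "C i *\<^sub>v e i s \<in> carrier_vec (m i)"
    and LCe: "L i *\<^sub>v (C i *\<^sub>v e i s) \<in> carrier_vec n" and Mg: "M i *\<^sub>v g i s \<in> carrier_vec n" if i: "i < N" for i s
    using A C[OF i] LM[OF i] e g by auto
  have e'_carr: "e' i s \<in> carrier_vec n" if "i < N" for i s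
    unfolding e'_def using Ae[OF that] LCe[OF that] Mg[OF that] by simp
  have e_deriv: "has_vec_deriv n (e i) (e' i s) s" if i: "i < N" and s: "0 < s" "s \<notin> range t" for i s
    unfolding has_vec_deriv_def
  proof (intro allI impI)
    fix k assume k: "k < n"
    have s0: "0 \<le> s" using s by simp
    have at: "at s within {0..} = at s" using s(1) by (intro at_within_open_subset[of s "{0<..}"]) auto
    let ?f = "local_observer n N A C L M \<gamma> W i (\<sigma> s) (xh i s) (C i *\<^sub>v x s) (\<lambda>j. xh j s - xh i s)"
    have dj: "xh j s - xh i s \<in> carrier_vec n" if "j < N" for j using xh_carr[OF that s0] xh_carr[OF i s0] by simp
    have "xh j s - xh i s = e j s - e i s" if "j < N" for j
      using x_carr[OF s0] xh_carr[OF that s0] xh_carr[OF i s0] by (intro eq_vecI) (auto simp: e_def)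
    hence gg: "vsum n N (\<lambda>j. W (\<sigma> s) $$ (i, j) \<cdot>\<^sub>v (xh j s - xh i s)) = g i s"
      unfolding g_def vsum_def by (intro arg_cong[where f = "vec n"] ext sum.cong) auto
    have "?f - A *\<^sub>v x s = e' i s"
      using local_observer_minus_plant[where C = C and L = L and M = M and i = i and W = W and p = "\<sigma> s"
          and \<gamma> = \<gamma> and N = N and d = "\<lambda>j. xh j s - xh i s",
          OF A C[OF i] LM[OF i] xh_carr[OF i s0] x_carr[OF s0] dj]
      unfolding gg e_eq[OF i s0, symmetric] e'_def .
    hence "e' i s $ k = ?f $ k - (A *\<^sub>v x s) $ k"
      using k carrier_matD[OF A] by (metis index_minus_vec(1) dim_mult_mat_vec)
    moreover have "((\<lambda>u. xh i u $ k - x u $ k) has_real_derivative ?f $ k - (A *\<^sub>v x s) $ k) (at s)"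
      using x xh[OF i] s0 s(2) k unfolding trajectory_def at[symmetric] by (intro DERIV_diff) auto
    ultimately show "((\<lambda>u. e i u $ k) has_real_derivative e' i s $ k) (at s)" using k by (simp add: e_def)
  qed
  have \<epsilon>_deriv: "has_vec_deriv n (\<epsilon> i) (Q *\<^sub>v e' i s) s" if i: "i < N" and s: "0 < s" "s \<notin> range t" for i s
    unfolding \<epsilon>_def[abs_def] by (rule has_vec_deriv_mult_mat[OF Q(1) e e'_carr[OF i] e_deriv[OF i s]])
  have Qe': "Q *\<^sub>v e' i s = (S *\<^sub>v \<epsilon> i s - Q *\<^sub>v (L i *\<^sub>v (C i *\<^sub>v (P *\<^sub>v \<epsilon> i s)))) + \<gamma> i \<cdot>\<^sub>v (E i *\<^sub>v (Q *\<^sub>v g i s))"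
    if i: "i < N" for i s
  proof -
    have QAe: "Q *\<^sub>v (A *\<^sub>v e i s) = S *\<^sub>v \<epsilon> i s"
    proof -
      have QA: "Q * A \<in> carrier_mat n n" using Q(1) A by simp
      show ?thesis
        unfolding S_def assoc_mult_mat_vec[OF QA P(1) \<epsilon>] Pe by (rule assoc_mult_mat_vec[OF Q(1) A e, symmetric])
    qed
    have 1: "A *\<^sub>v e i s - L i *\<^sub>v (C i *\<^sub>v e i s) \<in> carrier_vec n" using Ae[OF i] LCe[OF i] by simp
    have 2: "\<gamma> i \<cdot>\<^sub>v (M i *\<^sub>v g i s) \<in> carrier_vec n" using Mg[OF i] by simp
    show ?thesis
      unfolding e'_def mult_add_distrib_mat_vec[OF Q(1) 1 2] mult_minus_distrib_mat_vec[OF Q(1) Ae[OF i] LCe[OF i]]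
        mult_mat_vec[OF Q(1) Mg[OF i]] QAe dec5[OF i g] Pe ..
  qed
  have Qg: "Q *\<^sub>v g i s = vsum n N (\<lambda>j. W (\<sigma> s) $$ (i, j) \<cdot>\<^sub>v ((\<omega> j s + \<eta> j s) - (\<omega> i s + \<eta> i s)))" if i: "i < N" for i s
  proof -
    have "Q *\<^sub>v g i s = vsum n N (\<lambda>j. Q *\<^sub>v (W (\<sigma> s) $$ (i, j) \<cdot>\<^sub>v (e j s - e i s)))"
      unfolding g_def using e by (intro mult_mat_vsum[OF Q(1)]) simp
    also have "\<dots> = vsum n N (\<lambda>j. W (\<sigma> s) $$ (i, j) \<cdot>\<^sub>v (\<epsilon> j s - \<epsilon> i s))"
    proof -
      have "Q *\<^sub>v (a \<cdot>\<^sub>v (e j s - e i s)) = a \<cdot>\<^sub>v (\<epsilon> j s - \<epsilon> i s)" for a j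
        unfolding \<epsilon>_def mult_minus_distrib_mat_vec[OF Q(1) e e, symmetric] using e by (intro mult_mat_vec[OF Q(1)]) simp
      thus ?thesis by simp
    qed
    also have "\<dots> = vsum n N (\<lambda>j. W (\<sigma> s) $$ (i, j) \<cdot>\<^sub>v ((\<omega> j s + \<eta> j s) - (\<omega> i s + \<eta> i s)))"
      unfolding vsum_def using \<epsilon>_split i by (intro arg_cong[where f = "vec n"] ext sum.cong) auto
    finally show ?thesis .
  qed
  have parts: "S *\<^sub>v \<epsilon> i s \<in> carrier_vec n" "Q *\<^sub>v (L i *\<^sub>v (C i *\<^sub>v (P *\<^sub>v \<epsilon> i s))) \<in> carrier_vec n"
    "C i *\<^sub>v (P *\<^sub>v \<epsilon> i s) \<in> carrier_vec (m i)"
    "S *\<^sub>v \<epsilon> i s - Q *\<^sub>v (L i *\<^sub>v (C i *\<^sub>v (P *\<^sub>v \<epsilon> i s))) \<in> carrier_vec n"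
    "Q *\<^sub>v g i s \<in> carrier_vec n" "E i *\<^sub>v (Q *\<^sub>v g i s) \<in> carrier_vec n" if i: "i < N" for i s
  proof -
    show S\<epsilon>: "S *\<^sub>v \<epsilon> i s \<in> carrier_vec n" by (rule mult_mat_vec_carrier[OF S \<epsilon>])
    show "C i *\<^sub>v (P *\<^sub>v \<epsilon> i s) \<in> carrier_vec (m i)" unfolding Pe by (rule Ce[OF i])
    show QL: "Q *\<^sub>v (L i *\<^sub>v (C i *\<^sub>v (P *\<^sub>v \<epsilon> i s))) \<in> carrier_vec n"
      unfolding Pe by (rule mult_mat_vec_carrier[OF Q(1) LCe[OF i]])
    show "S *\<^sub>v \<epsilon> i s - Q *\<^sub>v (L i *\<^sub>v (C i *\<^sub>v (P *\<^sub>v \<epsilon> i s))) \<in> carrier_vec n" using S\<epsilon> QL by (rule minus_carrier_vec)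
    show Qg': "Q *\<^sub>v g i s \<in> carrier_vec n" by (rule mult_mat_vec_carrier[OF Q(1) g])
    show "E i *\<^sub>v (Q *\<^sub>v g i s) \<in> carrier_vec n" by (rule mult_mat_vec_carrier[OF E(1)[OF i] Qg'])
  qed

  interpret observer_error n N n0 r S E F \<gamma> G W \<sigma> t \<tau> \<eta> \<omega> w
  proof (unfold_locales)
    show "S \<in> carrier_mat n n" by (rule S)
    show "v \<bullet> (S *\<^sub>v v) = 0" if v: "v \<in> carrier_vec n" for v
    proof -
      have Sv: "S *\<^sub>v v \<in> carrier_vec n" using S v by simp
      have "transpose_mat S *\<^sub>v v = - (S *\<^sub>v v)"
        using skew v carrier_matD[OF S] unfolding skew_symmetric_def S_def[symmetric] Q_def[symmetric] by simp
      hence "- (S *\<^sub>v v) \<bullet> v = v \<bullet> (S *\<^sub>v v)" using transpose_vec_mult_scalar[OF S v v] by simp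
      moreover have "- (S *\<^sub>v v) \<bullet> v = - ((S *\<^sub>v v) \<bullet> v)" using v carrier_matD[OF S] by (intro scalar_prod_uminus_left) simp
      ultimately show ?thesis using comm_scalar_prod[OF Sv v] by simp
    qed
    show "E i \<in> carrier_mat n n" "transpose_mat (E i) = E i" "F i \<in> carrier_mat (r i) (r i)" "Hurwitz (F i)" "0 < \<gamma> i"
      if "i < N" for i using E F \<gamma> that by auto
    show "E i *\<^sub>v (E i *\<^sub>v v) = E i *\<^sub>v v" if "i < N" "v \<in> carrier_vec n" for i v by (rule dec3[OF that])
    show "v = 0\<^sub>v n" if v: "v \<in> carrier_vec n" and un: "\<And>i. i < N \<Longrightarrow> E i *\<^sub>v v = v" for v
    proof -
      have Pv: "P *\<^sub>v v \<in> carrier_vec n" using P(1) v by simp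
      have "P *\<^sub>v v = 0\<^sub>v n"
        by (rule jointly_unobservable_trivial[OF A C obs Pv]) (use dec7[OF _ v un] in auto)
      moreover have "Q *\<^sub>v (P *\<^sub>v v) = v" using assoc_mult_mat_vec[OF Q(1) P(1) v] Q(3) v by simp
      moreover have "Q *\<^sub>v 0\<^sub>v n = 0\<^sub>v n" using Q(1) by (intro eq_vecI) auto
      ultimately show ?thesis by simp
    qed
    show "switching_signal n0 \<sigma> t \<tau>" "jointly_connected N G \<sigma> t \<tau>" by (rule switching, rule conn)
    show "undirected_graph N (G p)" "weighted_adjacency N (G p) (W p)" if "p \<in> {1..n0}" for p
      using graphs[OF that] weights[OF that] by auto
    fix i s assume i: "i < N"
    show "\<eta> i s \<in> carrier_vec n" "\<omega> i s \<in> carrier_vec n" "w i s \<in> carrier_vec (r i)" by (rule \<eta>[OF i] \<omega>[OF i] w[OF i])+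
    show "E i *\<^sub>v \<eta> i s = \<eta> i s" unfolding \<eta>_def by (rule dec3[OF i \<epsilon>])
    show "\<omega> i s \<bullet> \<omega> i s = w i s \<bullet> w i s" unfolding \<omega>_def by (rule iso[OF i w[OF i]])
    have \<epsilon>_cont: "vec_continuous_on n {0..} (\<epsilon> i)"
      unfolding \<epsilon>_def[abs_def] by (rule vec_continuous_on_mult_mat[OF Q(1) e e_cont[OF i]])
    show "vec_continuous_on n {0..} (\<eta> i)"
      unfolding \<eta>_def[abs_def] by (rule vec_continuous_on_mult_mat[OF E(1)[OF i] \<epsilon> \<epsilon>_cont])
    show "vec_continuous_on (r i) {0..} (w i)"
      unfolding w_def[abs_def] by (rule vec_continuous_on_mult_mat[OF Dt[OF i] \<epsilon> \<epsilon>_cont])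
    assume s: "0 < s" "s \<notin> range t"
    have Qe'_carr: "Q *\<^sub>v e' i s \<in> carrier_vec n" by (rule mult_mat_vec_carrier[OF Q(1) e'_carr[OF i]])
    have \<gamma>g: "\<gamma> i \<cdot>\<^sub>v (E i *\<^sub>v (Q *\<^sub>v g i s)) \<in> carrier_vec n" using parts(6)[OF i] by simp
    have "transpose_mat (D i) *\<^sub>v (Q *\<^sub>v e' i s) = F i *\<^sub>v w i s"
    proof -
      have "F i *\<^sub>v w i s \<in> carrier_vec (r i)" by (rule mult_mat_vec_carrier[OF F(1)[OF i] w[OF i]])
      moreover have "\<gamma> i \<cdot>\<^sub>v 0\<^sub>v (r i) = 0\<^sub>v (r i)" by (intro eq_vecI) auto
      moreover have w_eq: "transpose_mat (D i) *\<^sub>v \<epsilon> i s = w i s" by (simp add: w_def)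
      ultimately show ?thesis
        unfolding Qe'[OF i] mult_add_distrib_mat_vec[OF Dt[OF i] parts(4)[OF i] \<gamma>g] dec6[OF i \<epsilon>]
          mult_mat_vec[OF Dt[OF i] parts(6)[OF i]] dec2[OF i parts(5)[OF i]] w_eq by simp
    qed
    with has_vec_deriv_mult_mat[OF Dt[OF i] \<epsilon> Qe'_carr \<epsilon>_deriv[OF i s]]
    show "has_vec_deriv (r i) (w i) (F i *\<^sub>v w i s) s" unfolding w_def[abs_def] by simp
    have "E i *\<^sub>v (Q *\<^sub>v e' i s) = S *\<^sub>v \<eta> i s + \<gamma> i \<cdot>\<^sub>v (E i *\<^sub>v (Q *\<^sub>v g i s))"
    proof -
      have "S *\<^sub>v \<eta> i s - 0\<^sub>v n = S *\<^sub>v \<eta> i s" using mult_mat_vec_carrier[OF S \<eta>[OF i]] by simp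
      moreover have \<eta>_eq: "E i *\<^sub>v \<epsilon> i s = \<eta> i s" by (simp add: \<eta>_def)
      ultimately show ?thesis
        unfolding Qe'[OF i] mult_add_distrib_mat_vec[OF E(1)[OF i] parts(4)[OF i] \<gamma>g]
          mult_minus_distrib_mat_vec[OF E(1)[OF i] parts(1,2)[OF i]] dec4[OF i \<epsilon>]
          mult_mat_vec[OF E(1)[OF i] parts(6)[OF i]] dec3[OF i parts(5)[OF i]]
          dec8[OF i parts(3)[OF i]] \<eta>_eq by simp
    qed
    moreover have "has_vec_deriv n (\<eta> i) (E i *\<^sub>v (Q *\<^sub>v e' i s)) s"
      unfolding \<eta>_def by (rule has_vec_deriv_mult_mat[OF E(1)[OF i] \<epsilon> Qe'_carr \<epsilon>_deriv[OF i s]])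
    ultimately show "has_vec_deriv n (\<eta> i) (S *\<^sub>v \<eta> i s + \<gamma> i \<cdot>\<^sub>v (E i *\<^sub>v
        vsum n N (\<lambda>j. W (\<sigma> s) $$ (i, j) \<cdot>\<^sub>v ((\<omega> j s + \<eta> j s) - (\<omega> i s + \<eta> i s))))) s"
      unfolding Qg[OF i, symmetric] by simp
  qed
  obtain c \<rho> where c: "0 \<le> c" "0 < \<rho>"
    "\<And>s. 0 \<le> s \<Longrightarrow> \<omega> i0 s \<bullet> \<omega> i0 s + \<eta> i0 s \<bullet> \<eta> i0 s \<le> c * exp (- \<rho> * s)"
    using exponential_decay i0 by blast
  obtain p where p: "0 \<le> p" "\<And>v. v \<in> carrier_vec n \<Longrightarrow> (P *\<^sub>v v) \<bullet> (P *\<^sub>v v) \<le> p * (v \<bullet> v)"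
    using matrix_bounded[OF P(1)] by blast
  have "L2_set (\<lambda>k. (xh i0 s - x s) $ k) {..<dim_vec (xh i0 s - x s)} \<le> sqrt (2 * p * c) * exp (- (\<rho> / 2) * s)"
    if s: "0 \<le> s" for s
  proof -
    have "(L2_set (\<lambda>k. (xh i0 s - x s) $ k) {..<dim_vec (xh i0 s - x s)})\<^sup>2 = e i0 s \<bullet> e i0 s"
      unfolding e_eq[OF i0 s, symmetric] using e[of i0 s]
      by (simp add: L2_set_def scalar_prod_self[of _ n] sum_nonneg)
    also have "\<dots> \<le> p * (\<epsilon> i0 s \<bullet> \<epsilon> i0 s)" using p(2)[OF \<epsilon>[of i0 s]] by (simp add: Pe)
    also have "\<dots> \<le> p * (2 * (\<omega> i0 s \<bullet> \<omega> i0 s) + 2 * (\<eta> i0 s \<bullet> \<eta> i0 s))"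
      unfolding \<epsilon>_split[OF i0, symmetric] using p(1) scalar_prod_add_self_le[OF \<omega>(1)[OF i0] \<eta>(1)[OF i0]]
      by (intro mult_left_mono) auto
    also have "\<dots> \<le> p * (2 * (c * exp (- \<rho> * s)))"
      using c(3)[OF s] p(1) by (intro mult_left_mono) auto
    also have "\<dots> = (sqrt (2 * p * c) * exp (- (\<rho> / 2) * s))\<^sup>2"
      using p(1) c(1) by (simp add: power_mult_distrib exp_double[symmetric])
    finally show ?thesis by (rule power2_le_imp_le) (use p(1) c(1) in simp)
  qed
  moreover have "0 \<le> sqrt (2 * p * c)" "0 < \<rho> / 2" using c p(1) by simp_all
  ultimately show ?thesis unfolding exp_to_zero_def by blast
qed

theorem theorem1:
  fixes n N n0 :: nat and m :: "nat \<Rightarrow> nat"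
    and A P :: "real mat" and C L M W :: "nat \<Rightarrow> real mat"
    and \<gamma> :: "nat \<Rightarrow> real"
    and G :: "nat \<Rightarrow> nat pair_pre_digraph"
    and \<sigma> :: "real \<Rightarrow> nat" and t :: "nat \<Rightarrow> real" and \<tau> :: real
  assumes "A \<in> carrier_mat n n"
    and "\<And>i. i < N \<Longrightarrow> C i \<in> carrier_mat (m i) n"
    and "switching_signal n0 \<sigma> t \<tau>"
    and "\<And>p. p \<in> {1..n0} \<Longrightarrow> undirected_graph N (G p)"
    and "\<And>p. p \<in> {1..n0} \<Longrightarrow> weighted_adjacency N (G p) (W p)"
    and "neutrally_stable A"
    and "observable n (block_col n (map C [0..<N])) A"
    and "jointly_connected N G \<sigma> t \<tau>"
    and "P \<in> carrier_mat n n" and "invertible_mat P"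
    and "skew_symmetric (mat_inv P * A * P)"
    and "\<And>i. i < N \<Longrightarrow> \<gamma> i > 0"
    and "\<And>i. i < N \<Longrightarrow> gain_design n (m i) A (C i) P (L i) (M i)"
  shows "solves_dist_exp_estimation n N m A C n0 G \<sigma> t (local_observer n N A C L M \<gamma> W)"
  unfolding solves_dist_exp_estimation_def
proof (intro conjI allI impI ballI)
  fix i p assume i: "i < N" and p: "p \<in> {1..n0}"
  have "L i \<in> carrier_mat n (m i)" "M i \<in> carrier_mat n n"
    using gain_design_decomposition[OF assms(1) assms(2)[OF i] assms(9-11) assms(13)[OF i]] by auto
  thus "local_linear_map n (m i) N {j. j < N \<and> (j, i) \<in> parcs (G p)} (local_observer n N A C L M \<gamma> W i p)"
    using local_linear_map_local_observer[where C = C and L = L and M = M and W = W and p = p, OF assms(1) assms(2)[OF i] _ _ assms(5)[OF p] i] by blast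
next
  fix x xh i
  assume tr: "trajectory n (range t) (\<lambda>s. A *\<^sub>v x s) x \<and>
    (\<forall>i<N. trajectory n (range t)
      (\<lambda>s. local_observer n N A C L M \<gamma> W i (\<sigma> s) (xh i s) (C i *\<^sub>v x s) (\<lambda>j. xh j s - xh i s)) (xh i))"
    and i: "i < N"
  show "exp_to_zero (\<lambda>s. xh i s - x s)"
    by (rule decay_of_trajectory_errors[OF assms(1-5,7-13) _ _ i]) (use tr in auto)
qed

end
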